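(* Let $a_1,\ldots,a_k\colon\mathbb{N}\to\mathbb{N}\cup\{0\}$ be completely additive functions such that: (i) $\{a_i(p):p\text{ prime}\}$ is finite for each $i\in\{1,\ldots,k\}$; (ii) for any subgroup $\Gamma\subset\mathbb{Z}^k$ with $\mathrm{rank}(\Gamma)<k$, the set $P_\Gamma=\{p\in\mathbb{P}:(a_1(p),\ldots,a_k(p))\notin\Gamma\}$ satisfies $\sum_{p\in P_\Gamma}1/p=\infty$. Then for any totally uniquely ergodic $(X,\mu,T_1,\ldots,T_k)$ one has $$\lim_{N\to\infty}\frac1N\sum_{n=1}^N f\big(T_1^{a_1(n)}\cdots T_k^{a_k(n)}x\big)=\int f\,d\mu$$ for every $f\in C(X)$ and every $x\in X$.
   Context: $\mathbb{N}=\{1,2,3,\ldots\}$ and $\mathbb{P}$ is the set of primes. A function $a$ on $\mathbb{N}$ is completely additive if $a(nm)=a(n)+a(m)$ for all $n,m\in\mathbb{N}$. $C(X)$ is the space of continuous complex-valued functions on $X$. Let $T_1,\ldots,T_k$ be commuting continuous maps on a compact metric space $X$ and $\mu$ a Borel probability measure on $X$. $(X,\mu,T_1,\ldots,T_k)$ is called totally uniquely ergodic if for all $m_1,\ldots,m_k\in\mathbb{N}$ the measure $\mu$ is the only Borel probability measure on $X$ that is invariant under $T_i^{m_i}$ for all $i=1,\ldots,k$. *)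

theory Defs
  imports
    "HOL-Analysis.Analysis"
    "HOL-Probability.Probability_Measure"
    "HOL-Algebra.Product_Groups"
    "HOL-Algebra.FiniteProduct"
    "HOL-Computational_Algebra.Primes"
    "HOL-Library.Extended_Nat"
begin

(* The condition ranges over positive integers only: the value at 0 is unconstrained. *)
definition completely_additive :: "(nat \<Rightarrow> nat) \<Rightarrow> bool" where
  "completely_additive a \<longleftrightarrow> (\<forall>m\<ge>1. \<forall>n\<ge>1. a (m * n) = a m + a n)"

(* The additive group of integer vectors, indexed by 1, ..., k.  Its elements are the
   functions that equal undefined outside {1..k}. *)
definition int_vec_group :: "nat \<Rightarrow> (nat \<Rightarrow> int) monoid" where
  "int_vec_group k = product_group {1..k} (\<lambda>_. integer_group)"

(* Linear independence over the integers in a commutative group written multiplicatively. *)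
definition int_independent :: "('a, 'b) monoid_scheme \<Rightarrow> 'a set \<Rightarrow> bool" where
  "int_independent G B \<longleftrightarrow>
     (\<forall>c :: 'a \<Rightarrow> int. (\<Otimes>\<^bsub>G\<^esub>b\<in>B. b [^]\<^bsub>G\<^esub> c b) = \<one>\<^bsub>G\<^esub> \<longrightarrow> (\<forall>b\<in>B. c b = 0))"

(* The rank of a subgroup H of a commutative group G: the largest size of an independent
   subset of H, with value infinity if there is no largest size. *)
definition subgroup_rank :: "('a, 'b) monoid_scheme \<Rightarrow> 'a set \<Rightarrow> enat" where
  "subgroup_rank G H =
     (SUP B \<in> {B. finite B \<and> B \<subseteq> H \<and> int_independent G B}. enat (card B))"

definition borel_prob :: "'x::topological_space measure \<Rightarrow> bool" where
  "borel_prob \<nu> \<longleftrightarrow> prob_space \<nu> \<and> sets \<nu> = sets borel"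

definition invariant_under :: "'x::topological_space measure \<Rightarrow> ('x \<Rightarrow> 'x) \<Rightarrow> bool" where
  "invariant_under \<nu> S \<longleftrightarrow> distr \<nu> borel S = \<nu>"

definition totally_uniquely_ergodic ::
    "nat \<Rightarrow> 'x::topological_space measure \<Rightarrow> (nat \<Rightarrow> 'x \<Rightarrow> 'x) \<Rightarrow> bool" where
  "totally_uniquely_ergodic k \<mu> T \<longleftrightarrow>
     (\<forall>m :: nat \<Rightarrow> nat. (\<forall>i\<in>{1..k}. m i \<ge> 1) \<longrightarrow>
        (\<forall>\<nu>. borel_prob \<nu> \<and> (\<forall>i\<in>{1..k}. invariant_under \<nu> (T i ^^ m i)) \<longleftrightarrow> \<nu> = \<mu>))"

(* T 1 ^^ e 1 applied to T 2 ^^ e 2 applied to ... applied to (T k ^^ e k) x *)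
definition multi_iterate ::
    "nat \<Rightarrow> (nat \<Rightarrow> 'x \<Rightarrow> 'x) \<Rightarrow> (nat \<Rightarrow> nat) \<Rightarrow> 'x \<Rightarrow> 'x" where
  "multi_iterate k T e x = foldr (\<lambda>i. T i ^^ e i) [1..<Suc k] x"

end

theory Submission
  imports Defs "HOL-Real_Asymp.Real_Asymp"
begin

text \<open>
  Let \<open>g n\<close> be the value of a continuous function at the \<open>n\<close>-th point of the orbit, and give a prime \<open>p\<close>
  the colour \<open>(a 1 p, \<dots>, a k p)\<close>, so that \<open>g (p * n)\<close> depends only on \<open>n\<close> and the colour of \<open>p\<close>. By
  the Turan-Kubilius inequality, the average of \<open>g\<close> up to \<open>y\<close> is close to the mean, with weights
  \<open>1 / p\<close>, of the averages of \<open>g (p * n)\<close> up to \<open>y / p\<close>, for any finite set of primes with large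
  reciprocal sum. A Choquet-Deny type convexity argument, combined with an upper bound for the number
  of primes in short intervals, shows that the averages up to \<open>y\<close> and up to \<open>y / p\<close> are
  asymptotically equal. Taking all primes of one colour, it follows that every limit functional of the
  averages is invariant under \<open>T\<close> raised to each colour whose primes have divergent reciprocal sum.
  By the rank hypothesis these colours generate a subgroup of full rank, so the limit functional is
  invariant under some power of each \<open>T i\<close>. By the Riesz representation theorem it is integration
  against a measure, which total unique ergodicity identifies as \<open>\<mu>\<close>.\<close>

section \<open>Averages and their dilates\<close>

text \<open>Turan-Kubilius for the primes of one colour compares \<open>g\<close> at scale
  \<open>y\<close> with one dilate of \<open>g\<close> at the many scales \<open>y / p\<close>.
  Nothing is known about how the primes of a single colour are distributed, so these scales can be
  merged only after slow variation is known, and slow variation is drawn from all primes together.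
  Dilation by \<open>p\<close> replaces \<open>g\<close> by another function; hence extremal values
  are taken over scales and over all dilation factors \<open>m\<close> at once. The object that is
  compared is a vector of averages along a logarithmic grid of step \<theta>, because one average
  alone does not show an oscillation between scales. The prime number input is elementary and lossy:
  the lower bound \<open>ln (ln N) / 2\<close> for the sum of \<open>1 / p\<close>, and a bound for
  short windows that exceeds the expected order by \<open>1 / sqrt \<theta>\<close>. Both losses are
  affordable because the number of disjoint translates is of order
  \<open>1 / \<theta>\<close>.\<close>

definition avg :: "(nat \<Rightarrow> real) \<Rightarrow> real \<Rightarrow> real" where
  "avg g y = (\<Sum>n=1..nat \<lfloor>y\<rfloor>. g n) / y"

lemma avg_abs_le:
  assumes "\<And>n. \<bar>g n\<bar> \<le> 1" and "0 < y"
  shows "\<bar>avg g y\<bar> \<le> 1"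
proof -
  have "\<bar>\<Sum>n=1..nat \<lfloor>y\<rfloor>. g n\<bar> \<le> (\<Sum>n=1..nat \<lfloor>y\<rfloor>. \<bar>g n\<bar>)"
    by (rule sum_abs)
  also have "\<dots> \<le> (\<Sum>n=1..nat \<lfloor>y\<rfloor>. 1)"
    by (rule sum_mono) (use assms in auto)
  also have "\<dots> = real (nat \<lfloor>y\<rfloor>)"
    by simp
  also have "\<dots> \<le> y"
    using assms(2) by linarith
  finally show ?thesis
    using assms(2) by (simp add: avg_def divide_le_eq)
qed

text \<open>The partial sums differ by at most \<open>y - z + 1\<close> terms of modulus at most 1,
  and changing the normalisation from \<open>z\<close> to \<open>y\<close> costs another
  \<open>y - z\<close>.\<close>

lemma avg_diff_le:
  assumes g: "\<And>n. \<bar>g n\<bar> \<le> 1" and z: "0 < z" "z \<le> y"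
  shows "\<bar>avg g y - avg g z\<bar> \<le> (2 * (y - z) + 1) / y"
proof -
  let ?a = "nat \<lfloor>z\<rfloor>" and ?b = "nat \<lfloor>y\<rfloor>"
  have ab: "?a \<le> ?b" using z by (simp add: floor_mono nat_mono)
  have "(\<Sum>n=1..?b. g n) = (\<Sum>n=1..?a. g n) + (\<Sum>n=Suc ?a..?b. g n)"
    using sum.ub_add_nat[of 1 ?a g "?b - ?a"] ab by simp
  then have *: "y * avg g y - z * avg g z = (\<Sum>n=Suc ?a..?b. g n)"
    using z by (simp add: avg_def)
  have "\<bar>\<Sum>n=Suc ?a..?b. g n\<bar> \<le> (\<Sum>n=Suc ?a..?b. \<bar>g n\<bar>)"
    by (rule sum_abs)
  also have "\<dots> \<le> (\<Sum>n=Suc ?a..?b. 1)"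
    by (rule sum_mono) (use g in auto)
  also have "\<dots> = real ?b - real ?a"
    using ab by simp
  also have "\<dots> \<le> y - z + 1"
    using z by linarith
  finally have 1: "\<bar>y * avg g y - z * avg g z\<bar> \<le> y - z + 1"
    using * by simp
  have 2: "\<bar>(y - z) * avg g z\<bar> \<le> y - z"
    using avg_abs_le[of g z, OF g z(1)] z by (simp add: abs_mult mult_left_le)
  have "y * (avg g y - avg g z) = (y * avg g y - z * avg g z) - (y - z) * avg g z"
    by (simp add: algebra_simps)
  then have "\<bar>y * (avg g y - avg g z)\<bar> \<le> 2 * (y - z) + 1"
    using order_trans[OF abs_triangle_ineq4 add_mono[OF 1 2]] by simp
  then have "\<bar>avg g y - avg g z\<bar> * y \<le> 2 * (y - z) + 1"
    using z by (simp add: abs_mult mult.commute)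
  then show ?thesis
    using z by (simp add: le_divide_eq)
qed

text \<open>Since \<open>1 - z / y \<le> ln (y / z)\<close>, distance on the logarithmic scale
  controls the bound in \<open>avg_diff_le\<close>; the term \<open>1 / b\<close> is the rounding
  error of the floors.\<close>

lemma avg_log_lipschitz:
  assumes g: "\<And>n. \<bar>g n\<bar> \<le> 1" and b: "0 < b" "b \<le> y" "b \<le> z"
    and t: "\<bar>ln y - ln z\<bar> \<le> t"
  shows "\<bar>avg g y - avg g z\<bar> \<le> 2 * t + 1 / b"
proof -
  have main: "\<bar>avg g y - avg g z\<bar> \<le> 2 * t + 1 / b"
    if "b \<le> z" "z \<le> y" "\<bar>ln y - ln z\<bar> \<le> t" for y z
  proof -
    have pos: "0 < z" "0 < y" using that b(1) by linarith+
    have "1 - z / y \<le> t"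
    proof -
      have "ln (z / y) \<le> z / y - 1"
        using pos by (intro ln_le_minus_one) auto
      then show ?thesis
        using that(3) pos by (simp add: ln_div)
    qed
    moreover have "1 / y \<le> 1 / b"
      using b(1) that by (intro divide_left_mono) auto
    moreover have "(2 * (y - z) + 1) / y = 2 * (1 - z / y) + 1 / y"
      using pos by (simp add: field_simps)
    ultimately show ?thesis
      using avg_diff_le[of g z y, OF g pos(1) that(2)] by argo
  qed
  show ?thesis
  proof (cases "z \<le> y")
    case True
    then show ?thesis using main b t by blast
  next
    case False
    then show ?thesis using main[of y z] b t by (simp add: abs_minus_commute)
  qed
qed

section \<open>Multiples of primes and the Turan-Kubilius inequality\<close>

lemma sum_multiples:
  fixes g :: "nat \<Rightarrow> real"
  assumes "d > 0"
  shows "(\<Sum>n=1..N div d. g (d * n)) = (\<Sum>n=1..N. of_bool (d dvd n) * g n)"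
proof -
  have "(\<Sum>n=1..N div d. g (d * n)) = (\<Sum>n\<in>{n\<in>{1..N}. d dvd n}. g n)"
    by (rule sum.reindex_bij_witness[of _ "\<lambda>n. n div d" "\<lambda>n. d * n"])
       (use assms in \<open>auto simp: less_eq_div_iff_mult_less_eq mult.commute div_le_mono Suc_le_eq elim!: dvdE\<close>)
  also have "\<dots> = (\<Sum>n=1..N. if d dvd n then g n else 0)"
    by (rule sum.inter_filter) simp
  also have "\<dots> = (\<Sum>n=1..N. of_bool (d dvd n) * g n)"
    by (intro sum.cong) auto
  finally show ?thesis .
qed

text \<open>Normalising \<open>avg\<close> by the real number \<open>y\<close> and not by its floor
  makes this an exact identity.\<close>

lemma avg_dilate:
  assumes "d > 0" "0 < y"
  shows "avg (\<lambda>n. g (d * n)) (y / real d) / real d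
           = (\<Sum>n=1..nat \<lfloor>y\<rfloor>. of_bool (d dvd n) * g n) / y"
proof -
  have "\<lfloor>y / real d\<rfloor> = \<lfloor>y\<rfloor> div int d"
    using floor_divide_real_eq_div[of "int d" y] by simp
  then have "nat \<lfloor>y / real d\<rfloor> = nat \<lfloor>y\<rfloor> div d"
    using assms by (simp add: nat_div_distrib)
  then show ?thesis
    using assms sum_multiples[OF assms(1), of g "nat \<lfloor>y\<rfloor>"] by (simp add: avg_def)
qed

lemma count_multiples:
  assumes "d > 0" "0 < y"
  shows "(\<Sum>n=1..nat \<lfloor>y\<rfloor>. of_bool (d dvd n)) \<le> y / real d"
    and "y / real d - 1 \<le> (\<Sum>n=1..nat \<lfloor>y\<rfloor>. of_bool (d dvd n))"
proof -
  have "(\<Sum>n=1..nat \<lfloor>y\<rfloor>. of_bool (d dvd n)) = real (nat \<lfloor>y\<rfloor> div d)"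
    using sum_multiples[of d "\<lambda>_. 1" "nat \<lfloor>y\<rfloor>"] assms by simp
  also have "nat \<lfloor>y\<rfloor> div d = nat \<lfloor>y / real d\<rfloor>"
    using floor_divide_real_eq_div[of "int d" y] assms by (simp add: nat_div_distrib)
  finally have *: "(\<Sum>n=1..nat \<lfloor>y\<rfloor>. of_bool (d dvd n)) = real (nat \<lfloor>y / real d\<rfloor>)" .
  have "0 < y / real d" using assms by simp
  then show "(\<Sum>n=1..nat \<lfloor>y\<rfloor>. of_bool (d dvd n)) \<le> y / real d"
    and "y / real d - 1 \<le> (\<Sum>n=1..nat \<lfloor>y\<rfloor>. of_bool (d dvd n))"
    unfolding * by linarith+
qed

text \<open>The square of the number of divisors from \<open>B\<close> is expanded. By coprimality
  the pairs of distinct primes contribute at most \<open>y * L\<^sup>2\<close>, which the first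
  moment cancels; the diagonal leaves \<open>y * L\<close>, and rounding in the first moment leaves
  \<open>2 * L * card B\<close>.\<close>

lemma turan_kubilius:
  fixes B :: "nat set" and y :: real
  assumes B: "finite B" "\<And>p. p \<in> B \<Longrightarrow> prime p" and y: "0 < y"
  defines "L \<equiv> \<Sum>p\<in>B. 1 / real p"
  shows "(\<Sum>n=1..nat \<lfloor>y\<rfloor>. ((\<Sum>p\<in>B. of_bool (p dvd n)) - L)\<^sup>2) \<le> y * L + 2 * L * real (card B)"
proof -
  let ?N = "nat \<lfloor>y\<rfloor>"
  let ?w = "\<lambda>n. \<Sum>p\<in>B. of_bool (p dvd n) :: real"
  have L0: "0 \<le> L" unfolding L_def by (intro sum_nonneg) auto
  have pos: "p > 0" if "p \<in> B" for p using B(2)[OF that] prime_gt_0_nat by blast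
  have NY: "real ?N \<le> y" using y by linarith
  have pair: "(\<Sum>n=1..?N. of_bool (p dvd n) * of_bool (q dvd n)) \<le> y / (real p * real q) + (if p = q then y / real p else 0)"
    if "p \<in> B" "q \<in> B" for p q
  proof (cases "p = q")
    case True
    have "(\<Sum>n=1..?N. of_bool (p dvd n) * of_bool (q dvd n)) = (\<Sum>n=1..?N. of_bool (p dvd n) :: real)"
      using True by (intro sum.cong) auto
    also have "\<dots> \<le> y / real p" using count_multiples(1)[OF pos[OF that(1)] y] .
    finally show ?thesis using True y by (simp add: add_increasing)
  next
    case False
    then have cop: "coprime p q" using that B(2) primes_coprime by blast
    have "(\<Sum>n=1..?N. of_bool (p dvd n) * of_bool (q dvd n)) = (\<Sum>n=1..?N. of_bool (p * q dvd n) :: real)"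
      using cop by (intro sum.cong) (auto simp: divides_mult dest: dvd_mult_left dvd_mult_right)
    also have "\<dots> \<le> y / real (p * q)" using count_multiples(1)[of "p * q" y] pos that y by simp
    finally show ?thesis using False by simp
  qed
  have "(\<Sum>n=1..?N. (?w n)\<^sup>2) = (\<Sum>n=1..?N. \<Sum>p\<in>B. \<Sum>q\<in>B. of_bool (p dvd n) * of_bool (q dvd n))"
    by (simp add: power2_eq_square sum_product)
  also have "\<dots> = (\<Sum>p\<in>B. \<Sum>q\<in>B. \<Sum>n=1..?N. of_bool (p dvd n) * of_bool (q dvd n))"
    by (subst sum.swap, rule sum.cong[OF refl], rule sum.swap)
  also have "\<dots> \<le> (\<Sum>p\<in>B. \<Sum>q\<in>B. y / (real p * real q) + (if p = q then y / real p else 0))"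
    by (intro sum_mono pair)
  also have "\<dots> = (\<Sum>p\<in>B. \<Sum>q\<in>B. y * ((1 / real p) * (1 / real q))) + (\<Sum>p\<in>B. y / real p)"
    using B(1) by (simp add: sum.distrib)
  also have "\<dots> = y * L\<^sup>2 + y * L"
    by (simp add: L_def power2_eq_square sum_product sum_distrib_left divide_divide_eq_left mult.commute)
  finally have sq: "(\<Sum>n=1..?N. (?w n)\<^sup>2) \<le> y * L\<^sup>2 + y * L" .
  have "(\<Sum>n=1..?N. ?w n) = (\<Sum>p\<in>B. \<Sum>n=1..?N. of_bool (p dvd n))"
    by (rule sum.swap)
  also have "\<dots> \<ge> (\<Sum>p\<in>B. y / real p - 1)"
    by (intro sum_mono count_multiples(2) pos y)
  finally have "y * L - real (card B) \<le> (\<Sum>n=1..?N. ?w n)"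
    by (simp add: sum_subtractf L_def sum_distrib_left)
  then have "2 * L * (y * L - real (card B)) \<le> 2 * L * (\<Sum>n=1..?N. ?w n)"
    using L0 by (intro mult_left_mono) auto
  moreover have "(\<Sum>n=1..?N. (?w n - L)\<^sup>2) = (\<Sum>n=1..?N. (?w n)\<^sup>2) - 2 * L * (\<Sum>n=1..?N. ?w n) + real ?N * L\<^sup>2"
    by (simp add: power2_diff sum.distrib sum_subtractf sum_distrib_left algebra_simps)
  moreover have "real ?N * L\<^sup>2 \<le> y * L\<^sup>2"
    using NY by (intro mult_right_mono) auto
  ultimately show ?thesis
    using sq by (simp add: algebra_simps power2_eq_square)
qed

text \<open>Summing the dilates counts each \<open>n\<close> once for every divisor in
  \<open>B\<close>, so the error is the average of \<open>g n\<close> times the relative deviation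
  of that count from \<open>L\<close>. The condition \<open>2 * card B \<le> y\<close> bounds the
  variance by \<open>2 * y * L\<close>; the error is then at most \<open>sqrt (2 / L)\<close>, hence
  the threshold \<open>2 / e\<^sup>2\<close>.\<close>

lemma avg_prime_dilates:
  fixes B :: "nat set" and y e :: real
  assumes B: "finite B" "\<And>p. p \<in> B \<Longrightarrow> prime p" and g: "\<And>n. \<bar>g n\<bar> \<le> 1"
    and y: "0 < y" "2 * real (card B) \<le> y" and e: "0 < e"
  defines "L \<equiv> \<Sum>p\<in>B. 1 / real p"
  assumes L: "2 / e\<^sup>2 \<le> L"
  shows "\<bar>avg g y - (\<Sum>p\<in>B. 1 / real p / L * avg (\<lambda>n. g (p * n)) (y / real p))\<bar> \<le> e"
proof -
  let ?N = "nat \<lfloor>y\<rfloor>"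
  let ?w = "\<lambda>n. \<Sum>p\<in>B. of_bool (p dvd n) :: real"
  have L0: "0 < L" using L e by (smt (verit) divide_pos_pos zero_less_power)
  have pos: "p > 0" if "p \<in> B" for p using B(2)[OF that] prime_gt_0_nat by blast
  have NY: "real ?N \<le> y" using y by linarith
  have "(\<Sum>p\<in>B. 1 / real p / L * avg (\<lambda>n. g (p * n)) (y / real p))
      = (\<Sum>p\<in>B. avg (\<lambda>n. g (p * n)) (y / real p) / real p) / L"
    by (simp add: sum_divide_distrib field_simps)
  also have "\<dots> = (\<Sum>p\<in>B. (\<Sum>n=1..?N. of_bool (p dvd n) * g n) / y) / L"
    using avg_dilate[OF pos y(1), of _ g] by simp
  also have "\<dots> = (\<Sum>n=1..?N. ?w n * g n) / y / L"
    by (simp only: sum_divide_distrib[symmetric] sum_distrib_right sum.swap[of _ B])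
  finally have eq0: "(\<Sum>p\<in>B. 1 / real p / L * avg (\<lambda>n. g (p * n)) (y / real p))
      = (\<Sum>n=1..?N. ?w n * g n) / y / L" .
  have "(\<Sum>n=1..?N. (L - ?w n) * g n) = L * (\<Sum>n=1..?N. g n) - (\<Sum>n=1..?N. ?w n * g n)"
    unfolding left_diff_distrib sum_subtractf sum_distrib_left ..
  then have eq: "avg g y - (\<Sum>p\<in>B. 1 / real p / L * avg (\<lambda>n. g (p * n)) (y / real p))
      = (\<Sum>n=1..?N. (L - ?w n) * g n) / (y * L)"
    unfolding eq0 using L0 y(1) by (simp add: avg_def diff_divide_distrib)
  text \<open>AM-GM stands in for the Cauchy-Schwarz inequality.\<close>
  have am: "\<bar>L - w\<bar> \<le> (w - L)\<^sup>2 / (2 * e * L) + e * L / 2" for w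
  proof -
    have "0 \<le> (\<bar>w - L\<bar> - e * L)\<^sup>2" by simp
    then have "2 * (e * L) * \<bar>w - L\<bar> \<le> (w - L)\<^sup>2 + (e * L)\<^sup>2"
      by (simp add: power2_diff algebra_simps)
    then have "\<bar>w - L\<bar> \<le> ((w - L)\<^sup>2 + (e * L)\<^sup>2) / (2 * (e * L))"
      using e L0 by (simp add: le_divide_eq algebra_simps)
    also have "\<dots> = (w - L)\<^sup>2 / (2 * e * L) + e * L / 2"
      using e L0 by (simp add: field_simps power2_eq_square)
    finally show ?thesis by (simp add: abs_minus_commute)
  qed
  have "\<bar>\<Sum>n=1..?N. (L - ?w n) * g n\<bar> \<le> (\<Sum>n=1..?N. \<bar>(L - ?w n) * g n\<bar>)"
    by (rule sum_abs)
  also have "\<dots> \<le> (\<Sum>n=1..?N. \<bar>L - ?w n\<bar>)"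
    by (intro sum_mono) (simp add: abs_mult g mult_left_le)
  also have "\<dots> \<le> (\<Sum>n=1..?N. (?w n - L)\<^sup>2 / (2 * e * L) + e * L / 2)"
    by (intro sum_mono am)
  also have "\<dots> = (\<Sum>n=1..?N. (?w n - L)\<^sup>2) / (2 * e * L) + real ?N * (e * L / 2)"
    by (simp add: sum.distrib sum_divide_distrib)
  also have "\<dots> \<le> (y * L + 2 * L * real (card B)) / (2 * e * L) + y * (e * L / 2)"
    using turan_kubilius[OF B y(1)] e L0 NY unfolding L_def
    by (intro add_mono divide_right_mono mult_right_mono) auto
  also have "\<dots> \<le> (y * L + L * y) / (2 * e * L) + y * (e * L / 2)"
    using y L0 e by (intro add_mono divide_right_mono) auto
  also have "\<dots> = y / e + y * (e * L / 2)"
    using L0 e by (simp add: field_simps)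
  also have "y / e \<le> y * (e * L / 2)"
  proof -
    have "2 \<le> L * e\<^sup>2" using L e by (simp add: divide_le_eq)
    then show ?thesis using e y by (simp add: field_simps power2_eq_square)
  qed
  finally have "\<bar>\<Sum>n=1..?N. (L - ?w n) * g n\<bar> \<le> e * (y * L)"
    by (simp add: algebra_simps)
  then show ?thesis
    unfolding eq using y(1) L0 by (simp add: abs_mult divide_le_eq)
qed

section \<open>Reciprocals of primes\<close>

text \<open>A finite Euler product, built one prime at a time: a number is free of \<open>p\<close>
  or \<open>p\<close> times another number of the same kind, so the new sum is at most the old one
  plus \<open>1 / p\<close> times itself.\<close>

lemma sum_smooth_reciprocals_le:
  fixes S :: "nat set"
  assumes "finite S" "\<And>p. p \<in> S \<Longrightarrow> prime p"
  shows "(\<Sum>n\<in>{n\<in>{1..N}. prime_factors n \<subseteq> S}. 1 / real n) \<le> (\<Prod>p\<in>S. real p / (real p - 1))"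
  using assms
proof (induction S)
  case empty
  have "{n\<in>{1..N}. prime_factors n \<subseteq> {}} \<subseteq> {1}"
    by (auto simp: prime_factorization_empty_iff)
  then have "(\<Sum>n\<in>{n\<in>{1..N}. prime_factors n \<subseteq> {}}. 1 / real n) \<le> (\<Sum>n\<in>{1}. 1 / real n)"
    by (intro sum_mono2) auto
  then show ?case by simp
next
  case (insert p S)
  let ?D = "\<lambda>S. {n\<in>{1..N}. prime_factors n \<subseteq> S}"
  have p: "prime p" "p \<ge> 2" using insert.prems prime_ge_2_nat by blast+
  have split: "?D (insert p S) \<subseteq> ?D S \<union> (\<lambda>m. p * m) ` ?D (insert p S)"
  proof
    fix n assume n: "n \<in> ?D (insert p S)"
    show "n \<in> ?D S \<union> (\<lambda>m. p * m) ` ?D (insert p S)"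
    proof (cases "p dvd n")
      case False
      then have "p \<notin> prime_factors n" by auto
      then show ?thesis using n by auto
    next
      case True
      then obtain m where m: "n = p * m" by blast
      then have "m \<noteq> 0" "m \<le> n" using n p by auto
      moreover have "prime_factors m \<subseteq> prime_factors n"
        using m n by (intro dvd_prime_factors) auto
      ultimately have "m \<in> ?D (insert p S)" using n by auto
      then show ?thesis using m by blast
    qed
  qed
  have "(\<Sum>n\<in>?D (insert p S). 1 / real n) \<le> (\<Sum>n\<in>?D S \<union> (\<lambda>m. p * m) ` ?D (insert p S). 1 / real n)"
    using split by (intro sum_mono2) auto
  also have "\<dots> \<le> (\<Sum>n\<in>?D S. 1 / real n) + (\<Sum>n\<in>(\<lambda>m. p * m) ` ?D (insert p S). 1 / real n)"
    by (subst sum_Un) (auto intro!: sum_nonneg)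
  also have "(\<Sum>n\<in>(\<lambda>m. p * m) ` ?D (insert p S). 1 / real n) = (\<Sum>n\<in>?D (insert p S). 1 / real n) / real p"
    using p by (subst sum.reindex) (auto simp: inj_on_def sum_divide_distrib field_simps)
  finally have "(\<Sum>n\<in>?D (insert p S). 1 / real n) * (1 - 1 / real p) \<le> (\<Sum>n\<in>?D S. 1 / real n)"
    by (simp add: algebra_simps)
  also have "\<dots> \<le> (\<Prod>p\<in>S. real p / (real p - 1))"
    using insert by blast
  finally have "(\<Sum>n\<in>?D (insert p S). 1 / real n) \<le> (\<Prod>p\<in>S. real p / (real p - 1)) / (1 - 1 / real p)"
    using p by (subst pos_le_divide_eq) auto
  also have "\<dots> = (\<Prod>p\<in>insert p S. real p / (real p - 1))"
    using p insert.hyps by (simp add: field_simps)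
  finally show ?case .
qed

text \<open>Every \<open>n \<le> N\<close> factors into primes up to \<open>N\<close>, so the
  harmonic sum is below the Euler product. The factor 1/2 is the price of the cheap estimate
  \<open>p / (p - 1) \<le> exp (2 / p)\<close>.\<close>

lemma sum_prime_reciprocals_ge:
  assumes "N \<ge> 1"
  shows "ln (ln (real N + 1)) / 2 \<le> (\<Sum>p\<in>{p. prime p \<and> p \<le> N}. 1 / real p)"
proof -
  let ?P = "{p. prime p \<and> p \<le> N}"
  have fin: "finite ?P" by (rule finite_subset[of _ "{..N}"]) auto
  have "ln (real N + 1) \<le> harm N" by (rule ln_le_harm)
  also have "harm N = (\<Sum>n\<in>{n\<in>{1..N}. prime_factors n \<subseteq> ?P}. 1 / real n)"
    unfolding harm_def inverse_eq_divide
    by (intro sum.cong) (auto simp: in_prime_factors_iff dest!: dvd_imp_le)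
  also have "\<dots> \<le> (\<Prod>p\<in>?P. real p / (real p - 1))"
    using fin by (intro sum_smooth_reciprocals_le) auto
  also have "\<dots> \<le> (\<Prod>p\<in>?P. exp (2 / real p))"
  proof (rule prod_mono, safe)
    fix p :: nat assume "prime p"
    then have p: "real p \<ge> 2" using prime_ge_2_nat by auto
    then show "0 \<le> real p / (real p - 1)" by simp
    have "real p / (real p - 1) \<le> 1 + 2 / real p"
      using p by (simp add: field_simps)
    also have "\<dots> \<le> exp (2 / real p)" by (rule exp_ge_add_one_self)
    finally show "real p / (real p - 1) \<le> exp (2 / real p)" .
  qed
  also have "\<dots> = exp (2 * (\<Sum>p\<in>?P. 1 / real p))"
    using fin by (simp add: exp_sum sum_distrib_left)
  finally have "ln (real N + 1) \<le> exp (2 * (\<Sum>p\<in>?P. 1 / real p))" .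
  then have "ln (ln (real N + 1)) \<le> 2 * (\<Sum>p\<in>?P. 1 / real p)"
    using assms ln_ge_zero[of "real N + 1"] by (subst (asm) ln_le_cancel_iff[symmetric]) auto
  then show ?thesis by simp
qed

section \<open>An upper bound for primes in short intervals\<close>

lemma prod_primes_dvd:
  fixes S :: "nat set"
  assumes "finite S" "\<And>p. p \<in> S \<Longrightarrow> prime p" "\<And>p. p \<in> S \<Longrightarrow> p dvd n"
  shows "\<Prod>S dvd n"
  using assms
proof (induction S)
  case (insert p S)
  have "coprime p (\<Prod>S)"
    using insert by (intro prod_coprime_right) (auto intro: primes_coprime)
  then show ?case
    using insert by (auto intro: divides_mult)
qed simp

text \<open>The primes in \<open>{a<..a + K}\<close> all divide the binomial coefficient of \<open>a + K\<close> over \<open>K\<close>.\<close>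

lemma card_primes_interval:
  fixes a K :: nat and t :: real
  assumes K: "K \<le> a" and a: "1 \<le> a" and t: "0 < t"
  shows "real (card {p. prime p \<and> a < p \<and> p \<le> a + K}) * ln (real a) \<le> t * real (a + K) + real K / t"
proof -
  let ?S = "{p. prime p \<and> a < p \<and> p \<le> a + K}"
  have fin: "finite ?S" by (rule finite_subset[of _ "{..a + K}"]) auto
  have pdvd: "p dvd (a + K choose K)" if "p \<in> ?S" for p
  proof -
    have p: "prime p" "a < p" "p \<le> a + K" using that by auto
    have "p dvd fact (a + K)" using p prime_dvd_fact_iff by blast
    also have "fact (a + K) = (fact K * fact a) * (a + K choose K)"
      using binomial_fact_lemma[of K "a + K"] by simp
    finally have "p dvd fact K \<or> p dvd fact a \<or> p dvd (a + K choose K)"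
      using p(1) by (simp add: prime_dvd_mult_iff)
    then show ?thesis using p K by (auto simp: prime_dvd_fact_iff)
  qed
  have "\<Prod>?S dvd (a + K choose K)"
    using fin pdvd by (intro prod_primes_dvd) auto
  then have "\<Prod>?S \<le> (a + K choose K)"
    by (intro dvd_imp_le) (auto simp: zero_less_binomial)
  moreover have "a ^ card ?S \<le> \<Prod>?S"
    using prod_mono[of ?S "\<lambda>_. a" "\<lambda>p. p"] by simp
  ultimately have "a ^ card ?S \<le> (a + K choose K)" by linarith
  then have 1: "real a ^ card ?S \<le> real (a + K choose K)"
    by (metis of_nat_le_iff of_nat_power)
  \<comment> \<open>The binomial coefficient is bounded by one term of the expansion of
    \<open>(t + 1) ^ (a + K)\<close>; the free parameter \<open>t\<close> is optimised only when the
    window is known.\<close>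
  have "real (a + K choose K) * t ^ K \<le> (\<Sum>k\<le>a + K. real (a + K choose k) * t ^ k)"
    using t member_le_sum[of K "{..a + K}" "\<lambda>k. real (a + K choose k) * t ^ k"] by simp
  also have "\<dots> = (t + 1) ^ (a + K)"
    by (subst binomial_ring) simp
  finally have "real a ^ card ?S * t ^ K \<le> (t + 1) ^ (a + K)"
    using 1 t by (meson mult_right_mono order_trans zero_le_power less_imp_le)
  then have "ln (real a ^ card ?S * t ^ K) \<le> ln ((t + 1) ^ (a + K))"
    using a t by (subst ln_le_cancel_iff) auto
  then have "real (card ?S) * ln (real a) + real K * ln t \<le> real (a + K) * ln (1 + t)"
    using a t by (simp add: ln_mult ln_realpow add.commute)
  moreover have "real (a + K) * ln (1 + t) \<le> real (a + K) * t"
    using t by (intro mult_left_mono ln_add_one_self_le_self) auto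
  \<comment> \<open>This crude bound for the logarithm is where the factor
    \<open>1 / sqrt \<theta>\<close> in the window estimate comes from.\<close>
  moreover have "real K * (- ln t) \<le> real K * (1 / t)"
  proof (intro mult_left_mono)
    show "- ln t \<le> 1 / t" using ln_le_minus_one[of "1 / t"] t by (simp add: ln_div)
  qed auto
  ultimately show ?thesis by (simp add: algebra_simps)
qed

text \<open>The fair share of the \<open>n\<close>-th window of logarithmic length \<theta> is about
  \<open>1 / n\<close>. The loss comes from \<open>card_primes_interval\<close> with
  \<open>t = sqrt \<theta>\<close>, which balances its two terms for an interval of length about
  \<open>\<theta> * x\<close>.\<close>

lemma sum_prime_reciprocals_window_le:
  fixes \<theta> :: real and n :: nat
  assumes \<theta>: "0 < \<theta>" "\<theta> \<le> 1/8" and n: "1 \<le> n" and big: "2 / \<theta> \<le> exp (\<theta> * real n)"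
  shows "(\<Sum>p\<in>{p. prime p \<and> \<theta> * real n \<le> ln (real p) \<and> ln (real p) < \<theta> * (real n + 1)}. 1 / real p)
           \<le> 14 / (sqrt \<theta> * real n)" (is "sum _ ?W \<le> _")
proof -
  define x where "x = exp (\<theta> * real n)"
  \<comment> \<open>The largest integer below \<open>x\<close>, so that a prime equal to
    \<open>x\<close> still counts; the summand 1 in \<open>K\<close> makes up for
    \<open>a \<ge> x - 1\<close>.\<close>
  define a where "a = nat (\<lceil>x\<rceil> - 1)"
  define K where "K = nat \<lceil>x * (exp \<theta> - 1)\<rceil> + 1"
  let ?S = "{p. prime p \<and> a < p \<and> p \<le> a + K}"
  have x16: "16 \<le> x"
  proof -
    have "16 \<le> 2 / \<theta>" using \<theta> by (simp add: field_simps)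
    then show ?thesis using big by (simp add: x_def)
  qed
  have aub: "real a \<le> x" and alb: "x - 1 \<le> real a"
    using x16 unfolding a_def by linarith+
  have e2: "exp \<theta> - 1 \<le> 2 * \<theta>"
  proof -
    have "exp \<theta> \<le> 1 + \<theta> + \<theta>\<^sup>2" using \<theta> by (intro exp_bound) auto
    moreover have "\<theta>\<^sup>2 \<le> \<theta>" using \<theta> by (simp add: power2_eq_square mult_left_le)
    ultimately show ?thesis by linarith
  qed
  have "0 \<le> exp \<theta> - 1" using \<theta> by simp
  have "x * (exp \<theta> - 1) \<le> 2 * \<theta> * x"
    using mult_left_mono[OF e2, of x] x16 by (simp add: algebra_simps)
  moreover have "2 \<le> \<theta> * x" using big \<theta> by (simp add: x_def field_simps)
  moreover have "0 \<le> x * (exp \<theta> - 1)" using x16 \<theta> by simp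
  \<comment> \<open>Rounding adds at most 2 to \<open>K\<close>, which
    \<open>2 \<le> \<theta> * x\<close> absorbs.\<close>
  ultimately have K3: "real K \<le> 3 * (\<theta> * x)"
    unfolding K_def by linarith
  have \<theta>x: "\<theta> * x \<le> x / 8" using \<theta> x16 by simp
  have Ka: "K \<le> a"
  proof -
    have "real K \<le> real a" using K3 \<theta>x x16 alb by linarith
    then show ?thesis by simp
  qed
  have a1: "1 \<le> a" using alb x16 by linarith
  have WS: "?W \<subseteq> ?S"
  proof safe
    fix p assume p: "prime p" "\<theta> * real n \<le> ln (real p)" "ln (real p) < \<theta> * (real n + 1)"
    have p0: "0 < real p" using p(1) prime_gt_0_nat by simp
    have 1: "x \<le> real p" using p(2) p0 by (simp add: x_def ln_ge_iff)
    have "real p < exp (\<theta> * (real n + 1))" using p(3) p0 by (metis exp_less_cancel_iff exp_ln)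
    also have "\<dots> = x * exp \<theta>" by (simp add: x_def algebra_simps exp_add)
    finally have 2: "real p < x + x * (exp \<theta> - 1)" by (simp add: algebra_simps)
    show "a < p" using 1 x16 unfolding a_def by linarith
    show "p \<le> a + K" using 2 alb unfolding K_def by linarith
  qed
  have fin: "finite ?S" by (rule finite_subset[of _ "{..a + K}"]) auto
  have s: "0 < sqrt \<theta>" "sqrt \<theta> \<le> 1" "sqrt \<theta> * sqrt \<theta> = \<theta>" using \<theta> by auto
  have "real (card ?S) * ln (real a) \<le> sqrt \<theta> * real (a + K) + real K / sqrt \<theta>"
    using card_primes_interval[OF Ka a1 s(1)] .
  also have "\<dots> \<le> sqrt \<theta> * (4 * x) + 3 * (\<theta> * x) / sqrt \<theta>"
  proof (intro add_mono mult_left_mono divide_right_mono)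
    show "real (a + K) \<le> 4 * x" using aub K3 \<theta>x x16 unfolding of_nat_add by linarith
  qed (use s K3 in auto)
  also have "\<dots> = 7 * sqrt \<theta> * x"
    using s by (simp add: real_div_sqrt field_simps)
  finally have c1: "real (card ?S) * ln (real a) \<le> 7 * sqrt \<theta> * x" .
  have "\<theta> * real n / 2 \<le> ln (real a)"
  proof -
    have "x \<le> (x - 1)\<^sup>2" 
    proof -
      have "3 * x \<le> x * x" using x16 by (intro mult_right_mono) auto
      then show ?thesis by (simp add: power2_eq_square algebra_simps)
    qed
    also have "\<dots> \<le> (real a)\<^sup>2" using alb x16 by (intro power_mono) auto
    finally have "ln x \<le> ln ((real a)\<^sup>2)" using x16 a1 by (subst ln_le_cancel_iff) auto
    then show ?thesis using a1 by (simp add: x_def ln_realpow)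
  qed
  then have "real (card ?S) * (\<theta> * real n / 2) \<le> 7 * sqrt \<theta> * x"
    using c1 by (meson mult_left_mono of_nat_0_le_iff order_trans)
  then have "real (card ?S) / x \<le> 14 * sqrt \<theta> / (\<theta> * real n)"
    using x16 \<theta> n by (simp add: field_simps)
  also have "\<dots> = 14 / (sqrt \<theta> * real n)"
    using s \<theta> n by (simp add: field_simps)
  finally have c2: "real (card ?S) / x \<le> 14 / (sqrt \<theta> * real n)" .
  have "(\<Sum>p\<in>?W. 1 / real p) \<le> (\<Sum>p\<in>?W. 1 / x)"
  proof (intro sum_mono divide_left_mono)
    fix p assume "p \<in> ?W"
    then have p: "prime p" "\<theta> * real n \<le> ln (real p)" by auto
    then show "x \<le> real p" using prime_gt_0_nat[OF p(1)] by (simp add: x_def ln_ge_iff)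
    then show "0 < real p * x" using x16 by simp
  qed auto
  also have "\<dots> = real (card ?W) / x" by simp
  also have "\<dots> \<le> real (card ?S) / x"
    using card_mono[OF fin WS] x16 by (intro divide_right_mono) auto
  finally show ?thesis using c2 by linarith
qed

section \<open>Slow variation of the averages\<close>

text \<open>A discrete intermediate value argument: take the first passage times through the levels
  \<open>j * (\<Delta> + l)\<close>. A step overshoots its level by at most \<open>l\<close>, which
  leaves a gap of \<Delta> before the next level.\<close>

lemma separated_indices:
  fixes v :: "nat \<Rightarrow> real"
  assumes step: "\<And>i. i < R \<Longrightarrow> \<bar>v (Suc i) - v i\<bar> \<le> l" and tot: "\<kappa> \<le> \<bar>v R - v 0\<bar>"
    and l: "0 \<le> l" and \<Delta>: "0 < \<Delta>" and I: "real I * (\<Delta> + l) \<le> \<kappa>"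
  shows "\<exists>J\<subseteq>{0..R}. card J = I \<and> (\<forall>i\<in>J. \<forall>i'\<in>J. i \<noteq> i' \<longrightarrow> \<Delta> \<le> \<bar>v i - v i'\<bar>)"
proof -
  \<comment> \<open>The sign turns the walk upwards.\<close>
  define \<sigma> :: real where "\<sigma> = (if v R \<ge> v 0 then 1 else -1)"
  define u where "u i = \<sigma> * (v i - v 0)" for i
  have uv: "\<bar>u i - u j\<bar> = \<bar>v i - v j\<bar>" for i j
    by (auto simp: u_def \<sigma>_def)
  have u0: "u 0 = 0" and uR: "\<kappa> \<le> u R"
    using tot by (auto simp: u_def \<sigma>_def)
  define h where "h j = (LEAST i. real j * (\<Delta> + l) \<le> u i)" for j
  have hR: "h j \<le> R" "real j * (\<Delta> + l) \<le> u (h j)" "u (h j) \<le> real j * (\<Delta> + l) + l" if "j < I" for j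
  proof -
    have "real j * (\<Delta> + l) \<le> real I * (\<Delta> + l)"
      using that l \<Delta> by (intro mult_right_mono) auto
    then have ex: "real j * (\<Delta> + l) \<le> u R" using I uR by linarith
    then show R: "h j \<le> R" unfolding h_def by (rule Least_le)
    show "real j * (\<Delta> + l) \<le> u (h j)" unfolding h_def using ex by (rule LeastI)
    show "u (h j) \<le> real j * (\<Delta> + l) + l"
    proof (cases "h j")
      case 0
      then show ?thesis using u0 l \<Delta> by simp
    next
      case (Suc i)
      then have "\<not> real j * (\<Delta> + l) \<le> u i"
        using not_less_Least[of i "\<lambda>i. real j * (\<Delta> + l) \<le> u i"] Suc unfolding h_def by simp
      moreover have "\<bar>u (Suc i) - u i\<bar> \<le> l" using step[of i] uv Suc R by simp
      ultimately show ?thesis using Suc by simp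
    qed
  qed
  have sep: "\<Delta> \<le> u (h j') - u (h j)" if "j < j'" "j' < I" for j j'
  proof -
    have "(real j + 1) * (\<Delta> + l) \<le> real j' * (\<Delta> + l)"
      using that l \<Delta> by (intro mult_right_mono) auto
    then show ?thesis using hR(2)[of j'] hR(3)[of j] that by (simp add: algebra_simps)
  qed
  have sep': "\<Delta> \<le> \<bar>u (h j) - u (h j')\<bar>" if "j \<noteq> j'" "j < I" "j' < I" for j j'
    using that sep[of j j'] sep[of j' j] by (cases "j < j'") (auto simp: abs_if)
  have "inj_on h {..<I}"
    using sep' \<Delta> by (intro inj_onI) force
  then have "card (h ` {..<I}) = I" by (simp add: card_image)
  moreover have "\<Delta> \<le> \<bar>v i - v i'\<bar>" if ii: "i \<in> h ` {..<I}" "i' \<in> h ` {..<I}" "i \<noteq> i'" for i i'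
  proof -
    obtain j where "i = h j" "j < I" using ii(1) by auto
    moreover obtain j' where "i' = h j'" "j' < I" using ii(2) by auto
    ultimately show ?thesis using ii(3) sep'[of j j'] uv[of i i'] by auto
  qed
  ultimately show ?thesis
    using hR(1) by (intro exI[of _ "h ` {..<I}"]) auto
qed

text \<open>The disjoint translates of \<open>W\<close> by the elements of \<open>J\<close> all fit
  into one harmonic sum. A shift by at most \<open>R \<le> n0\<close> changes a reciprocal by at
  most a factor 2.\<close>

lemma sum_reciprocals_translates_le:
  fixes W J :: "nat set"
  assumes W: "W \<subseteq> {n0..N}" and J: "J \<subseteq> {0..R}" and n0: "1 \<le> n0" "R \<le> n0"
    and disj: "\<And>n n' i i'. n \<in> W \<Longrightarrow> n' \<in> W \<Longrightarrow> i \<in> J \<Longrightarrow> i' \<in> J \<Longrightarrow> i \<noteq> i' \<Longrightarrow> n + i \<noteq> n' + i'"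
  shows "real (card J) * (\<Sum>n\<in>W. 1 / real n) \<le> 2 * (1 + ln (real (N + R)))"
proof (cases "W = {} \<or> N + R = 0")
  case True
  then have "W = {}" using W n0 by auto
  then show ?thesis
    by (cases "N + R = 0") (auto intro!: add_nonneg_nonneg)
next
  case False
  have finJ: "finite J" using J finite_subset by blast
  have finW: "finite W" using W finite_subset by blast
  have "real (card J) * (\<Sum>n\<in>W. 1 / real n) = (\<Sum>i\<in>J. \<Sum>n\<in>W. 1 / real n)"
    by simp
  also have "\<dots> \<le> (\<Sum>i\<in>J. \<Sum>n\<in>W. 2 * (1 / real (n + i)))"
  proof (intro sum_mono)
    fix i n assume "i \<in> J" "n \<in> W"
    then have "i \<le> n" "1 \<le> n" using J W n0 by fastforce+
    then show "1 / real n \<le> 2 * (1 / real (n + i))" by (simp add: field_simps)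
  qed
  also have "\<dots> = 2 * (\<Sum>(n, i)\<in>W \<times> J. 1 / real (n + i))"
    by (subst sum.swap) (simp add: sum.cartesian_product sum_distrib_left case_prod_unfold)
  also have "(\<Sum>(n, i)\<in>W \<times> J. 1 / real (n + i)) = (\<Sum>k\<in>(\<lambda>(n, i). n + i) ` (W \<times> J). 1 / real k)"
  proof (subst sum.reindex)
    show "inj_on (\<lambda>(n, i). n + i) (W \<times> J)"
    proof (intro inj_onI, clarify)
      fix n i n' i' assume "n \<in> W" "i \<in> J" "n' \<in> W" "i' \<in> J" "n + i = n' + i'"
      then show "n = n' \<and> i = i'" using disj[of n n' i i'] by (cases "i = i'") auto
    qed
  qed (simp add: case_prod_unfold o_def)
  also have "\<dots> \<le> (\<Sum>k\<in>{1..N + R}. 1 / real k)"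
    using W J n0 by (intro sum_mono2) fastforce+
  also have "\<dots> = harm (N + R)"
    by (simp add: harm_def inverse_eq_divide)
  also have "\<dots> \<le> 1 + ln (real (N + R))"
  proof -
    obtain q where q: "N + R = Suc q" using False by (cases "N + R") auto
    have "harm (Suc q) - ln (real (Suc q)) \<le> harm (Suc 0) - ln (real (Suc 0))"
      using decseq_harm_diff_ln by (rule decseqD) simp
    then show ?thesis using q by (simp add: harm_def)
  qed
  finally show ?thesis by simp
qed

text \<open>\<open>S\<close> is the limit superior for large \<open>y\<close> of the supremum over
  \<open>m\<close>. The upper bound must be uniform in \<open>m\<close>, since it is applied at
  \<open>m * p\<close> for many primes \<open>p\<close>.\<close>

lemma limsup_witness:
  fixes Q :: "real \<Rightarrow> nat \<Rightarrow> real"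
  assumes Q: "\<And>y m. 1 \<le> y \<Longrightarrow> 1 \<le> m \<Longrightarrow> \<bar>Q y m\<bar> \<le> C"
  shows "\<exists>S. \<forall>\<tau>>0. (\<exists>Y. \<forall>y\<ge>Y. \<forall>m\<ge>1. Q y m \<le> S + \<tau>) \<and> (\<forall>Y. \<exists>y\<ge>Y. \<exists>m\<ge>1. S - \<tau> \<le> Q y m)"
proof -
  define X where "X = {s. \<exists>Y. \<forall>y\<ge>Y. \<forall>m\<ge>1. Q y m \<le> s}"
  have "C \<in> X" unfolding X_def using Q by (auto intro!: exI[of _ 1] dest: abs_le_D1)
  then have ne: "X \<noteq> {}" by blast
  have bdd: "bdd_below X"
  proof (rule bdd_belowI)
    fix s assume "s \<in> X"
    then obtain Y where "\<forall>y\<ge>Y. \<forall>m\<ge>1. Q y m \<le> s" unfolding X_def by blast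
    then have "Q (max Y 1) 1 \<le> s" by simp
    moreover have "\<bar>Q (max Y 1) 1\<bar> \<le> C" using Q by simp
    ultimately show "- C \<le> s" by linarith
  qed
  show ?thesis
  proof (rule exI[of _ "Inf X"], intro allI impI conjI)
    fix \<tau> :: real assume \<tau>: "0 < \<tau>"
    then have "\<exists>s\<in>X. s < Inf X + \<tau>" using ne bdd by (subst cInf_less_iff[symmetric]) auto
    then show "\<exists>Y. \<forall>y\<ge>Y. \<forall>m\<ge>1. Q y m \<le> Inf X + \<tau>"
      unfolding X_def by (auto intro: less_imp_le order_trans) (meson less_imp_le order_trans)
    fix Y
    have "Inf X - \<tau> \<notin> X" using cInf_lower[OF _ bdd, of "Inf X - \<tau>"] \<tau> by auto
    then show "\<exists>y\<ge>Y. \<exists>m\<ge>1. Inf X - \<tau> \<le> Q y m"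
      unfolding X_def by (auto simp: not_le) (meson less_imp_le)
  qed
qed

text \<open>If \<open>U\<close> were exactly the weighted mean of the \<open>W p\<close>, the left
  side would be the mean of their squared norms minus the squared norm of \<open>U\<close>. The
  defect \<open>e\<close> enters once, through the inner product with \<open>U\<close>.\<close>

lemma weighted_variance_le:
  fixes w :: "'b \<Rightarrow> real" and U c :: "'i \<Rightarrow> real" and W :: "'b \<Rightarrow> 'i \<Rightarrow> real"
  assumes w: "\<And>p. p \<in> B \<Longrightarrow> 0 \<le> w p" "(\<Sum>p\<in>B. w p) = 1" and c: "\<And>i. i \<in> K \<Longrightarrow> 0 \<le> c i"
    and U: "\<And>i. i \<in> K \<Longrightarrow> \<bar>U i\<bar> \<le> b"
    and e: "\<And>i. i \<in> K \<Longrightarrow> \<bar>U i - (\<Sum>p\<in>B. w p * W p i)\<bar> \<le> e"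
    and M: "\<And>p. p \<in> B \<Longrightarrow> (\<Sum>i\<in>K. c i * (W p i)\<^sup>2) \<le> M"
  shows "(\<Sum>p\<in>B. w p * (\<Sum>i\<in>K. c i * (U i - W p i)\<^sup>2))
           \<le> M - (\<Sum>i\<in>K. c i * (U i)\<^sup>2) + 2 * b * e * (\<Sum>i\<in>K. c i)"
proof -
  have "(\<Sum>p\<in>B. w p * (\<Sum>i\<in>K. c i * (U i - W p i)\<^sup>2))
      = (\<Sum>p\<in>B. w p * (\<Sum>i\<in>K. c i * (U i)\<^sup>2)) - 2 * (\<Sum>p\<in>B. w p * (\<Sum>i\<in>K. c i * U i * W p i))
        + (\<Sum>p\<in>B. w p * (\<Sum>i\<in>K. c i * (W p i)\<^sup>2))"
    by (simp add: power2_diff algebra_simps sum.distrib sum_subtractf sum_distrib_left)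
  also have "(\<Sum>p\<in>B. w p * (\<Sum>i\<in>K. c i * (U i)\<^sup>2)) = (\<Sum>i\<in>K. c i * (U i)\<^sup>2)"
    using w(2) by (simp add: sum_distrib_right[symmetric])
  also have "(\<Sum>p\<in>B. w p * (\<Sum>i\<in>K. c i * U i * W p i)) = (\<Sum>i\<in>K. c i * U i * (\<Sum>p\<in>B. w p * W p i))"
    unfolding sum_distrib_left by (subst sum.swap) (simp add: mult_ac)
  also have "(\<Sum>p\<in>B. w p * (\<Sum>i\<in>K. c i * (W p i)\<^sup>2)) \<le> (\<Sum>p\<in>B. w p * M)"
    using w M by (intro sum_mono mult_left_mono) auto
  also have "(\<Sum>p\<in>B. w p * M) = M"
    using w(2) by (simp add: sum_distrib_right[symmetric])
  finally have 1: "(\<Sum>p\<in>B. w p * (\<Sum>i\<in>K. c i * (U i - W p i)\<^sup>2))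
      \<le> (\<Sum>i\<in>K. c i * (U i)\<^sup>2) - 2 * (\<Sum>i\<in>K. c i * U i * (\<Sum>p\<in>B. w p * W p i)) + M"
    by simp
  have "(\<Sum>i\<in>K. c i * (U i)\<^sup>2) - (\<Sum>i\<in>K. c i * U i * (\<Sum>p\<in>B. w p * W p i))
      = (\<Sum>i\<in>K. c i * (U i * (U i - (\<Sum>p\<in>B. w p * W p i))))"
    by (simp add: sum_subtractf[symmetric] power2_eq_square algebra_simps)
  also have "\<dots> \<le> (\<Sum>i\<in>K. c i * (b * e))"
  proof (intro sum_mono mult_left_mono)
    fix i assume i: "i \<in> K"
    have "U i * (U i - (\<Sum>p\<in>B. w p * W p i)) \<le> \<bar>U i\<bar> * \<bar>U i - (\<Sum>p\<in>B. w p * W p i)\<bar>"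
      by (simp flip: abs_mult)
    also have "\<dots> \<le> b * e"
      using U[OF i] e[OF i] by (intro mult_mono) auto
    finally show "U i * (U i - (\<Sum>p\<in>B. w p * W p i)) \<le> b * e" .
  qed (use c in auto)
  also have "\<dots> = b * e * (\<Sum>i\<in>K. c i)"
    by (simp add: sum_distrib_left mult_ac)
  finally show ?thesis using 1 by (simp add: algebra_simps)
qed


text \<open>The index \<open>i\<close> moves down a grid of step \<theta> on the logarithmic scale.
  With \<open>m\<close> as a parameter, the family is closed under passing from
  \<open>(y, m)\<close> to \<open>(y / p, m * p)\<close>, the move made by
  \<open>avg_prime_dilates\<close>.\<close>

definition scaled_avg :: "(nat \<Rightarrow> real) \<Rightarrow> real \<Rightarrow> real \<Rightarrow> nat \<Rightarrow> nat \<Rightarrow> real" where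
  "scaled_avg g \<theta> y m i = avg (\<lambda>n. g (m * n)) (y * exp (- (\<theta> * real i)))"

text \<open>Choose \<open>y\<close> and \<open>m\<close> such that the quadratic form \<open>Q\<close> below nearly attains its limit superior. The
  vector \<open>V y m\<close> is almost an average of the vectors \<open>V (y / p) (m * p)\<close>, on which \<open>Q\<close> is not
  essentially larger, so strict convexity forces most of them to be close to \<open>V y m\<close>. The dominant
  term of \<open>Q\<close> ensures that the near-maximiser still oscillates.\<close>

lemma few_bad_primes:
  fixes g :: "nat \<Rightarrow> real" and \<theta> \<kappa> \<delta> :: real and R :: nat
  defines "V \<equiv> scaled_avg g \<theta>"
  assumes g: "\<And>n. \<bar>g n\<bar> \<le> 1" and \<theta>: "0 < \<theta>" and \<kappa>: "0 < \<kappa>" and \<delta>: "0 < \<delta>"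
    and osc: "\<And>Y. \<exists>y\<ge>Y. \<kappa> \<le> \<bar>V y 1 R - V y 1 0\<bar>"
  shows "\<exists>L. \<forall>P Y. \<exists>y\<ge>Y. \<exists>m\<ge>1. \<kappa> / 2 \<le> \<bar>V y m R - V y m 0\<bar> \<and>
           (\<Sum>p\<in>{p. prime p \<and> p \<le> P \<and> (\<exists>i\<le>R. \<delta> < \<bar>V (y / real p) (m * p) i - V y m i\<bar>)}. 1 / real p) \<le> L"
proof -
  \<comment> \<open>All terms of weight \<epsilon> together contribute at most
    \<open>\<kappa>\<^sup>2 / 4\<close> to \<open>Q\<close>.\<close>
  define \<epsilon> where "\<epsilon> = \<kappa>\<^sup>2 / (4 * (real R + 1))"
  define K where "K = {..Suc R}"
  \<comment> \<open>The extra coordinate \<open>Suc R\<close> is the oscillation itself. It gets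
    weight 1, while the small weight on the other coordinates is what detects bad primes.\<close>
  define U where "U y m i = (if i \<le> R then V y m i else V y m R - V y m 0)" for y m i
  define c where "c i = (if i \<le> R then \<epsilon> else 1)" for i
  define Q where "Q y m = (\<Sum>i\<in>K. c i * (U y m i)\<^sup>2)" for y m
  define C where "C = \<epsilon> * (real R + 1) + 1"
  have \<epsilon>: "0 < \<epsilon>" using \<kappa> by (simp add: \<epsilon>_def)
  have c0: "0 \<le> c i" for i using \<epsilon> by (simp add: c_def)
  have sum_c: "(\<Sum>i\<in>K. c i) = C"
    by (simp add: K_def c_def C_def mult.commute)
  have C1: "1 \<le> C" using \<epsilon> by (simp add: C_def)
  have V1: "\<bar>V y m i\<bar> \<le> 1" if "0 < y" for y m i
    unfolding V_def scaled_avg_def using that g by (intro avg_abs_le) auto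
  have U2: "\<bar>U y m i\<bar> \<le> 2" if "0 < y" for y m i
    using V1[OF that, of m i] V1[OF that, of m R] V1[OF that, of m 0] by (auto simp: U_def)
  have Q0: "0 \<le> Q y m" for y m
    unfolding Q_def using c0 by (intro sum_nonneg) auto
  have "Q y m \<le> (\<Sum>i\<in>K. c i * 2\<^sup>2)" if "0 < y" for y m
    unfolding Q_def using U2[OF that] c0 by (intro sum_mono mult_left_mono abs_le_square_iff[THEN iffD1]) auto
  then have "\<bar>Q y m\<bar> \<le> 4 * C" if "1 \<le> y" "1 \<le> m" for y m
    using Q0[of y m] sum_c that by (simp add: sum_distrib_right[symmetric] mult.commute)
  then obtain S where S: "\<And>\<tau>. 0 < \<tau> \<Longrightarrow> \<exists>Y. \<forall>y\<ge>Y. \<forall>m\<ge>1. Q y m \<le> S + \<tau>"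
    "\<And>\<tau> Y. 0 < \<tau> \<Longrightarrow> \<exists>y\<ge>Y. \<exists>m\<ge>1. S - \<tau> \<le> Q y m"
    using limsup_witness[of Q "4 * C"] by metis
  have Q_split: "Q y m = (V y m R - V y m 0)\<^sup>2 + \<epsilon> * (\<Sum>i\<le>R. (V y m i)\<^sup>2)" for y m
    by (simp add: Q_def K_def U_def c_def sum_distrib_left)
  have Q_lower: "(V y m R - V y m 0)\<^sup>2 \<le> Q y m" for y m
    unfolding Q_split using \<epsilon> by (simp add: sum_nonneg)
  have Q_upper: "Q y m \<le> (V y m R - V y m 0)\<^sup>2 + \<kappa>\<^sup>2 / 4" if "0 < y" for y m
  proof -
    have "(\<Sum>i\<le>R. (V y m i)\<^sup>2) \<le> (\<Sum>i\<le>R. 1)"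
      using V1[OF that] by (intro sum_mono) (simp add: abs_square_le_1)
    then have "\<epsilon> * (\<Sum>i\<le>R. (V y m i)\<^sup>2) \<le> \<epsilon> * (real R + 1)"
      using \<epsilon> by (intro mult_left_mono) auto
    moreover have "\<epsilon> * (real R + 1) = \<kappa>\<^sup>2 / 4"
    proof -
      have "4 * (real R + 1) \<noteq> 0" by simp
      then have "\<kappa>\<^sup>2 = \<epsilon> * (4 * (real R + 1))"
        unfolding \<epsilon>_def by (rule nonzero_divide_eq_eq[THEN iffD1, OF _ refl])
      then show ?thesis by simp
    qed
    ultimately show ?thesis unfolding Q_split by linarith
  qed
  \<comment> \<open>The first bound makes the slack \<open>2 * \<tau>\<close> at most a quarter of
    the variance \<open>\<epsilon> * \<delta>\<^sup>2\<close> forced by bad primes; \<open>e\<close>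
    below is chosen so that its error takes another quarter. The second bound leaves
    \<open>\<kappa>\<^sup>2 / 4\<close> for the squared oscillation of a near-maximiser.\<close>
  define \<tau> where "\<tau> = min (\<epsilon> * \<delta>\<^sup>2 / 8) (\<kappa>\<^sup>2 / 4)"
  have \<tau>: "0 < \<tau>" "\<tau> \<le> \<epsilon> * \<delta>\<^sup>2 / 8" "\<tau> \<le> \<kappa>\<^sup>2 / 4"
    using \<epsilon> \<delta> \<kappa> by (auto simp: \<tau>_def)
  define e where "e = \<epsilon> * \<delta>\<^sup>2 / (32 * C)"
  have e: "0 < e" using \<epsilon> \<delta> C1 by (simp add: e_def)
  obtain Y1 where Y1: "\<And>y m. Y1 \<le> y \<Longrightarrow> 1 \<le> m \<Longrightarrow> Q y m \<le> S + \<tau>"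
    using S(1)[OF \<tau>(1)] by blast
  have S\<kappa>: "\<kappa>\<^sup>2 \<le> S + \<tau>"
  proof -
    obtain y where "y \<ge> Y1" "\<kappa> \<le> \<bar>V y 1 R - V y 1 0\<bar>" using osc by blast
    then have "\<kappa>\<^sup>2 \<le> (V y 1 R - V y 1 0)\<^sup>2" "Q y 1 \<le> S + \<tau>"
      using \<kappa> Y1 abs_le_square_iff[of \<kappa> "V y 1 R - V y 1 0"] by auto
    then show ?thesis using Q_lower[of y 1] by linarith
  qed
  show ?thesis
  proof (rule exI[of _ "2 / e\<^sup>2"], intro allI)
    fix P :: nat and Y :: real
    \<comment> \<open>One summand keeps every \<open>y / p\<close> in the range where
      \<open>Q\<close> is at most \<open>S + \<tau>\<close>; the other keeps every grid point above
      twice the number of primes used, as \<open>avg_prime_dilates\<close> demands.\<close>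
    obtain y m where y: "max (max Y 1) (real P * max Y1 1 + 2 * real P * exp (\<theta> * real R)) \<le> y" and m: "1 \<le> m"
      and Qy: "S - \<tau> \<le> Q y m"
      using S(2)[OF \<tau>(1)] by blast
    have y1: "Y \<le> y" "1 \<le> y" "real P * max Y1 1 \<le> y" "2 * real P * exp (\<theta> * real R) \<le> y"
    proof -
      have "max Y 1 \<le> y" "real P * max Y1 1 + 2 * real P * exp (\<theta> * real R) \<le> y"
        using y by auto
      moreover have "0 \<le> real P * max Y1 1" "0 \<le> 2 * real P * exp (\<theta> * real R)"
        by auto
      ultimately show "Y \<le> y" "1 \<le> y" "real P * max Y1 1 \<le> y" "2 * real P * exp (\<theta> * real R) \<le> y"
        by linarith+
    qed
    then have y0: "0 < y" by linarith
    have "\<kappa>\<^sup>2 / 4 \<le> (V y m R - V y m 0)\<^sup>2"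
      using S\<kappa> Qy Q_upper[OF y0, of m] \<tau>(3) by linarith
    then have "(\<kappa> / 2)\<^sup>2 \<le> (V y m R - V y m 0)\<^sup>2" by (simp add: power_divide)
    then have big: "\<kappa> / 2 \<le> \<bar>V y m R - V y m 0\<bar>"
      using \<kappa> abs_le_square_iff[of "\<kappa> / 2" "V y m R - V y m 0"] by simp
    define B where "B = {p. prime p \<and> p \<le> P \<and> (\<exists>i\<le>R. \<delta> < \<bar>V (y / real p) (m * p) i - V y m i\<bar>)}"
    let ?L = "\<Sum>p\<in>B. 1 / real p"
    have "?L \<le> 2 / e\<^sup>2"
    \<comment> \<open>Bad primes of reciprocal mass above \<open>2 / e\<^sup>2\<close> could serve
      alone as \<open>B\<close> in \<open>avg_prime_dilates\<close>. Their vectors would nearly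
      average to \<open>U y m\<close>, although each is \<delta> away from it in some
      coordinate.\<close>
    proof (rule ccontr)
      assume "\<not> ?L \<le> 2 / e\<^sup>2"
      then have L: "2 / e\<^sup>2 \<le> ?L" by simp
      then have L0: "0 < ?L" using e by (smt (verit) divide_pos_pos zero_less_power)
      have fin: "finite B" unfolding B_def by (rule finite_subset[of _ "{..P}"]) auto
      have Bp: "0 < p" "1 \<le> p" "p \<le> P" "prime p" if "p \<in> B" for p
        using that prime_gt_0_nat[of p] by (auto simp: B_def)
      have cardB: "card B \<le> P"
      proof -
        have "B \<subseteq> {1..P}" using Bp by (auto simp: Suc_le_eq)
        then have "card B \<le> card {1..P}" by (intro card_mono) auto
        then show ?thesis by simp
      qed
      define w where "w p = 1 / real p / ?L" for p
      have w0: "0 \<le> w p" for p using L0 by (simp add: w_def)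
      have w1: "(\<Sum>p\<in>B. w p) = 1"
        unfolding w_def sum_divide_distrib[symmetric] using L0 by simp
      have VV: "\<bar>V y m i - (\<Sum>p\<in>B. w p * V (y / real p) (m * p) i)\<bar> \<le> e" if i: "i \<le> R" for i
      proof -
        let ?z = "y * exp (- (\<theta> * real i))"
        have "2 * real (card B) * exp (\<theta> * real i) \<le> 2 * real P * exp (\<theta> * real R)"
          using cardB i \<theta> by (intro mult_mono) auto
        then have "2 * real (card B) * exp (\<theta> * real i) \<le> y" using y1(4) by linarith
        then have "2 * real (card B) * exp (\<theta> * real i) * exp (- (\<theta> * real i)) \<le> ?z"
          by (intro mult_right_mono) auto
        then have z: "2 * real (card B) \<le> ?z" by (simp add: mult.assoc flip: exp_add)
        have "\<bar>avg (\<lambda>n. g (m * n)) ?z - (\<Sum>p\<in>B. 1 / real p / ?L * avg (\<lambda>n. g (m * (p * n))) (?z / real p))\<bar> \<le> e"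
          using y0 by (intro avg_prime_dilates[OF fin _ _ _ z e L]) (auto intro: g Bp)
        then show ?thesis
          by (simp add: V_def scaled_avg_def w_def mult.assoc)
      qed
      \<comment> \<open>The oscillation coordinate is a difference of two averages, hence the
        doubled error.\<close>
      have UU: "\<bar>U y m i - (\<Sum>p\<in>B. w p * U (y / real p) (m * p) i)\<bar> \<le> 2 * e" for i
      proof (cases "i \<le> R")
        case True
        then show ?thesis using VV[OF True] e by (simp add: U_def)
      next
        case False
        have "U y m i - (\<Sum>p\<in>B. w p * U (y / real p) (m * p) i)
           = (V y m R - (\<Sum>p\<in>B. w p * V (y / real p) (m * p) R))
             - (V y m 0 - (\<Sum>p\<in>B. w p * V (y / real p) (m * p) 0))"
          using False by (simp add: U_def right_diff_distrib sum_subtractf)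
        then show ?thesis using VV[of R] VV[of 0] by linarith
      qed
      have QM: "(\<Sum>i\<in>K. c i * (U (y / real p) (m * p) i)\<^sup>2) \<le> S + \<tau>" if p: "p \<in> B" for p
      proof -
        have "real p * max Y1 1 \<le> real P * max Y1 1"
          using Bp[OF p] by (intro mult_right_mono) auto
        then have "max Y1 1 \<le> y / real p"
          using Bp[OF p] y1(3) by (simp add: le_divide_eq mult.commute)
        then show ?thesis
          using Y1[of "y / real p" "m * p"] m Bp[OF p] by (simp add: Q_def)
      qed
      have "(\<Sum>p\<in>B. w p * (\<Sum>i\<in>K. c i * (U y m i - U (y / real p) (m * p) i)\<^sup>2))
          \<le> (S + \<tau>) - (\<Sum>i\<in>K. c i * (U y m i)\<^sup>2) + 2 * 2 * (2 * e) * (\<Sum>i\<in>K. c i)"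
        by (rule weighted_variance_le) (use w0 w1 c0 U2[OF y0] UU QM in auto)
      also have "\<dots> \<le> 2 * \<tau> + 8 * e * C"
        using Qy by (simp add: sum_c Q_def)
      also have "8 * e * C = \<epsilon> * \<delta>\<^sup>2 / 4"
        using C1 by (simp add: e_def)
      also have "2 * \<tau> + \<epsilon> * \<delta>\<^sup>2 / 4 < \<epsilon> * \<delta>\<^sup>2"
      proof -
        have "0 < \<epsilon> * \<delta>\<^sup>2" using \<epsilon> \<delta> by simp
        then show ?thesis using \<tau>(2) by linarith
      qed
      also have "\<epsilon> * \<delta>\<^sup>2 = (\<Sum>p\<in>B. w p * (\<epsilon> * \<delta>\<^sup>2))"
        using w1 by (simp add: sum_distrib_right[symmetric])
      also have "\<dots> \<le> (\<Sum>p\<in>B. w p * (\<Sum>i\<in>K. c i * (U y m i - U (y / real p) (m * p) i)\<^sup>2))"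
      proof (intro sum_mono mult_left_mono w0)
        fix p assume "p \<in> B"
        then obtain i where i: "i \<le> R" "\<delta> < \<bar>V (y / real p) (m * p) i - V y m i\<bar>"
          unfolding B_def by blast
        then have "\<delta>\<^sup>2 \<le> (U y m i - U (y / real p) (m * p) i)\<^sup>2"
          using \<delta> abs_le_square_iff[of \<delta> "U y m i - U (y / real p) (m * p) i"]
          by (simp add: U_def abs_minus_commute)
        then have "\<epsilon> * \<delta>\<^sup>2 \<le> c i * (U y m i - U (y / real p) (m * p) i)\<^sup>2"
          using i \<epsilon> by (simp add: c_def)
        also have "\<dots> \<le> (\<Sum>i\<in>K. c i * (U y m i - U (y / real p) (m * p) i)\<^sup>2)"
          using i c0 by (intro member_le_sum) (auto simp: K_def)
        finally show "\<epsilon> * \<delta>\<^sup>2 \<le> (\<Sum>i\<in>K. c i * (U y m i - U (y / real p) (m * p) i)\<^sup>2)" .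
      qed
      finally show False by simp
    qed
    then show "\<exists>y\<ge>Y. \<exists>m\<ge>1. \<kappa> / 2 \<le> \<bar>V y m R - V y m 0\<bar> \<and>
           (\<Sum>p\<in>{p. prime p \<and> p \<le> P \<and> (\<exists>i\<le>R. \<delta> < \<bar>V (y / real p) (m * p) i - V y m i\<bar>)}. 1 / real p) \<le> 2 / e\<^sup>2"
      using y1(1) m big unfolding B_def by blast
  qed
qed


section \<open>Oscillation against the density of primes\<close>

lemma sum_Un_le_add:
  fixes h :: "'a \<Rightarrow> real"
  assumes "finite A" "finite B" "\<And>x. 0 \<le> h x"
  shows "sum h (A \<union> B) \<le> sum h A + sum h B"
  using assms by (subst sum_Un) (auto intro!: sum_nonneg)

lemma sum_UN_le_sum:
  fixes h :: "'a \<Rightarrow> real"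
  assumes "finite A" "\<And>a. a \<in> A \<Longrightarrow> finite (F a)" "\<And>x. 0 \<le> h x"
  shows "sum h (\<Union>a\<in>A. F a) \<le> (\<Sum>a\<in>A. sum h (F a))"
  using assms
proof (induction A)
  case (insert a A)
  have "sum h (F a \<union> (\<Union>a\<in>A. F a)) \<le> sum h (F a) + sum h (\<Union>a\<in>A. F a)"
    using insert by (intro sum_Un_le_add) auto
  then show ?case using insert by auto
qed simp

text \<open>Suppose the averages oscillate. For good primes \<open>p\<close> of one colour, \<open>V y m i\<close> is up to \<open>\<theta>\<close> the value
  of one and the same Lipschitz function at \<open>ln p + \<theta> * i\<close>. Hence, for indices \<open>i\<close> with well separated
  values of \<open>V y m\<close>, the translates by \<open>i\<close> of the set of windows of length \<open>\<theta>\<close> containing such primes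
  are disjoint. There are about \<open>\<kappa> / \<theta>\<close> such indices, whereas a window carries at most about
  \<open>1 / sqrt \<theta>\<close> times its fair share of primes. For small \<open>\<theta>\<close> the good primes are then too sparse.\<close>

lemma avg_slowly_varying:
  fixes g :: "nat \<Rightarrow> real" and col :: "nat \<Rightarrow> 'c"
  assumes g: "\<And>n. \<bar>g n\<bar> \<le> 1" and fin: "finite (col ` {p. prime p})"
    and col: "\<And>p q m. prime p \<Longrightarrow> prime q \<Longrightarrow> col p = col q \<Longrightarrow> 1 \<le> m \<Longrightarrow> g (p * m) = g (q * m)"
    and s: "0 < s"
  shows "((\<lambda>y. avg g y - avg g (y * exp (- s))) \<longlongrightarrow> 0) at_top"
proof (rule ccontr)
  assume "\<not> ?thesis"
  then obtain \<kappa> where \<kappa>: "0 < \<kappa>" and "\<not> (\<forall>\<^sub>F y in at_top. \<bar>avg g y - avg g (y * exp (- s))\<bar> < \<kappa>)"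
    unfolding tendsto_iff by auto
  then have osc0: "\<exists>y\<ge>Y. \<kappa> \<le> \<bar>avg g y - avg g (y * exp (- s))\<bar>" for Y
    unfolding eventually_at_top_linorder by (meson not_le)
  define C where "C = col ` {p. prime p}"
  define r where "r = card C"
  have r: "1 \<le> r"
    using fin two_is_prime_nat unfolding r_def C_def by (metis One_nat_def Suc_leI card_gt_0_iff empty_iff imageI mem_Collect_eq)
  \<comment> \<open>\<open>8064 = 8 * 28 * 36\<close> brings the sum over all windows down to \<open>(1 + ln (N + R)) / 8\<close>.\<close>
  define \<theta>0 where "\<theta>0 = min (1/8) (min (\<kappa> / 36) ((\<kappa> / (8064 * real r))\<^sup>2))"
  have \<theta>0: "0 < \<theta>0" using \<kappa> r by (simp add: \<theta>0_def)
  define R where "R = nat \<lceil>s / \<theta>0\<rceil>"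
  have R: "s / \<theta>0 \<le> real R" unfolding R_def by linarith
  have R0: "0 < real R" using R s \<theta>0 by (smt (verit) divide_pos_pos)
  \<comment> \<open>Dividing \<open>s\<close> exactly puts both scales \<open>y\<close> and
    \<open>y * exp (- s)\<close> on the grid.\<close>
  define \<theta> where "\<theta> = s / real R"
  have \<theta>: "0 < \<theta>" and \<theta>R: "\<theta> * real R = s" using s R0 by (auto simp: \<theta>_def)
  have "\<theta> \<le> \<theta>0" using R R0 \<theta>0 by (simp add: \<theta>_def field_simps)
  then have \<theta>s: "\<theta> \<le> 1/8" "\<theta> \<le> \<kappa> / 36" "\<theta> \<le> (\<kappa> / (8064 * real r))\<^sup>2"
    by (auto simp: \<theta>0_def)
  have sq: "sqrt \<theta> * (8064 * real r) \<le> \<kappa>"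
  proof -
    have "sqrt \<theta> \<le> \<kappa> / (8064 * real r)" using \<theta>s(3) \<kappa> r by (intro real_le_lsqrt) auto
    then show ?thesis using r by (simp add: le_divide_eq)
  qed
  \<comment> \<open>\<open>9 * \<theta>\<close> is the separation \<open>6 * \<theta>\<close> plus
    the largest step \<open>3 * \<theta>\<close> of \<open>V y m\<close>, and
    \<open>\<kappa> / 2\<close> is the oscillation that \<open>few_bad_primes\<close> leaves. By
    \<open>\<theta> \<le> \<kappa> / 36\<close> the floor costs at most a factor 2.\<close>
  define I where "I = nat \<lfloor>\<kappa> / (18 * \<theta>)\<rfloor>"
  have I_ub: "real I * (9 * \<theta>) \<le> \<kappa> / 2" and I_lb: "\<kappa> / (36 * \<theta>) \<le> real I"
  proof -
    have "1 \<le> \<kappa> / (36 * \<theta>)" using \<theta>s(2) \<theta> by (simp add: field_simps)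
    moreover have "\<kappa> / (18 * \<theta>) = 2 * (\<kappa> / (36 * \<theta>))" by simp
    ultimately show "\<kappa> / (36 * \<theta>) \<le> real I" unfolding I_def by linarith
    have "real I \<le> \<kappa> / (18 * \<theta>)" unfolding I_def using \<kappa> \<theta> by simp
    then show "real I * (9 * \<theta>) \<le> \<kappa> / 2" using \<theta> by (simp add: field_simps)
  qed
  have I0: "0 < real I" using I_lb \<kappa> \<theta> by (smt (verit) divide_pos_pos)
  define V where "V = scaled_avg g \<theta>"
  have "\<exists>y\<ge>Y. \<kappa> \<le> \<bar>V y 1 R - V y 1 0\<bar>" for Y
    using osc0[of Y] \<theta>R by (simp add: V_def scaled_avg_def abs_minus_commute)
  then obtain L0 where L0: "\<And>P Y. \<exists>y\<ge>Y. \<exists>m\<ge>1. \<kappa> / 2 \<le> \<bar>V y m R - V y m 0\<bar> \<and>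
      (\<Sum>p\<in>{p. prime p \<and> p \<le> P \<and> (\<exists>i\<le>R. \<theta> < \<bar>V (y / real p) (m * p) i - V y m i\<bar>)}. 1 / real p) \<le> L0"
    using few_bad_primes[of g \<theta> \<kappa> \<theta> R] g \<theta> \<kappa> unfolding V_def by blast
  \<comment> \<open>Beyond \<open>n0\<close> both the window estimate and the translation lemma
    apply; the finitely many smaller primes form the constant \<open>C1\<close>.\<close>
  define n0 where "n0 = max (max R 1) (nat \<lceil>2 / \<theta> / \<theta>\<rceil>)"
  have n0: "R \<le> n0" "1 \<le> n0" by (auto simp: n0_def)
  have n0big: "2 / \<theta> \<le> exp (\<theta> * real n)" if "n0 \<le> n" for n
  proof -
    have "2 / \<theta> / \<theta> \<le> real n0" unfolding n0_def by linarith
    then have "2 / \<theta> \<le> \<theta> * real n0" using \<theta> by (simp add: field_simps)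
    also have "\<dots> \<le> \<theta> * real n" using that \<theta> by simp
    also have "\<dots> \<le> exp (\<theta> * real n)" using exp_ge_add_one_self[of "\<theta> * real n"] by linarith
    finally show ?thesis .
  qed
  define S where "S = {p. prime p \<and> ln (real p) < \<theta> * real n0}"
  have finS: "finite S"
  proof (rule finite_subset)
    show "S \<subseteq> {..nat \<lceil>exp (\<theta> * real n0)\<rceil>}"
    proof
      fix p assume "p \<in> S"
      then have "0 < real p" "ln (real p) < \<theta> * real n0"
        using prime_gt_0_nat by (auto simp: S_def)
      then have "real p < exp (\<theta> * real n0)" by (metis exp_less_cancel_iff exp_ln)
      then show "p \<in> {..nat \<lceil>exp (\<theta> * real n0)\<rceil>}" by simp linarith
    qed
  qed simp
  define C1 where "C1 = (\<Sum>p\<in>S. 1 / real p)"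
  \<comment> \<open>All primes up to \<open>P\<close> weigh at least
    \<open>ln (\<theta> * N) / 2\<close>, the good windows at most
    \<open>(1 + ln (N + R)) / 8\<close>; since 1/2 exceeds 1/8, the gap outgrows the
    constants.\<close>
  have "filterlim (\<lambda>N. ln (\<theta> * real N) / 2 - (1 + ln (real N + real R)) / 8) at_top sequentially"
    using \<theta> by real_asymp
  then have "\<forall>\<^sub>F N in sequentially. C1 + L0 < ln (\<theta> * real N) / 2 - (1 + ln (real N + real R)) / 8"
    by (auto simp: filterlim_at_top_dense)
  then have "\<forall>\<^sub>F N in sequentially. C1 + L0 + (1 + ln (real N + real R)) / 8 < ln (\<theta> * real N) / 2"
    by (rule eventually_mono) linarith
  then obtain N where N: "1 \<le> N" "C1 + L0 + (1 + ln (real (N + R))) / 8 < ln (\<theta> * real N) / 2"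
    unfolding eventually_sequentially by (metis of_nat_add max.cobounded1 max.cobounded2)
  define P where "P = nat \<lfloor>exp (\<theta> * real N)\<rfloor>"
  have P1: "1 \<le> P" unfolding P_def using \<theta> by (simp add: le_nat_iff)
  have P2: "\<theta> * real N \<le> ln (real P + 1)"
  proof -
    have "exp (\<theta> * real N) \<le> real P + 1" unfolding P_def by linarith
    then show ?thesis by (subst ln_ge_iff) auto
  qed
  have P3: "ln (real p) \<le> \<theta> * real N" if "p \<le> P" "0 < p" for p
  proof -
    have "real P \<le> exp (\<theta> * real N)" unfolding P_def by simp
    then have "real p \<le> exp (\<theta> * real N)" using that by linarith
    then show ?thesis using that by (metis ln_exp ln_le_cancel_iff exp_gt_zero of_nat_0_less_iff)
  qed
  obtain y m where y: "real P * exp s / \<theta> \<le> y" and m: "1 \<le> m" and osc: "\<kappa> / 2 \<le> \<bar>V y m R - V y m 0\<bar>"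
    and bad: "(\<Sum>p\<in>{p. prime p \<and> p \<le> P \<and> (\<exists>i\<le>R. \<theta> < \<bar>V (y / real p) (m * p) i - V y m i\<bar>)}. 1 / real p) \<le> L0"
    using L0 by blast
  have y0: "0 < y" using y P1 \<theta> by (smt (verit) divide_pos_pos exp_gt_zero mult_pos_pos of_nat_0_less_iff Suc_le_eq One_nat_def)
  have lip: "\<bar>avg h (y / real p * exp (- (\<theta> * real i))) - avg h (y / real q * exp (- (\<theta> * real j)))\<bar> \<le> 3 * \<theta>"
    if h: "\<And>n. \<bar>h n\<bar> \<le> 1" and pq: "0 < p" "p \<le> P" "0 < q" "q \<le> P" and ij: "i \<le> R" "j \<le> R"
      and close: "\<bar>(ln (real q) + \<theta> * real j) - (ln (real p) + \<theta> * real i)\<bar> \<le> \<theta>" for h p q i j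
  proof -
    \<comment> \<open>The smallest scale that can occur; \<open>y\<close> was taken so large that
      its rounding error \<open>1 / b\<close> is at most \<theta>.\<close>
    define b where "b = y / real P * exp (- s)"
    have b0: "0 < b" using y0 P1 by (simp add: b_def)
    have "1 / \<theta> \<le> b"
    proof -
      have "real P * exp s / \<theta> / real P * exp (- s) \<le> b"
        unfolding b_def using y by (intro mult_right_mono divide_right_mono) auto
      then show ?thesis using P1 by (simp add: exp_minus)
    qed
    then have b1: "1 / b \<le> \<theta>" using b0 \<theta> by (simp add: field_simps)
    have bb: "b \<le> y / real p * exp (- (\<theta> * real i))" if "0 < p" "p \<le> P" "i \<le> R" for p i
      unfolding b_def using that y0 \<theta> \<theta>R[symmetric]
      by (intro mult_mono divide_left_mono) (auto simp: mult_left_mono)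
    have ln: "ln (y / real p * exp (- (\<theta> * real i))) = ln y - (ln (real p) + \<theta> * real i)" if "0 < p" for p i
      using that y0 by (simp add: ln_mult ln_div)
    have "\<bar>avg h (y / real p * exp (- (\<theta> * real i))) - avg h (y / real q * exp (- (\<theta> * real j)))\<bar> \<le> 2 * \<theta> + 1 / b"
    proof (rule avg_log_lipschitz[OF h b0 bb[OF pq(1,2) ij(1)] bb[OF pq(3,4) ij(2)]])
      show "\<bar>ln (y / real p * exp (- (\<theta> * real i))) - ln (y / real q * exp (- (\<theta> * real j)))\<bar> \<le> \<theta>"
        unfolding ln[OF pq(1)] ln[OF pq(3)] using close by linarith
    qed
    then show ?thesis using b1 by linarith
  qed
  have step: "\<bar>V y m (Suc i) - V y m i\<bar> \<le> 3 * \<theta>" if "i < R" for i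
    unfolding V_def scaled_avg_def
    using lip[of "\<lambda>n. g (m * n)" 1 1 "Suc i" i] g P1 that \<theta> by (simp add: algebra_simps)
  have "real I * (6 * \<theta> + 3 * \<theta>) \<le> \<kappa> / 2" using I_ub by simp
  then obtain J where J: "J \<subseteq> {0..R}" "card J = I"
    and sep: "\<And>i i'. i \<in> J \<Longrightarrow> i' \<in> J \<Longrightarrow> i \<noteq> i' \<Longrightarrow> 6 * \<theta> \<le> \<bar>V y m i - V y m i'\<bar>"
    using separated_indices[OF step osc, of "6 * \<theta>" I] \<theta> by auto
  define B where "B = {p. prime p \<and> p \<le> P \<and> (\<exists>i\<le>R. \<theta> < \<bar>V (y / real p) (m * p) i - V y m i\<bar>)}"
  define win where "win n = {p. prime p \<and> \<theta> * real n \<le> ln (real p) \<and> ln (real p) < \<theta> * (real n + 1)}" for n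
  define W where "W c = {n\<in>{n0..N}. \<exists>p\<in>win n. p \<le> P \<and> p \<notin> B \<and> col p = c}" for c
  have Wsum: "real I * (\<Sum>n\<in>W c. 1 / real n) \<le> 2 * (1 + ln (real (N + R)))" for c
    unfolding J(2)[symmetric]
  proof (rule sum_reciprocals_translates_le[OF _ J(1) n0(2,1)])
    show "W c \<subseteq> {n0..N}" by (auto simp: W_def)
    fix n n' i i' assume n: "n \<in> W c" "n' \<in> W c" and i: "i \<in> J" "i' \<in> J" "i \<noteq> i'"
    show "n + i \<noteq> n' + i'"
    proof
      assume eq: "n + i = n' + i'"
      obtain p where p: "p \<in> win n" "p \<le> P" "p \<notin> B" "col p = c" using n by (auto simp: W_def)
      obtain q where q: "q \<in> win n'" "q \<le> P" "q \<notin> B" "col q = c" using n by (auto simp: W_def)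
      have pq: "prime p" "prime q" "0 < p" "0 < q"
        using p q prime_gt_0_nat by (auto simp: win_def)
      have iR: "i \<le> R" "i' \<le> R" using i J by auto
      have "\<theta> * real n + \<theta> * real i = \<theta> * real n' + \<theta> * real i'"
        using arg_cong[OF eq, of real] by (simp flip: distrib_left)
      then have close: "\<bar>(ln (real q) + \<theta> * real i') - (ln (real p) + \<theta> * real i)\<bar> \<le> \<theta>"
        using p(1) q(1) by (simp add: win_def distrib_left) linarith
      \<comment> \<open>Primes of one colour give the same dilate, so that the two vectors differ
        only through the scales \<open>y / p\<close> and \<open>y / q\<close>.\<close>
      have gpq: "(\<lambda>k. g (m * p * k)) = (\<lambda>k. g (m * q * k))"
      proof
        fix k
        show "g (m * p * k) = g (m * q * k)"
        proof (cases "k = 0")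
          case False
          then have "g (p * (m * k)) = g (q * (m * k))"
            using col[of p q "m * k"] pq p q m by simp
          then show ?thesis by (simp add: mult_ac)
        qed simp
      qed
      \<comment> \<open>This error and the two from goodness of \<open>p\<close> and
        \<open>q\<close> add up to \<open>5 * \<theta>\<close>, below the separation.\<close>
      have "\<bar>V (y / real p) (m * p) i - V (y / real q) (m * q) i'\<bar> \<le> 3 * \<theta>"
        unfolding V_def scaled_avg_def gpq using lip[OF _ pq(3) p(2) pq(4) q(2) iR close] g by simp
      moreover have "\<bar>V (y / real p) (m * p) i - V y m i\<bar> \<le> \<theta>"
        using p pq iR unfolding B_def by (auto simp: not_less)
      moreover have "\<bar>V (y / real q) (m * q) i' - V y m i'\<bar> \<le> \<theta>"
        using q pq iR unfolding B_def by (auto simp: not_less)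
      moreover have "6 * \<theta> \<le> \<bar>V y m i - V y m i'\<bar>" using sep i by blast
      ultimately show False using \<theta> by linarith
    qed
  qed
  have finwin: "finite (win n)" for n
  proof (rule finite_subset)
    show "win n \<subseteq> {..nat \<lceil>exp (\<theta> * (real n + 1))\<rceil>}"
    proof
      fix p assume "p \<in> win n"
      then have "0 < real p" "ln (real p) < \<theta> * (real n + 1)"
        using prime_gt_0_nat by (auto simp: win_def)
      then have "real p < exp (\<theta> * (real n + 1))" by (metis exp_less_cancel_iff exp_ln)
      then show "p \<in> {..nat \<lceil>exp (\<theta> * (real n + 1))\<rceil>}" by simp linarith
    qed
  qed simp
  have finB: "finite B" unfolding B_def by (rule finite_subset[of _ "{..P}"]) auto
  have finW: "finite (W c)" for c by (simp add: W_def)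
  have finC: "finite C" using fin by (simp add: C_def)
  \<comment> \<open>A prime is small, bad, or good; a good one marks its window for its colour. A
    marked window is then charged with all its primes, whatever their colours.\<close>
  have cover: "{p. prime p \<and> p \<le> P} \<subseteq> (S \<union> B) \<union> (\<Union>c\<in>C. \<Union>n\<in>W c. win n)"
  proof
    fix p assume p: "p \<in> {p. prime p \<and> p \<le> P}"
    then have p0: "0 < p" using prime_gt_0_nat by auto
    show "p \<in> (S \<union> B) \<union> (\<Union>c\<in>C. \<Union>n\<in>W c. win n)"
    proof (cases "p \<in> S \<or> p \<in> B")
      case False
      define n where "n = nat \<lfloor>ln (real p) / \<theta>\<rfloor>"
      have lnp: "\<theta> * real n0 \<le> ln (real p)" using False p by (auto simp: S_def)
      then have n0le: "real n0 \<le> ln (real p) / \<theta>" using \<theta> by (simp add: field_simps)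
      then have n1: "real n \<le> ln (real p) / \<theta>" "ln (real p) / \<theta> < real n + 1" "n0 \<le> n"
        unfolding n_def by linarith+
      have "ln (real p) / \<theta> \<le> real N" using P3[of p] p p0 \<theta> by (simp add: field_simps)
      then have "n \<le> N" using n1(1) by linarith
      moreover have w: "p \<in> win n" using n1 \<theta> p by (simp add: win_def field_simps)
      ultimately have "n \<in> W (col p)" using n1(3) p False by (auto simp: W_def)
      then show ?thesis using w p by (auto simp: C_def)
    qed auto
  qed
  have "ln (\<theta> * real N) / 2 \<le> ln (ln (real P + 1)) / 2"
  proof -
    have "0 < \<theta> * real N" using \<theta> N(1) by simp
    then have "ln (\<theta> * real N) \<le> ln (ln (real P + 1))"
      using P2 by (subst ln_le_cancel_iff) linarith+
    then show ?thesis by simp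
  qed
  also have "\<dots> \<le> (\<Sum>p\<in>{p. prime p \<and> p \<le> P}. 1 / real p)"
    by (rule sum_prime_reciprocals_ge[OF P1])
  also have "\<dots> \<le> (\<Sum>p\<in>(S \<union> B) \<union> (\<Union>c\<in>C. \<Union>n\<in>W c. win n). 1 / real p)"
    using finS finB finC finW finwin by (intro sum_mono2 cover) auto
  also have "\<dots> \<le> (\<Sum>p\<in>S. 1 / real p) + (\<Sum>p\<in>B. 1 / real p) + (\<Sum>p\<in>(\<Union>c\<in>C. \<Union>n\<in>W c. win n). 1 / real p)"
    using finS finB finC finW finwin
    by (intro order_trans[OF sum_Un_le_add] add_mono order_refl) auto
  also have "(\<Sum>p\<in>(\<Union>c\<in>C. \<Union>n\<in>W c. win n). 1 / real p) \<le> (\<Sum>c\<in>C. \<Sum>n\<in>W c. \<Sum>p\<in>win n. 1 / real p)"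
    using finC finW finwin
    by (intro order_trans[OF sum_UN_le_sum] sum_mono order_refl) auto
  also have "\<dots> \<le> (\<Sum>c\<in>C. \<Sum>n\<in>W c. 14 / (sqrt \<theta> * real n))"
    unfolding win_def
    by (intro sum_mono sum_prime_reciprocals_window_le \<theta> \<theta>s n0big) (use n0 in \<open>auto simp: W_def\<close>)
  also have "\<dots> = (\<Sum>c\<in>C. 14 / sqrt \<theta> * (\<Sum>n\<in>W c. 1 / real n))"
    by (simp add: sum_distrib_left)
  also have "\<dots> \<le> (\<Sum>c\<in>C. (1 + ln (real (N + R))) / (8 * real r))"
  proof (intro sum_mono)
    fix c
    have ln0: "0 \<le> 1 + ln (real (N + R))" using N(1) by (intro add_nonneg_nonneg ln_ge_zero) auto
    have s0: "0 < sqrt \<theta>" "sqrt \<theta> * sqrt \<theta> = \<theta>" using \<theta> by auto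
    have "(\<Sum>n\<in>W c. 1 / real n) \<le> 2 * (1 + ln (real (N + R))) / real I"
      using Wsum[of c] I0 by (simp add: le_divide_eq mult.commute)
    then have "14 / sqrt \<theta> * (\<Sum>n\<in>W c. 1 / real n) \<le> 14 / sqrt \<theta> * (2 * (1 + ln (real (N + R))) / real I)"
      using s0 by (intro mult_left_mono) auto
    also have "\<dots> = (1 + ln (real (N + R))) * (28 / (sqrt \<theta> * real I))"
      by simp
    also have "\<dots> \<le> (1 + ln (real (N + R))) * (1 / (8 * real r))"
    proof (intro mult_left_mono ln0)
      have "\<kappa> \<le> real I * (36 * (sqrt \<theta> * sqrt \<theta>))" using I_lb \<theta> s0 by (simp add: divide_le_eq)
      then have "sqrt \<theta> * (8064 * real r) \<le> sqrt \<theta> * (real I * (36 * sqrt \<theta>))"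
        using sq by (simp add: mult_ac)
      then have "8064 * real r \<le> real I * (36 * sqrt \<theta>)"
        using s0(1) by (rule mult_left_le_imp_le)
      then have "224 * real r \<le> real I * sqrt \<theta>" by simp
      then show "28 / (sqrt \<theta> * real I) \<le> 1 / (8 * real r)"
        using s0 I0 r by (simp add: field_simps)
    qed
    finally show "14 / sqrt \<theta> * (\<Sum>n\<in>W c. 1 / real n) \<le> (1 + ln (real (N + R))) / (8 * real r)"
      by simp
  qed
  also have "\<dots> = (1 + ln (real (N + R))) / 8"
    using r by (simp add: r_def)
  finally show False
    using N(2) bad by (simp add: C1_def B_def)
qed

text \<open>Apply \<open>avg_prime_dilates\<close> to a fixed finite set of primes with the colour
  of \<open>q\<close>: all dilates equal \<open>h\<close>, and slow variation of \<open>h\<close>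
  moves the scales \<open>y / p\<close> back to \<open>y\<close>. The dilate \<open>h\<close>
  inherits the colour hypothesis from \<open>g\<close>.\<close>

lemma avg_dilate_prime_class:
  fixes g :: "nat \<Rightarrow> real" and col :: "nat \<Rightarrow> 'c"
  assumes g: "\<And>n. \<bar>g n\<bar> \<le> 1" and fin: "finite (col ` {p. prime p})"
    and col: "\<And>p q m. prime p \<Longrightarrow> prime q \<Longrightarrow> col p = col q \<Longrightarrow> 1 \<le> m \<Longrightarrow> g (p * m) = g (q * m)"
    and q: "prime q"
    and div: "\<And>L. \<exists>B. finite B \<and> B \<subseteq> {p. prime p \<and> col p = col q} \<and> L \<le> (\<Sum>p\<in>B. 1 / real p)"
  shows "((\<lambda>y. avg g y - avg (\<lambda>n. g (q * n)) y) \<longlongrightarrow> 0) at_top"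
proof (unfold tendsto_iff, intro allI impI)
  fix e :: real assume e: "0 < e"
  define h where "h n = g (q * n)" for n
  obtain B where B: "finite B" "B \<subseteq> {p. prime p \<and> col p = col q}" and L: "2 / (e / 3)\<^sup>2 \<le> (\<Sum>p\<in>B. 1 / real p)"
    using div by blast
  let ?L = "\<Sum>p\<in>B. 1 / real p"
  have L0: "0 < ?L" using L e by (smt (verit) divide_pos_pos zero_less_power)
  have Bp: "prime p" "2 \<le> real p" if "p \<in> B" for p
    using B(2) that prime_ge_2_nat[of p] by auto
  have gp: "(\<lambda>n. g (p * n)) = h" if "p \<in> B" for p
  proof
    fix n show "g (p * n) = h n"
      using col[of p q n] that B(2) q by (cases "n = 0") (auto simp: h_def)
  qed
  have "\<forall>\<^sub>F y in at_top. \<bar>avg h y - avg h (y / real p)\<bar> < e / 3" if p: "p \<in> B" for p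
  proof -
    have "((\<lambda>y. avg h y - avg h (y * exp (- ln (real p)))) \<longlongrightarrow> 0) at_top"
    proof (rule avg_slowly_varying[OF _ fin])
      fix p p' m :: nat assume "prime p" "prime p'" "col p = col p'" "1 \<le> m"
      then have "g (p * (q * m)) = g (p' * (q * m))"
        using q by (intro col) (auto simp: Suc_le_eq prime_gt_0_nat)
      then show "h (p * m) = h (p' * m)" by (simp add: h_def mult_ac)
    qed (use g Bp[OF p] in \<open>auto simp: h_def\<close>)
    moreover have "y * exp (- ln (real p)) = y / real p" for y
      using Bp(2)[OF p] by (simp add: exp_minus field_simps)
    ultimately have "((\<lambda>y. avg h y - avg h (y / real p)) \<longlongrightarrow> 0) at_top" by simp
    from tendstoD[OF this, of "e / 3"] e show ?thesis by (simp add: dist_real_def)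
  qed
  then have "\<forall>\<^sub>F y in at_top. \<forall>p\<in>B. \<bar>avg h y - avg h (y / real p)\<bar> < e / 3"
    using B(1) by (simp add: eventually_ball_finite_distrib)
  moreover have "\<forall>\<^sub>F y in at_top. max 1 (2 * real (card B)) \<le> y"
    by (rule eventually_ge_at_top)
  ultimately show "\<forall>\<^sub>F y in at_top. dist (avg g y - avg (\<lambda>n. g (q * n)) y) 0 < e"
  proof eventually_elim
    case (elim y)
    have "\<bar>avg g y - (\<Sum>p\<in>B. 1 / real p / ?L * avg (\<lambda>n. g (p * n)) (y / real p))\<bar> \<le> e / 3"
      using elim(2) e by (intro avg_prime_dilates[OF B(1) _ g _ _ _ L]) (auto intro: Bp)
    moreover have "(\<Sum>p\<in>B. 1 / real p / ?L * avg (\<lambda>n. g (p * n)) (y / real p)) = (\<Sum>p\<in>B. 1 / real p / ?L * avg h (y / real p))"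
      using gp by (intro sum.cong) auto
    moreover have "\<bar>(\<Sum>p\<in>B. 1 / real p / ?L * avg h (y / real p)) - avg h y\<bar> \<le> e / 3"
    proof -
      have w: "(\<Sum>p\<in>B. 1 / real p / ?L) = 1"
        unfolding sum_divide_distrib[symmetric] using L0 by simp
      have "(\<Sum>p\<in>B. 1 / real p / ?L * avg h (y / real p)) - avg h y
          = (\<Sum>p\<in>B. 1 / real p / ?L * avg h (y / real p)) - (\<Sum>p\<in>B. 1 / real p / ?L) * avg h y"
        unfolding w by simp
      also have "\<dots> = (\<Sum>p\<in>B. 1 / real p / ?L * (avg h (y / real p) - avg h y))"
        unfolding sum_distrib_right sum_subtractf[symmetric] by (simp only: right_diff_distrib)
      also have "\<bar>\<dots>\<bar> \<le> (\<Sum>p\<in>B. \<bar>1 / real p / ?L * (avg h (y / real p) - avg h y)\<bar>)"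
        by (rule sum_abs)
      also have "\<dots> \<le> (\<Sum>p\<in>B. 1 / real p / ?L * (e / 3))"
      proof (rule sum_mono)
        fix p assume "p \<in> B"
        then have "\<bar>avg h (y / real p) - avg h y\<bar> \<le> e / 3"
          using elim(1) by (simp add: abs_minus_commute less_imp_le)
        moreover have w0: "0 \<le> 1 / real p / ?L" using L0 by simp
        ultimately show "\<bar>1 / real p / ?L * (avg h (y / real p) - avg h y)\<bar> \<le> 1 / real p / ?L * (e / 3)"
          unfolding abs_mult abs_of_nonneg[OF w0] by (rule mult_left_mono)
      qed
      also have "\<dots> = e / 3"
        unfolding sum_distrib_right[symmetric] w by simp
      finally show ?thesis .
    qed
    ultimately have "\<bar>avg g y - avg h y\<bar> < e" using e by linarith
    moreover have "h = (\<lambda>n. g (q * n))" by (simp add: h_def fun_eq_iff)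
    ultimately show ?case by (simp add: dist_real_def)
  qed
qed

section \<open>The Riesz representation theorem on a compact metric space\<close>

text \<open>The functional is total, but only its values on continuous functions are constrained; a
  limit functional extended arbitrarily to other functions therefore qualifies.\<close>

locale positive_functional =
  fixes \<Lambda> :: "('x::metric_space \<Rightarrow> real) \<Rightarrow> real"
  assumes compact: "compact (UNIV :: 'x set)"
    and add: "continuous_on UNIV f \<Longrightarrow> continuous_on UNIV g \<Longrightarrow> \<Lambda> (\<lambda>x. f x + g x) = \<Lambda> f + \<Lambda> g"
    and scale: "continuous_on UNIV f \<Longrightarrow> \<Lambda> (\<lambda>x. c * f x) = c * \<Lambda> f"
    and nonneg: "continuous_on UNIV f \<Longrightarrow> (\<And>x. 0 \<le> f x) \<Longrightarrow> 0 \<le> \<Lambda> f"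
    and one: "\<Lambda> (\<lambda>_. 1) = 1"
begin

lemma diff:
  assumes "continuous_on UNIV f" "continuous_on UNIV g"
  shows "\<Lambda> (\<lambda>x. f x - g x) = \<Lambda> f - \<Lambda> g"
  using add[of f "\<lambda>x. (-1) * g x"] scale[of g "-1"] assms by (simp add: continuous_on_minus)

lemma mono:
  assumes "continuous_on UNIV f" "continuous_on UNIV g" "\<And>x. f x \<le> g x"
  shows "\<Lambda> f \<le> \<Lambda> g"
  using nonneg[of "\<lambda>x. g x - f x"] diff[of g f] assms by (simp add: continuous_on_diff)

lemma const: "\<Lambda> (\<lambda>_. c) = c"
  using scale[of "\<lambda>_. 1" c] one by simp

lemma sum:
  assumes "finite I" "\<And>i. i \<in> I \<Longrightarrow> continuous_on UNIV (f i)"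
  shows "\<Lambda> (\<lambda>x. \<Sum>i\<in>I. f i x) = (\<Sum>i\<in>I. \<Lambda> (f i))"
  using assms
proof (induction I)
  case empty
  then show ?case using const[of 0] by simp
next
  case (insert i I)
  then have "\<Lambda> (\<lambda>x. f i x + (\<Sum>i\<in>I. f i x)) = \<Lambda> (f i) + \<Lambda> (\<lambda>x. \<Sum>i\<in>I. f i x)"
    by (intro add continuous_on_sum) auto
  then show ?case using insert by simp
qed

text \<open>Vanishing outside \<open>U\<close> replaces the usual compact support inside
  \<open>U\<close>; truncating at a small \<epsilon> makes up for the difference.\<close>

definition sub :: "'x set \<Rightarrow> ('x \<Rightarrow> real) set" where
  "sub U = {g. continuous_on UNIV g \<and> (\<forall>x. 0 \<le> g x \<and> g x \<le> 1) \<and> (\<forall>x. x \<notin> U \<longrightarrow> g x = 0)}"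

definition inner_vol :: "'x set \<Rightarrow> ennreal" where
  "inner_vol U = (SUP g\<in>sub U. ennreal (\<Lambda> g))"

definition outer_vol :: "'x set \<Rightarrow> ennreal" where
  "outer_vol E = (INF U\<in>{U. open U \<and> E \<subseteq> U}. inner_vol U)"

lemma subI:
  assumes "continuous_on UNIV g" "\<And>x. 0 \<le> g x" "\<And>x. g x \<le> 1" "\<And>x. x \<notin> U \<Longrightarrow> g x = 0"
  shows "g \<in> sub U"
  using assms by (auto simp: sub_def)

lemma zero_in_sub: "(\<lambda>_. 0) \<in> sub U"
  by (auto simp: sub_def)

lemma sub_le_inner_vol: "g \<in> sub U \<Longrightarrow> ennreal (\<Lambda> g) \<le> inner_vol U"
  unfolding inner_vol_def by (rule SUP_upper)

lemma inner_vol_mono: "U \<subseteq> V \<Longrightarrow> inner_vol U \<le> inner_vol V"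
  unfolding inner_vol_def by (rule SUP_subset_mono) (auto simp: sub_def)

lemma inner_vol_le_1: "inner_vol U \<le> 1"
  unfolding inner_vol_def
proof (rule SUP_least)
  fix g assume "g \<in> sub U"
  then have "\<Lambda> g \<le> \<Lambda> (\<lambda>_. 1)" by (intro mono) (auto simp: sub_def)
  then show "ennreal (\<Lambda> g) \<le> 1" using one by (simp add: ennreal_le_1)
qed

lemma outer_vol_le: "open U \<Longrightarrow> E \<subseteq> U \<Longrightarrow> outer_vol E \<le> inner_vol U"
  unfolding outer_vol_def by (rule INF_lower) auto

lemma outer_vol_open: "open U \<Longrightarrow> outer_vol U = inner_vol U"
  unfolding outer_vol_def
  by (intro antisym INF_lower INF_greatest) (auto intro: inner_vol_mono)

lemma outer_vol_mono: "E \<subseteq> F \<Longrightarrow> outer_vol E \<le> outer_vol F"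
  unfolding outer_vol_def by (rule INF_superset_mono) auto

lemma outer_vol_empty: "outer_vol {} = 0"
proof -
  have "inner_vol {} = 0"
    unfolding inner_vol_def
  proof (intro antisym SUP_least)
    fix g assume "g \<in> sub {}"
    then have "g = (\<lambda>_. 0)" by (auto simp: sub_def)
    then show "ennreal (\<Lambda> g) \<le> 0" using const[of 0] by simp
  qed simp
  then show ?thesis using outer_vol_open[of "{}"] by simp
qed

lemma outer_vol_UNIV: "outer_vol UNIV = 1"
proof -
  have "(\<lambda>_. 1) \<in> sub UNIV" by (auto simp: sub_def)
  then have "1 \<le> inner_vol UNIV" using sub_le_inner_vol[of "\<lambda>_. 1" UNIV] one by simp
  then show ?thesis using outer_vol_open[of UNIV] inner_vol_le_1[of UNIV] by simp
qed

lemma open_positivity_function: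
  fixes U :: "'x set"
  assumes "open U"
  obtains d :: "'x \<Rightarrow> real" where "continuous_on UNIV d" "\<And>x. 0 \<le> d x" "\<And>x. 0 < d x \<longleftrightarrow> x \<in> U"
\<comment> \<open>The distance to an empty set is 0 by convention, so the whole space needs its own
  function.\<close>
proof (cases "U = UNIV")
  case True
  then show ?thesis by (intro that[of "\<lambda>_. 1"]) auto
next
  case False
  have "infdist x (- U) = 0 \<longleftrightarrow> x \<notin> U" for x
    using in_closed_iff_infdist_zero[of "- U" x] assms False by auto
  then have "0 < infdist x (- U) \<longleftrightarrow> x \<in> U" for x
    using infdist_nonneg[of x "- U"] by (metis less_le)
  then show ?thesis
    by (intro that[of "\<lambda>x. infdist x (- U)"]) (auto intro: continuous_intros infdist_nonneg)
qed

text \<open>In place of a partition of unity, \<open>g\<close> is cut down to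
  \<open>min g (m * d n)\<close> on each \<open>U n\<close>. For growing \<open>m\<close> the sums
  of these pieces eventually exceed \<open>g - \<epsilon>\<close> at each point, and compactness
  gives one \<open>m\<close> for all points, as in Dini's theorem.\<close>

lemma inner_vol_UN_le:
  assumes U: "\<And>n::nat. open (U n)"
  shows "inner_vol (\<Union>n. U n) \<le> (\<Sum>n. inner_vol (U n))"
  unfolding inner_vol_def[of "\<Union>n. U n"]
proof (rule SUP_least)
  fix g assume g: "g \<in> sub (\<Union>n. U n)"
  then have gc: "continuous_on UNIV g" and g01: "\<And>x. 0 \<le> g x" "\<And>x. g x \<le> 1"
    by (auto simp: sub_def)
  have "\<forall>n. \<exists>d :: 'x \<Rightarrow> real. continuous_on UNIV d \<and> (\<forall>x. 0 \<le> d x) \<and> (\<forall>x. 0 < d x \<longleftrightarrow> x \<in> U n)"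
  proof
    fix n
    obtain e :: "'x \<Rightarrow> real" where "continuous_on UNIV e" "\<And>x. 0 \<le> e x" "\<And>x. 0 < e x \<longleftrightarrow> x \<in> U n"
      using open_positivity_function[OF U[of n]] by blast
    then show "\<exists>d :: 'x \<Rightarrow> real. continuous_on UNIV d \<and> (\<forall>x. 0 \<le> d x) \<and> (\<forall>x. 0 < d x \<longleftrightarrow> x \<in> U n)"
      by (intro exI[of _ e]) auto
  qed
  then obtain d :: "nat \<Rightarrow> 'x \<Rightarrow> real" where dc: "\<And>n. continuous_on UNIV (d n)" and d0: "\<And>n x. 0 \<le> d n x"
    and dU: "\<And>n x. 0 < d n x \<longleftrightarrow> x \<in> U n"
    by metis
  define h where "h m n x = min (g x) (real m * d n x)" for m n x
  have hc: "continuous_on UNIV (h m n)" for m n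
    unfolding h_def by (intro continuous_intros gc dc)
  have h0: "0 \<le> h m n x" for m n x using g01 d0 by (simp add: h_def)
  have hsub: "h m n \<in> sub (U n)" for m n
  proof (intro subI hc h0)
    fix x show "h m n x \<le> 1" using g01(2)[of x] by (simp add: h_def min.coboundedI1)
    show "h m n x = 0" if "x \<notin> U n"
    proof -
      have "d n x = 0" using dU[of n x] d0[of n x] that by linarith
      then show ?thesis using g01(1)[of x] by (simp add: h_def)
    qed
  qed
  show "ennreal (\<Lambda> g) \<le> (\<Sum>n. inner_vol (U n))"
  proof (rule ennreal_le_epsilon)
    fix \<epsilon> :: real assume \<epsilon>: "0 < \<epsilon>"
    define O' where "O' m = {x. g x < \<epsilon> + (\<Sum>n<m. h m n x)}" for m
    have O'_mono: "O' m \<subseteq> O' m'" if "m \<le> m'" for m m'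
    proof -
      have "(\<Sum>n<m. h m n x) \<le> (\<Sum>n<m'. h m' n x)" for x
      proof -
        have "(\<Sum>n<m. h m n x) \<le> (\<Sum>n<m. h m' n x)"
          unfolding h_def using that d0 by (intro sum_mono min.mono mult_right_mono) auto
        also have "\<dots> \<le> (\<Sum>n<m'. h m' n x)"
          using that h0 by (intro sum_mono2) auto
        finally show ?thesis .
      qed
      then show ?thesis unfolding O'_def by (smt (verit) Collect_mono)
    qed
    have "x \<in> (\<Union>m. O' m)" for x
    proof (cases "g x = 0")
      case True
      then have "x \<in> O' 0" using \<epsilon> by (simp add: O'_def)
      then show ?thesis by blast
    next
      case False
      then obtain n where n: "x \<in> U n" using g by (auto simp: sub_def)
      then have dn: "0 < d n x" using dU by blast
      then obtain m0 :: nat where m0: "g x < real m0 * d n x" using reals_Archimedean3 by blast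
      let ?m = "max m0 (Suc n)"
      have "real m0 * d n x \<le> real ?m * d n x" using dn by (intro mult_right_mono) auto
      then have "g x = h ?m n x" using m0 by (simp add: h_def)
      also have "\<dots> \<le> (\<Sum>n<?m. h ?m n x)" using h0 by (intro member_le_sum) auto
      finally have "x \<in> O' ?m" using \<epsilon> by (simp add: O'_def)
      then show ?thesis by blast
    qed
    then have cover: "UNIV \<subseteq> (\<Union>m\<in>UNIV. O' m)" by blast
    have O'_open: "open (O' m)" for m
      unfolding O'_def by (intro open_Collect_less continuous_intros gc hc)
    obtain M where M: "finite M" "UNIV \<subseteq> (\<Union>m\<in>M. O' m)"
      by (rule compactE_image[OF compact O'_open cover]) auto
    define m where "m = Max (insert 0 M)"
    have O'm: "UNIV \<subseteq> O' m"
    proof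
      fix x :: 'x
      obtain m' where "m' \<in> M" "x \<in> O' m'" using M(2) by blast
      moreover have "m' \<le> m" using M(1) \<open>m' \<in> M\<close> by (simp add: m_def)
      ultimately show "x \<in> O' m" using O'_mono by blast
    qed
    have le: "g x \<le> \<epsilon> + (\<Sum>n<m. h m n x)" for x
      using subsetD[OF O'm, of x] by (simp add: O'_def less_imp_le)
    have "\<Lambda> g \<le> \<Lambda> (\<lambda>x. \<epsilon> + (\<Sum>n<m. h m n x))"
      by (intro mono le gc continuous_intros hc)
    also have "\<dots> = \<epsilon> + (\<Sum>n<m. \<Lambda> (h m n))"
      using add[of "\<lambda>_. \<epsilon>" "\<lambda>x. \<Sum>n<m. h m n x"] const sum[of "{..<m}" "h m"] hc
      by (simp add: continuous_on_sum)
    finally have "ennreal (\<Lambda> g) \<le> ennreal (\<epsilon> + (\<Sum>n<m. \<Lambda> (h m n)))"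
      by (rule ennreal_leI)
    also have "\<dots> = ennreal \<epsilon> + ennreal (\<Sum>n<m. \<Lambda> (h m n))"
      using \<epsilon> nonneg[OF hc h0] by (intro ennreal_plus sum_nonneg) auto
    also have "ennreal (\<Sum>n<m. \<Lambda> (h m n)) = (\<Sum>n<m. ennreal (\<Lambda> (h m n)))"
      using nonneg[OF hc h0] by (intro sum_ennreal[symmetric]) auto
    also have "(\<Sum>n<m. ennreal (\<Lambda> (h m n))) \<le> (\<Sum>n<m. inner_vol (U n))"
      by (intro sum_mono sub_le_inner_vol hsub)
    also have "\<dots> \<le> (\<Sum>n. inner_vol (U n))"
      by (intro sum_le_suminf) auto
    finally show "ennreal (\<Lambda> g) \<le> (\<Sum>n. inner_vol (U n)) + ennreal \<epsilon>"
      by (simp add: add.commute)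
  qed
qed

section \<open>From the functional to a Borel measure by Caratheodory's method\<close>

lemma outer_vol_outer_measure: "outer_measure_space (Pow UNIV) outer_vol"
  unfolding outer_measure_space_def
proof (intro conjI)
  show "positive (Pow UNIV) outer_vol"
    by (simp add: positive_def outer_vol_empty)
  show "increasing (Pow UNIV) outer_vol"
    by (simp add: increasing_def outer_vol_mono)
  show "countably_subadditive (Pow UNIV) outer_vol"
    unfolding countably_subadditive_def
  proof safe
    fix A :: "nat \<Rightarrow> 'x set"
    show "outer_vol (\<Union>i. A i) \<le> (\<Sum>i. outer_vol (A i))"
    proof (rule ennreal_le_epsilon)
      fix e :: real assume e: "0 < e"
      have "\<exists>U. open U \<and> A n \<subseteq> U \<and> inner_vol U \<le> outer_vol (A n) + ennreal (e * (1/2) ^ Suc n)" for n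
      proof -
        \<comment> \<open>Finiteness is needed: adding a positive amount is a strict increase in
          \<open>ennreal\<close> only below infinity.\<close>
        have "outer_vol (A n) \<le> 1"
          using outer_vol_mono[of "A n" UNIV] outer_vol_UNIV by simp
        then have "outer_vol (A n) < \<infinity>"
          by (rule order_le_less_trans) simp
        then have "outer_vol (A n) < outer_vol (A n) + ennreal (e * (1/2) ^ Suc n)"
          using e by (simp add: ennreal_add_left_cancel_less)
        then show ?thesis
          unfolding outer_vol_def[of "A n"] INF_less_iff by (auto intro: less_imp_le)
      qed
      then obtain U where U: "\<And>n. open (U n)" "\<And>n. A n \<subseteq> U n"
        "\<And>n. inner_vol (U n) \<le> outer_vol (A n) + ennreal (e * (1/2) ^ Suc n)"
        by metis
      have "outer_vol (\<Union>i. A i) \<le> inner_vol (\<Union>i. U i)"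
        using U by (intro outer_vol_le open_UN) auto
      also have "\<dots> \<le> (\<Sum>i. inner_vol (U i))"
        using U by (intro inner_vol_UN_le)
      also have "\<dots> \<le> (\<Sum>i. outer_vol (A i) + ennreal (e * (1/2) ^ Suc i))"
        using U by (intro suminf_le) auto
      also have "\<dots> = (\<Sum>i. outer_vol (A i)) + (\<Sum>i. ennreal (e * (1/2) ^ Suc i))"
        by (rule suminf_add[symmetric]) auto
      also have "(\<Sum>i. ennreal (e * (1/2) ^ Suc i)) = ennreal e"
        using e sums_mult[OF power_half_series, of e] by (intro suminf_ennreal_eq) auto
      finally show "outer_vol (\<Union>i. A i) \<le> (\<Sum>i. outer_vol (A i)) + ennreal e" .
    qed
  qed
qed

lemma outer_vol_Un_le: "outer_vol (A \<union> B) \<le> outer_vol A + outer_vol B"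
proof -
  have "outer_vol (A \<union> (B - A)) \<le> outer_vol A + outer_vol (B - A)"
    by (rule subadditiveD[OF ring_of_sets.countably_subadditive_subadditive[OF ring_of_sets_Pow[of UNIV]]])
       (use outer_vol_outer_measure in \<open>auto simp: outer_measure_space_def\<close>)
  also have "\<dots> \<le> outer_vol A + outer_vol B"
    by (intro add_left_mono outer_vol_mono) auto
  finally show ?thesis by simp
qed

text \<open>Given \<open>g\<close> living on \<open>U \<inter> V\<close>, the set where
  \<open>g\<close> is below \<epsilon> is an open neighbourhood of \<open>E - U\<close>. A function
  \<open>h\<close> on that part of \<open>V\<close> and the truncation of \<open>g\<close> at height
  \<epsilon> are never positive together, so their sum is still at most 1; the truncation costs only
  \<epsilon>.\<close>

lemma outer_vol_split_open:
  assumes U: "open U"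
  shows "outer_vol (E \<inter> U) + outer_vol (E - U) \<le> outer_vol E"
  unfolding outer_vol_def[of E]
proof (rule INF_greatest)
  fix V assume "V \<in> {V. open V \<and> E \<subseteq> V}"
  then have V: "open V" "E \<subseteq> V" by auto
  have main: "ennreal (\<Lambda> g) + outer_vol (E - U) \<le> inner_vol V" if g: "g \<in> sub (U \<inter> V)" for g
  proof (rule ennreal_le_epsilon)
    fix \<epsilon> :: real assume \<epsilon>: "0 < \<epsilon>"
    have gc: "continuous_on UNIV g" and g01: "\<And>x. 0 \<le> g x" "\<And>x. g x \<le> 1" and gU: "\<And>x. x \<notin> U \<inter> V \<Longrightarrow> g x = 0"
      using g by (auto simp: sub_def)
    define k where "k x = max (g x - \<epsilon>) 0" for x
    have kc: "continuous_on UNIV k" unfolding k_def by (intro continuous_intros gc)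
    define W where "W = V \<inter> {x. g x < \<epsilon>}"
    have W: "open W" unfolding W_def by (intro open_Int V open_Collect_less continuous_intros gc)
    have "E - U \<subseteq> W" using V gU \<epsilon> by (auto simp: W_def)
    then have "outer_vol (E - U) \<le> inner_vol W" by (rule outer_vol_le[OF W])
    then have "ennreal (\<Lambda> g) + outer_vol (E - U) \<le> ennreal (\<Lambda> g) + inner_vol W"
      by (rule add_left_mono)
    also have "\<dots> = (SUP h\<in>sub W. ennreal (\<Lambda> g) + ennreal (\<Lambda> h))"
      unfolding inner_vol_def using zero_in_sub by (subst ennreal_SUP_add_right) auto
    also have "\<dots> \<le> inner_vol V + ennreal \<epsilon>"
    proof (rule SUP_least)
      fix h assume h: "h \<in> sub W"
      then have hc: "continuous_on UNIV h" and h01: "\<And>x. 0 \<le> h x" "\<And>x. h x \<le> 1" and hW: "\<And>x. x \<notin> W \<Longrightarrow> h x = 0"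
        by (auto simp: sub_def)
      have kh: "(\<lambda>x. k x + h x) \<in> sub V"
      proof (intro subI continuous_intros kc hc)
        fix x
        show "0 \<le> k x + h x" using h01 by (simp add: k_def)
        show "k x + h x \<le> 1"
        proof (cases "x \<in> W")
          case True
          then have "k x = 0" by (simp add: W_def k_def)
          then show ?thesis using h01 by simp
        next
          case False
          then show ?thesis using hW[of x] g01(2)[of x] \<epsilon> by (simp add: k_def)
        qed
        show "k x + h x = 0" if "x \<notin> V"
          using that gU[of x] hW[of x] \<epsilon> by (simp add: k_def W_def)
      qed
      have "\<Lambda> g + \<Lambda> h = \<Lambda> (\<lambda>x. g x + h x)"
        using add[OF gc hc] by simp
      also have "\<dots> \<le> \<Lambda> (\<lambda>x. (k x + h x) + \<epsilon>)"
        by (intro mono continuous_intros gc hc kc) (simp add: k_def)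
      also have "\<dots> = \<Lambda> (\<lambda>x. k x + h x) + \<epsilon>"
        using add[of "\<lambda>x. k x + h x" "\<lambda>_. \<epsilon>"] const kc hc by (simp add: continuous_on_add)
      finally have "ennreal (\<Lambda> g) + ennreal (\<Lambda> h) \<le> ennreal (\<Lambda> (\<lambda>x. k x + h x) + \<epsilon>)"
        using nonneg[OF gc g01(1)] nonneg[OF hc h01(1)] by (simp add: ennreal_leI flip: ennreal_plus)
      also have "\<dots> = ennreal (\<Lambda> (\<lambda>x. k x + h x)) + ennreal \<epsilon>"
        using \<epsilon> kh nonneg by (intro ennreal_plus) (auto simp: sub_def)
      also have "\<dots> \<le> inner_vol V + ennreal \<epsilon>"
        by (intro add_right_mono sub_le_inner_vol kh)
      finally show "ennreal (\<Lambda> g) + ennreal (\<Lambda> h) \<le> inner_vol V + ennreal \<epsilon>" .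
    qed
    finally show "ennreal (\<Lambda> g) + outer_vol (E - U) \<le> inner_vol V + ennreal \<epsilon>" .
  qed
  have "outer_vol (E \<inter> U) + outer_vol (E - U) \<le> inner_vol (U \<inter> V) + outer_vol (E - U)"
    using U V by (intro add_right_mono outer_vol_le) auto
  also have "\<dots> = (SUP g\<in>sub (U \<inter> V). ennreal (\<Lambda> g) + outer_vol (E - U))"
    unfolding inner_vol_def using zero_in_sub by (subst ennreal_SUP_add_left) auto
  also have "\<dots> \<le> inner_vol V"
    using main by (intro SUP_least)
  finally show "outer_vol (E \<inter> U) + outer_vol (E - U) \<le> inner_vol V" .
qed

definition riesz_measure :: "'x measure" where
  "riesz_measure = measure_of UNIV (sets borel) outer_vol"

lemma sets_riesz_measure: "sets riesz_measure = sets borel"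
  using sets.sigma_sets_eq[of "borel :: 'x measure"] by (simp add: riesz_measure_def sets_measure_of_conv)

text \<open>Caratheodory's lemma makes \<open>outer_vol\<close> a measure on its measurable sets;
  these form a sigma-algebra that contains the open sets by \<open>outer_vol_split_open\<close>,
  hence all Borel sets.\<close>

lemma emeasure_riesz_measure:
  assumes "A \<in> sets borel"
  shows "emeasure riesz_measure A = outer_vol A"
proof -
  let ?L = "lambda_system UNIV (Pow UNIV) outer_vol"
  have ms: "measure_space UNIV ?L outer_vol"
    using sigma_algebra.caratheodory_lemma[OF sigma_algebra_Pow outer_vol_outer_measure] .
  then interpret L: sigma_algebra UNIV ?L by (simp add: measure_space_def)
  have "U \<in> ?L" if "open U" for U
    unfolding algebra.lambda_system_eq[OF algebra_Pow]
  proof safe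
    fix E :: "'x set"
    have "outer_vol E \<le> outer_vol (E \<inter> U) + outer_vol (E - U)"
      using outer_vol_Un_le[of "E \<inter> U" "E - U"] by (simp add: Int_Diff_Un)
    then show "outer_vol (E \<inter> U) + outer_vol (E - U) = outer_vol E"
      using outer_vol_split_open[OF that, of E] by (rule antisym[rotated])
  qed auto
  then have "sigma_sets UNIV (Collect open) \<subseteq> ?L"
    by (intro L.sigma_sets_subset subsetI) blast
  then have sub: "sets borel \<subseteq> ?L"
    unfolding borel_def by (subst sets_measure_of) auto
  have "positive (sets borel) outer_vol" by (simp add: positive_def outer_vol_empty)
  moreover have "countably_additive (sets borel) outer_vol"
  proof (rule countably_additiveI)
    fix A :: "nat \<Rightarrow> 'x set"
    assume A: "range A \<subseteq> sets borel" "disjoint_family A" "(\<Union>i. A i) \<in> sets borel"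
    then have "range A \<subseteq> ?L" "(\<Union>i. A i) \<in> ?L" using sub by blast+
    moreover have "countably_additive ?L outer_vol" using ms unfolding measure_space_def by blast
    ultimately show "(\<Sum>i. outer_vol (A i)) = outer_vol (\<Union>i. A i)"
      using A(2) unfolding countably_additive_def by blast
  qed
  moreover have "sigma_algebra UNIV (sets (borel :: 'x measure))"
    using sets.sigma_algebra_axioms[of "borel :: 'x measure"] by simp
  ultimately show ?thesis
    unfolding riesz_measure_def using assms by (intro emeasure_measure_of_sigma)
qed

lemma borel_prob_riesz_measure: "borel_prob riesz_measure"
  unfolding borel_prob_def
proof
  have "space riesz_measure = UNIV" by (simp add: riesz_measure_def space_measure_of_conv)
  then show "prob_space riesz_measure"
    by (intro prob_spaceI) (simp add: emeasure_riesz_measure outer_vol_UNIV)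
qed (rule sets_riesz_measure)

section \<open>Integration by horizontal slices\<close>

lemma sum_clamp:
  fixes t c :: real
  assumes "0 \<le> c" "0 \<le> t"
  shows "(\<Sum>i<N. max 0 (min (t - real i * c) c)) = min t (real N * c)"
proof (induction N)
  case (Suc N)
  then show ?case using assms by (simp add: algebra_simps min_def max_def)
qed (use assms in simp)

lemma sum_indicator_le:
  fixes t c :: real
  assumes "0 \<le> c" "0 \<le> t"
  shows "(\<Sum>i<N. c * of_bool (real i * c < t)) \<le> t + c"
proof -
  \<comment> \<open>The bound \<open>N * c\<close> is added to make the induction go through: a new
    term is counted only while \<open>N * c < t\<close>.\<close>
  have "(\<Sum>i<N. c * of_bool (real i * c < t)) \<le> min (real N * c) (t + c)"
  proof (induction N)
    case (Suc N)
    then show ?case using assms by (cases "real N * c < t") (auto simp: algebra_simps)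
  qed (use assms in simp)
  then show ?thesis by simp
qed

text \<open>Slice \<open>g\<close> into layers of thickness \<open>c\<close>. A layer divided by
  \<open>c\<close> is subordinate to the open set where \<open>g\<close> exceeds its lower edge, so
  the functional is bounded by \<open>c\<close> times the measures of these sets, which sum to at
  most the integral of \<open>g + c\<close>.\<close>

lemma le_integral:
  assumes gc: "continuous_on UNIV g" and g01: "\<And>x. 0 \<le> g x" "\<And>x. g x \<le> 1"
  shows "\<Lambda> g \<le> (\<integral>x. g x \<partial>riesz_measure)"
proof -
  interpret prob_space riesz_measure
    using borel_prob_riesz_measure by (simp add: borel_prob_def)
  have meas: "f \<in> borel_measurable riesz_measure" if "f \<in> borel_measurable borel" for f :: "'x \<Rightarrow> real"
    using that measurable_cong_sets[OF sets_riesz_measure refl] by blast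
  have gm: "g \<in> borel_measurable borel" using gc by (rule borel_measurable_continuous_onI)
  have gi: "integrable riesz_measure g"
    using g01 by (intro integrable_const_bound[of _ 1] meas gm) auto
  have bound: "\<Lambda> g \<le> (\<integral>x. g x \<partial>riesz_measure) + 1 / real n" if n: "n \<ge> 1" for n :: nat
  proof -
    define c where "c = 1 / real n"
    have c: "0 < c" "real n * c = 1" using n by (auto simp: c_def)
    define h where "h i x = max 0 (min (g x - real i * c) c)" for i x
    define U where "U i = {x. real i * c < g x}" for i
    have hc: "continuous_on UNIV (h i)" for i unfolding h_def by (intro continuous_intros gc)
    have U: "open (U i)" for i unfolding U_def by (intro open_Collect_less continuous_intros gc)
    have int_ind: "integrable riesz_measure (\<lambda>x. c * indicat_real (U i) x)" for i
      using U by (intro integrable_mult_right integrable_real_indicator) (auto simp: sets_riesz_measure emeasure_eq_measure)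
    have "g = (\<lambda>x. \<Sum>i<n. h i x)"
      using sum_clamp[of c "g _" n] c g01 by (auto simp: h_def)
    then have "\<Lambda> g = (\<Sum>i<n. \<Lambda> (h i))" using sum[of "{..<n}" h] hc by simp
    also have "\<dots> \<le> (\<Sum>i<n. c * measure riesz_measure (U i))"
    proof (intro sum_mono)
      fix i
      have "(\<lambda>x. real n * h i x) \<in> sub (U i)"
      proof (intro subI continuous_intros hc)
        fix x
        show "0 \<le> real n * h i x" by (simp add: h_def)
        have "real n * h i x \<le> real n * c" using c by (intro mult_left_mono) (auto simp: h_def)
        then show "real n * h i x \<le> 1" using c by simp
        show "real n * h i x = 0" if "x \<notin> U i" using that by (simp add: U_def h_def)
      qed
      then have "ennreal (\<Lambda> (\<lambda>x. real n * h i x)) \<le> emeasure riesz_measure (U i)"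
        using sub_le_inner_vol U by (simp add: emeasure_riesz_measure outer_vol_open)
      then have "ennreal (real n * \<Lambda> (h i)) \<le> ennreal (measure riesz_measure (U i))"
        using scale[OF hc] by (simp add: emeasure_eq_measure)
      then have "real n * \<Lambda> (h i) \<le> measure riesz_measure (U i)"
        by (simp add: ennreal_le_iff)
      then have "c * (real n * \<Lambda> (h i)) \<le> c * measure riesz_measure (U i)"
        using c by (intro mult_left_mono) auto
      then show "\<Lambda> (h i) \<le> c * measure riesz_measure (U i)"
        using c(2) by (metis mult.assoc mult.commute mult_1)
    qed
    also have "\<dots> = (\<integral>x. (\<Sum>i<n. c * indicat_real (U i) x) \<partial>riesz_measure)"
      using U by (subst Bochner_Integration.integral_sum[OF int_ind]) (simp add: sets_riesz_measure)
    also have "\<dots> \<le> (\<integral>x. g x + c \<partial>riesz_measure)"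
    proof (rule integral_mono)
      show "integrable riesz_measure (\<lambda>x. \<Sum>i<n. c * indicat_real (U i) x)"
        by (intro Bochner_Integration.integrable_sum int_ind)
      show "(\<Sum>i<n. c * indicat_real (U i) x) \<le> g x + c" for x
        using sum_indicator_le[of c "g x" n] c g01(1)[of x] by (simp add: indicator_def U_def of_bool_def)
    qed (use gi in auto)
    also have "\<dots> = (\<integral>x. g x \<partial>riesz_measure) + c"
      using gi by (simp add: prob_space)
    finally show ?thesis by (simp add: c_def)
  qed
  show ?thesis
  proof (rule field_le_epsilon)
    fix e :: real assume "0 < e"
    then obtain n :: nat where "n \<ge> 1" "1 / real n < e"
      by (metis One_nat_def Suc_leI inverse_eq_divide reals_Archimedean zero_less_Suc)
    then show "\<Lambda> g \<le> (\<integral>x. g x \<partial>riesz_measure) + e" using bound[of n] by simp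
  qed
qed

text \<open>For values in the unit interval, the inequality for \<open>1 - g\<close> is the reverse
  of the one for \<open>g\<close>. The general case follows by an affine change of
  \<open>g\<close>.\<close>

lemma integral_riesz_measure:
  assumes gc: "continuous_on UNIV g"
  shows "(\<integral>x. g x \<partial>riesz_measure) = \<Lambda> g"
proof -
  interpret prob_space riesz_measure
    using borel_prob_riesz_measure by (simp add: borel_prob_def)
  have int: "integrable riesz_measure f" if f: "continuous_on UNIV f" for f :: "'x \<Rightarrow> real"
  proof -
    have "bounded (f ` UNIV)" using compact f by (intro compact_imp_bounded compact_continuous_image)
    then obtain b where "\<And>x. norm (f x) \<le> b" by (auto simp: bounded_iff)
    moreover have "f \<in> borel_measurable riesz_measure"
      using borel_measurable_continuous_onI[OF f] measurable_cong_sets[OF sets_riesz_measure refl] by blast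
    ultimately show ?thesis by (intro integrable_const_bound[of _ b]) auto
  qed
  have eq: "(\<integral>x. f x \<partial>riesz_measure) = \<Lambda> f"
    if f: "continuous_on UNIV f" "\<And>x. 0 \<le> f x" "\<And>x. f x \<le> 1" for f
  proof (rule antisym)
    show "\<Lambda> f \<le> (\<integral>x. f x \<partial>riesz_measure)" using f by (rule le_integral)
    have "\<Lambda> (\<lambda>x. 1 - f x) \<le> (\<integral>x. 1 - f x \<partial>riesz_measure)"
      using f by (intro le_integral continuous_intros) auto
    then show "(\<integral>x. f x \<partial>riesz_measure) \<le> \<Lambda> f"
      using int[OF f(1)] diff[of "\<lambda>_. 1" f] f(1) one by (simp add: prob_space)
  qed
  have "bounded (g ` UNIV)" using compact gc by (intro compact_imp_bounded compact_continuous_image)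
  then obtain b0 where b0: "\<And>x. \<bar>g x\<bar> \<le> b0" by (auto simp: bounded_iff)
  define b where "b = max b0 1"
  have b: "0 < b" "\<And>x. \<bar>g x\<bar> \<le> b" using b0 by (auto simp: b_def intro: max.coboundedI1)
  define f where "f x = (1 / (2 * b)) * (g x + b)" for x
  have fc: "continuous_on UNIV f" unfolding f_def by (intro continuous_intros gc)
  have "0 \<le> f x" "f x \<le> 1" for x using b(2)[of x] b(1) by (auto simp: f_def field_simps abs_le_iff)
  then have "(\<integral>x. f x \<partial>riesz_measure) = \<Lambda> f" using fc by (intro eq)
  moreover have "\<Lambda> f = (1 / (2 * b)) * (\<Lambda> g + b)"
    unfolding f_def using scale[of "\<lambda>x. g x + b" "1 / (2 * b)"] add[OF gc, of "\<lambda>_. b"] const gc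
    by (simp add: continuous_on_add)
  moreover have "(\<integral>x. f x \<partial>riesz_measure) = (1 / (2 * b)) * ((\<integral>x. g x \<partial>riesz_measure) + b)"
    unfolding f_def using int[OF gc] by (simp add: prob_space)
  ultimately show ?thesis using b(1) by simp
qed

end

text \<open>Indicators of closed sets are limits of the continuous functions
  \<open>max 0 (1 - n * infdist x C)\<close>, and closed sets form an intersection-stable
  generator.\<close>

lemma borel_prob_eqI:
  fixes M N :: "'x::metric_space measure"
  assumes M: "borel_prob M" and N: "borel_prob N"
    and eq: "\<And>g :: 'x \<Rightarrow> real. continuous_on UNIV g \<Longrightarrow> (\<integral>x. g x \<partial>M) = (\<integral>x. g x \<partial>N)"
  shows "M = N"
proof -
  have lim: "(\<lambda>n. \<integral>x. max 0 (1 - real n * infdist x C) \<partial>K) \<longlonglongrightarrow> measure K C"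
    if K: "borel_prob K" and C: "closed C" "C \<noteq> {}" for K :: "'x measure" and C
  proof -
    interpret prob_space K using K by (simp add: borel_prob_def)
    have sK: "sets K = sets borel" using K by (simp add: borel_prob_def)
    have "(\<lambda>n. \<integral>x. max 0 (1 - real n * infdist x C) \<partial>K) \<longlonglongrightarrow> (\<integral>x. indicator C x \<partial>K)"
    proof (rule integral_dominated_convergence[where w = "\<lambda>_. 1"])
      show "AE x in K. (\<lambda>n. max 0 (1 - real n * infdist x C)) \<longlonglongrightarrow> indicator C x"
      proof (rule AE_I2)
        fix x
        show "(\<lambda>n. max 0 (1 - real n * infdist x C)) \<longlonglongrightarrow> indicator C x"
        proof (cases "x \<in> C")
          case True
          then show ?thesis by simp
        next
          case False
          then have "0 < infdist x C"
            using in_closed_iff_infdist_zero[OF C] infdist_nonneg[of x C] by (metis less_le)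
          then obtain m :: nat where m: "1 < real m * infdist x C" using reals_Archimedean3 by blast
          have "\<forall>\<^sub>F n in sequentially. max 0 (1 - real n * infdist x C) = 0"
            using eventually_ge_at_top[of m]
          proof eventually_elim
            case (elim n)
            then have "real m * infdist x C \<le> real n * infdist x C"
              by (intro mult_right_mono infdist_nonneg) auto
            then show ?case using m by simp
          qed
          then show ?thesis using False by (simp add: tendsto_eventually)
        qed
      qed
      show "AE x in K. norm (max 0 (1 - real n * infdist x C)) \<le> 1" for n
        by (auto intro!: AE_I2 simp: infdist_nonneg)
      show "(\<lambda>x. max 0 (1 - real n * infdist x C)) \<in> borel_measurable K" for n
        unfolding measurable_cong_sets[OF sK refl]
        by (intro borel_measurable_continuous_onI continuous_intros)
      show "indicat_real C \<in> borel_measurable K"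
        using C sK by (intro borel_measurable_indicator) auto
    qed simp
    then show ?thesis by (simp add: sK C)
  qed
  have same: "emeasure M C = emeasure N C" if "closed C" for C
  \<comment> \<open>For empty \<open>C\<close> the convention \<open>infdist x {} = 0\<close> would
    make these functions constantly 1.\<close>
  proof (cases "C = {}")
    case False
    interpret M: prob_space M using M by (simp add: borel_prob_def)
    interpret N: prob_space N using N by (simp add: borel_prob_def)
    have "(\<integral>x. max 0 (1 - real n * infdist x C) \<partial>M) = (\<integral>x. max 0 (1 - real n * infdist x C) \<partial>N)" for n
      by (intro eq continuous_intros)
    then have "measure M C = measure N C"
      using lim[OF M that False] lim[OF N that False] LIMSEQ_unique by auto
    then show ?thesis by (simp add: M.emeasure_eq_measure N.emeasure_eq_measure)
  qed simp
  show ?thesis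
  proof (rule measure_eqI_generator_eq[where E = "{C. closed C}" and A = "\<lambda>_. UNIV" and \<Omega> = UNIV])
    show "Int_stable {C :: 'x set. closed C}" by (auto simp: Int_stable_def)
    show "sets M = sigma_sets UNIV {C. closed C}" "sets N = sigma_sets UNIV {C. closed C}"
      using M N by (simp_all add: borel_prob_def borel_eq_closed)
    show "emeasure M UNIV \<noteq> \<infinity>"
      using M by (metis borel_prob_def finite_measure.emeasure_finite infinity_ennreal_def prob_space_def)
  qed (use same in auto)
qed

section \<open>Integer vectors and commuting iterates\<close>

text \<open>Gaussian elimination without division: a pivot vector \<open>b0\<close> clears
  coordinate \<open>i\<close> from the others by cross-multiplication, and induction handles the
  remaining coordinates.\<close>

lemma int_linear_dependence:
  fixes f :: "'b \<Rightarrow> 'i \<Rightarrow> int"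
  assumes "finite I" "finite B" "card I < card B"
  shows "\<exists>c. (\<exists>b\<in>B. c b \<noteq> 0) \<and> (\<forall>i\<in>I. (\<Sum>b\<in>B. c b * f b i) = 0)"
  using assms
proof (induction I arbitrary: B f)
  case empty
  then have "B \<noteq> {}" by auto
  then show ?case by (intro exI[of _ "\<lambda>_. 1"]) auto
next
  case (insert i I)
  show ?case
  proof (cases "\<forall>b\<in>B. f b i = 0")
    case True
    obtain c where "\<exists>b\<in>B. c b \<noteq> 0" "\<forall>i\<in>I. (\<Sum>b\<in>B. c b * f b i) = 0"
      using insert.IH[of B f] insert.prems insert.hyps by auto
    then show ?thesis using True by (intro exI[of _ c]) auto
  next
    case False
    then obtain b0 where b0: "b0 \<in> B" "f b0 i \<noteq> 0" by blast
    define B' where "B' = B - {b0}"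
    have B': "finite B'" "card I < card B'"
      using insert.prems insert.hyps b0 by (auto simp: B'_def)
    obtain c where c: "\<exists>b\<in>B'. c b \<noteq> 0"
      "\<And>j. j \<in> I \<Longrightarrow> (\<Sum>b\<in>B'. c b * (f b0 i * f b j - f b i * f b0 j)) = 0"
      using insert.IH[OF B', of "\<lambda>b j. f b0 i * f b j - f b i * f b0 j"] by blast
    \<comment> \<open>Scaling by the nonzero pivot keeps a coefficient nonzero, and the value at
      \<open>b0\<close> collects what the elimination subtracted.\<close>
    define d where "d b = (if b = b0 then - (\<Sum>b\<in>B'. c b * f b i) else c b * f b0 i)" for b
    have d: "(\<Sum>b\<in>B. d b * f b j) = (\<Sum>b\<in>B'. c b * (f b0 i * f b j - f b i * f b0 j))" for j
    proof -
      have "(\<Sum>b\<in>B. d b * f b j) = d b0 * f b0 j + (\<Sum>b\<in>B'. d b * f b j)"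
        using b0 insert.prems by (simp add: B'_def sum.remove)
      also have "(\<Sum>b\<in>B'. d b * f b j) = (\<Sum>b\<in>B'. c b * f b0 i * f b j)"
        by (intro sum.cong) (auto simp: d_def B'_def)
      also have "d b0 * f b0 j = - (\<Sum>b\<in>B'. c b * f b i * f b0 j)"
        by (simp add: d_def sum_distrib_right)
      finally show ?thesis by (simp add: right_diff_distrib sum_subtractf mult_ac)
    qed
    have "(\<Sum>b\<in>B. d b * f b i) = 0" unfolding d by (simp add: mult.commute)
    moreover have "\<exists>b\<in>B. d b \<noteq> 0" using c(1) b0 by (auto simp: d_def B'_def)
    ultimately show ?thesis using c(2) by (intro exI[of _ d]) (auto simp: d)
  qed
qed

section \<open>The group of integer vectors and its subgroups of full rank\<close>

lemma comm_group_int_vec_group: "comm_group (int_vec_group k)"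
proof -
  have "group (int_vec_group k)" by (simp add: int_vec_group_def)
  then show ?thesis
    by (rule group.group_comm_groupI) (auto simp: int_vec_group_def add.commute)
qed

lemma carrier_int_vec_group: "carrier (int_vec_group k) = extensional {1..k}"
  by (simp add: int_vec_group_def PiE_def)

lemma one_int_vec_group: "\<one>\<^bsub>int_vec_group k\<^esub> = (\<lambda>j\<in>{1..k}. 0)"
  by (simp add: int_vec_group_def)

lemma mult_int_vec_group: "x \<otimes>\<^bsub>int_vec_group k\<^esub> y = (\<lambda>j\<in>{1..k}. x j + y j)"
  by (simp add: int_vec_group_def)

lemma inv_int_vec_group:
  "x \<in> carrier (int_vec_group k) \<Longrightarrow> inv\<^bsub>int_vec_group k\<^esub> x = (\<lambda>j\<in>{1..k}. - x j)"
  by (simp add: int_vec_group_def)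

lemma int_pow_int_vec_group:
  assumes "b \<in> carrier (int_vec_group k)"
  shows "b [^]\<^bsub>int_vec_group k\<^esub> (n::int) = (\<lambda>j\<in>{1..k}. n * b j)"
proof -
  interpret comm_group "int_vec_group k" by (rule comm_group_int_vec_group)
  have nat: "b [^]\<^bsub>int_vec_group k\<^esub> (n::nat) = (\<lambda>j\<in>{1..k}. int n * b j)" for n
  proof (induction n)
    case 0
    show ?case by (simp add: one_int_vec_group)
  next
    case (Suc n)
    then show ?case
      by (simp add: mult_int_vec_group algebra_simps cong: restrict_cong)
  qed
  have pow_closed: "(\<lambda>j\<in>{1..k}. z * b j) \<in> carrier (int_vec_group k)" for z
    by (simp add: carrier_int_vec_group)
  show ?thesis
  proof (cases "n \<ge> 0")
    case True
    then show ?thesis using nat[of "nat n"] int_pow_int[of "int_vec_group k" b "nat n"] by simp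
  next
    case False
    then have "b [^]\<^bsub>int_vec_group k\<^esub> n = inv\<^bsub>int_vec_group k\<^esub> (\<lambda>j\<in>{1..k}. int (nat (- n)) * b j)"
      using nat[of "nat (- n)"] int_pow_neg_int[OF assms, of "nat (- n)"] by simp
    also have "\<dots> = (\<lambda>j\<in>{1..k}. n * b j)"
      by (subst inv_int_vec_group[OF pow_closed]) (use False in \<open>simp cong: restrict_cong\<close>)
    finally show ?thesis .
  qed
qed

lemma finprod_int_vec_group:
  assumes "finite B" "B \<subseteq> carrier (int_vec_group k)"
  shows "(\<Otimes>\<^bsub>int_vec_group k\<^esub>b\<in>B. b [^]\<^bsub>int_vec_group k\<^esub> (c b :: int)) = (\<lambda>j\<in>{1..k}. \<Sum>b\<in>B. c b * b j)"
  using assms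
proof (induction B)
  case empty
  interpret comm_group "int_vec_group k" by (rule comm_group_int_vec_group)
  show ?case by (simp add: one_int_vec_group)
next
  case (insert b B)
  interpret comm_group "int_vec_group k" by (rule comm_group_int_vec_group)
  have "(\<Otimes>\<^bsub>int_vec_group k\<^esub>b\<in>insert b B. b [^]\<^bsub>int_vec_group k\<^esub> c b)
      = b [^]\<^bsub>int_vec_group k\<^esub> c b \<otimes>\<^bsub>int_vec_group k\<^esub> (\<Otimes>\<^bsub>int_vec_group k\<^esub>b\<in>B. b [^]\<^bsub>int_vec_group k\<^esub> c b)"
    using insert by (intro finprod_insert) auto
  also have "\<dots> = (\<lambda>j\<in>{1..k}. c b * b j) \<otimes>\<^bsub>int_vec_group k\<^esub> (\<lambda>j\<in>{1..k}. \<Sum>b\<in>B. c b * b j)"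
    using insert by (simp only: int_pow_int_vec_group insert_subset)
  also have "\<dots> = (\<lambda>j\<in>{1..k}. \<Sum>b\<in>insert b B. c b * b j)"
    using insert.hyps by (simp add: mult_int_vec_group cong: restrict_cong)
  finally show ?case .
qed

lemma finprod_subgroup_closed:
  assumes "comm_group G" "subgroup H G" "finite B" "B \<subseteq> H"
  shows "(\<Otimes>\<^bsub>G\<^esub>b\<in>B. b [^]\<^bsub>G\<^esub> (c b :: int)) \<in> H"
  using assms(3,4)
proof (induction B)
  case empty
  interpret comm_group G by fact
  show ?case using subgroup.one_closed[OF assms(2)] by simp
next
  case (insert b B)
  interpret comm_group G by fact
  have sub: "H \<subseteq> carrier G" using assms(2) by (rule subgroup.subset)
  then have "(\<Otimes>\<^bsub>G\<^esub>b\<in>insert b B. b [^]\<^bsub>G\<^esub> c b) = b [^]\<^bsub>G\<^esub> c b \<otimes>\<^bsub>G\<^esub> (\<Otimes>\<^bsub>G\<^esub>b\<in>B. b [^]\<^bsub>G\<^esub> c b)"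
    using insert by (intro finprod_insert) auto
  then show ?case
    using insert subgroup.m_closed[OF assms(2)] subgroup_int_pow_closed[OF assms(2)] by simp
qed

text \<open>\<open>k\<close> independent vectors of \<Gamma> and the \<open>i\<close>-th unit vector
  are too many to be independent. In a relation between them the unit vector has a nonzero
  coefficient, so this multiple of it lies in \<Gamma>.\<close>

lemma full_rank_subgroup_multiple:
  assumes sub: "subgroup \<Gamma> (int_vec_group k)" and rank: "\<not> subgroup_rank (int_vec_group k) \<Gamma> < enat k"
    and i: "i \<in> {1..k}"
  shows "\<exists>m\<ge>1. (\<lambda>j\<in>{1..k}. if j = i then int m else 0) \<in> \<Gamma>"
proof -
  \<comment> \<open>A strict inequality below a supremum yields an actual independent set.\<close>
  have "enat (k - 1) < subgroup_rank (int_vec_group k) \<Gamma>"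
  proof (rule less_le_trans)
    show "enat (k - 1) < enat k" using i by simp
    show "enat k \<le> subgroup_rank (int_vec_group k) \<Gamma>" using rank by (simp only: not_less)
  qed
  then obtain B where B': "B \<in> {B. finite B \<and> B \<subseteq> \<Gamma> \<and> int_independent (int_vec_group k) B}" "enat (k - 1) < enat (card B)"
    unfolding subgroup_rank_def less_SUP_iff by blast
  then have B: "finite B" "B \<subseteq> \<Gamma>" "int_independent (int_vec_group k) B" "k \<le> card B"
    by auto
  have \<Gamma>: "\<Gamma> \<subseteq> carrier (int_vec_group k)" using sub by (rule subgroup.subset)
  have B\<Gamma>: "B \<subseteq> carrier (int_vec_group k)" using B(2) \<Gamma> by blast
  \<comment> \<open>\<open>None\<close> stands for the unit vector, keeping it distinct even when it
    already belongs to \<open>B\<close>.\<close>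
  define f where "f b j = (case b of None \<Rightarrow> if j = i then 1 else 0 | Some b \<Rightarrow> b j)" for b :: "(nat \<Rightarrow> int) option" and j
  have "card {1..k} < card (insert None (Some ` B))"
    using B by (subst card_insert_disjoint) (auto simp: card_image)
  then have "\<exists>c. (\<exists>b\<in>insert None (Some ` B). c b \<noteq> 0) \<and> (\<forall>j\<in>{1..k}. (\<Sum>b\<in>insert None (Some ` B). c b * f b j) = 0)"
    using B(1) by (intro int_linear_dependence) auto
  then obtain c where c: "\<exists>b\<in>insert None (Some ` B). c b \<noteq> 0"
    and c0: "\<And>j. j \<in> {1..k} \<Longrightarrow> (\<Sum>b\<in>insert None (Some ` B). c b * f b j) = 0"
    by blast
  have sum: "c None * (if j = i then 1 else 0) = - (\<Sum>b\<in>B. c (Some b) * b j)" if "j \<in> {1..k}" for j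
    using c0[OF that] B(1) by (simp add: f_def sum.reindex)
  have "c None \<noteq> 0"
  proof
    assume 0: "c None = 0"
    then have "(\<lambda>j\<in>{1..k}. \<Sum>b\<in>B. c (Some b) * b j) = \<one>\<^bsub>int_vec_group k\<^esub>"
      using sum by (simp add: one_int_vec_group cong: restrict_cong)
    then have "(\<Otimes>\<^bsub>int_vec_group k\<^esub>b\<in>B. b [^]\<^bsub>int_vec_group k\<^esub> c (Some b)) = \<one>\<^bsub>int_vec_group k\<^esub>"
      using finprod_int_vec_group[OF B(1) B\<Gamma>, of "\<lambda>b. c (Some b)"] by simp
    with spec[OF B(3)[unfolded int_independent_def], of "\<lambda>b. c (Some b)"]
    have "\<forall>b\<in>B. c (Some b) = 0" by blast
    then show False using c 0 by auto
  qed
  \<comment> \<open>The sign makes the multiple positive, as exponents of iterates must be.\<close>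
  define s where "s = - sgn (c None)"
  have "(\<lambda>j\<in>{1..k}. \<Sum>b\<in>B. (s * c (Some b)) * b j) \<in> \<Gamma>"
    using finprod_subgroup_closed[OF comm_group_int_vec_group sub B(1,2), of "\<lambda>b. s * c (Some b)"]
      finprod_int_vec_group[OF B(1) B\<Gamma>, of "\<lambda>b. s * c (Some b)"] by simp
  moreover have "(\<Sum>b\<in>B. (s * c (Some b)) * b j) = (if j = i then int (nat \<bar>c None\<bar>) else 0)" if "j \<in> {1..k}" for j
  proof -
    have "(\<Sum>b\<in>B. (s * c (Some b)) * b j) = s * (\<Sum>b\<in>B. c (Some b) * b j)"
      by (simp add: sum_distrib_left mult.assoc)
    also have "\<dots> = s * (- (c None * (if j = i then 1 else 0)))"
      using sum[OF that] by simp
    also have "\<dots> = (if j = i then \<bar>c None\<bar> else 0)"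
      by (simp add: s_def abs_sgn mult.commute)
    finally show ?thesis by simp
  qed
  ultimately have "(\<lambda>j\<in>{1..k}. if j = i then int (nat \<bar>c None\<bar>) else 0) \<in> \<Gamma>"
    by (simp cong: restrict_cong)
  moreover have "nat \<bar>c None\<bar> \<ge> 1" using \<open>c None \<noteq> 0\<close> by simp
  ultimately show ?thesis by blast
qed

section \<open>Iterates of commuting maps\<close>

lemma funpow_commute:
  assumes "\<And>x. f (g x) = g (f x)"
  shows "(f ^^ m) ((g ^^ n) x) = (g ^^ n) ((f ^^ m) x)"
proof -
  have 1: "f ((g ^^ n) x) = (g ^^ n) (f x)" for x
    by (induction n) (simp_all add: assms)
  show ?thesis by (induction m) (simp_all add: 1)
qed

lemma foldr_funpow_commute:
  assumes "\<And>i x. i \<in> set xs \<Longrightarrow> T j (T i x) = T i (T j x)"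
  shows "(T j ^^ m) (foldr (\<lambda>i. T i ^^ e i) xs x) = foldr (\<lambda>i. T i ^^ e i) xs ((T j ^^ m) x)"
  using assms
proof (induction xs)
  case (Cons a xs)
  then show ?case using funpow_commute[of "T j" "T a" m "e a"] by simp
qed simp

lemma foldr_funpow_add:
  assumes "\<And>i j x. i \<in> set xs \<Longrightarrow> j \<in> set xs \<Longrightarrow> T i (T j x) = T j (T i x)"
  shows "foldr (\<lambda>i. T i ^^ (d i + e i)) xs x = foldr (\<lambda>i. T i ^^ d i) xs (foldr (\<lambda>i. T i ^^ e i) xs x)"
  using assms
proof (induction xs arbitrary: x)
  case (Cons i xs)
  have "(T i ^^ e i) (foldr (\<lambda>i. T i ^^ d i) xs y) = foldr (\<lambda>i. T i ^^ d i) xs ((T i ^^ e i) y)" for y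
  proof (rule foldr_funpow_commute)
    fix i' x assume "i' \<in> set xs"
    then show "T i (T i' x) = T i' (T i x)" by (intro Cons.prems) simp_all
  qed
  then show ?case using Cons by (simp add: funpow_add)
qed simp

lemma multi_iterate_add:
  assumes "\<And>i j. i \<in> {1..k} \<Longrightarrow> j \<in> {1..k} \<Longrightarrow> T i \<circ> T j = T j \<circ> T i"
  shows "multi_iterate k T (\<lambda>i. d i + e i) x = multi_iterate k T d (multi_iterate k T e x)"
  unfolding multi_iterate_def
proof (rule foldr_funpow_add)
  fix i j x assume "i \<in> set [1..<Suc k]" "j \<in> set [1..<Suc k]"
  then have "i \<in> {1..k}" "j \<in> {1..k}" by auto
  from fun_cong[OF assms[OF this], of x] show "T i (T j x) = T j (T i x)"
    by (simp only: o_apply)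
qed

lemma multi_iterate_cong:
  assumes "\<And>i. i \<in> {1..k} \<Longrightarrow> d i = e i"
  shows "multi_iterate k T d = multi_iterate k T e"
  unfolding multi_iterate_def using assms by (intro ext foldr_cong) auto

lemma multi_iterate_zero: "multi_iterate k T (\<lambda>_. 0) x = x"
proof -
  have "foldr (\<lambda>i. T i ^^ 0) xs x = x" for xs by (induction xs) auto
  then show ?thesis by (simp add: multi_iterate_def)
qed

lemma multi_iterate_single:
  assumes "i \<in> {1..k}"
  shows "multi_iterate k T (\<lambda>j. if j = i then m else 0) x = (T i ^^ m) x"
proof -
  have "foldr (\<lambda>j. T j ^^ (if j = i then m else 0)) xs x = (if i \<in> set xs then (T i ^^ m) x else x)"
    if "distinct xs" for xs
    using that by (induction xs) auto
  from this[of "[1..<Suc k]"] show ?thesis using assms by (simp add: multi_iterate_def del: upt_Suc)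
qed

lemma continuous_on_funpow:
  fixes f :: "'x::topological_space \<Rightarrow> 'x"
  assumes "continuous_on UNIV f"
  shows "continuous_on UNIV (f ^^ n)"
proof (induction n)
  case (Suc n)
  have "f ^^ Suc n = (\<lambda>x. f ((f ^^ n) x))" by auto
  then show ?case
    using continuous_on_compose2[OF assms Suc] by simp
qed (simp add: continuous_on_id id_def)

lemma continuous_on_multi_iterate:
  fixes T :: "nat \<Rightarrow> 'x::topological_space \<Rightarrow> 'x"
  assumes "\<And>i. i \<in> {1..k} \<Longrightarrow> continuous_on UNIV (T i)"
  shows "continuous_on UNIV (multi_iterate k T e)"
proof -
  have "continuous_on UNIV (foldr (\<lambda>i. T i ^^ e i) xs)" if "set xs \<subseteq> {1..k}" for xs
    using that
  proof (induction xs)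
    case (Cons i xs)
    have "foldr (\<lambda>i. T i ^^ e i) (i # xs) = (\<lambda>x. (T i ^^ e i) (foldr (\<lambda>i. T i ^^ e i) xs x))" by auto
    moreover have "continuous_on UNIV (T i ^^ e i)" using Cons.prems assms by (intro continuous_on_funpow) auto
    moreover have "continuous_on UNIV (foldr (\<lambda>i. T i ^^ e i) xs)" using Cons by auto
    ultimately show ?case
      using continuous_on_compose2[of UNIV "T i ^^ e i" UNIV "foldr (\<lambda>i. T i ^^ e i) xs"] by simp
  qed (simp add: continuous_on_id id_def)
  from this[of "[1..<Suc k]"] show ?thesis
    unfolding multi_iterate_def[abs_def] by (simp del: upt_Suc add: atLeastLessThanSuc_atLeastAtMost)
qed

section \<open>Limits of orbit averages\<close>

text \<open>By Tychonoff the sequence of families has a cluster point in a product of compact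
  intervals. A filter replaces a subsequence because the index type, later all real functions on the
  space, may be uncountable.\<close>

lemma exists_limit_functional:
  fixes A :: "nat \<Rightarrow> 'i \<Rightarrow> real"
  assumes bound: "\<And>N i. \<bar>A N i\<bar> \<le> b i" and inf: "\<exists>\<^sub>F N in sequentially. P N"
  obtains \<Lambda> G where "G \<noteq> bot" "G \<le> sequentially" "eventually P G" "\<And>i. ((\<lambda>N. A N i) \<longlongrightarrow> \<Lambda> i) G"
proof -
  define F where "F = inf_class.inf sequentially (principal {N. P N})"
  have F: "F \<noteq> bot"
    using inf by (simp add: F_def trivial_limit_def eventually_inf_principal frequently_def)
  define K where "K = (\<Pi>\<^sub>E i\<in>UNIV. {- b i .. b i})"
  have "compactin (product_topology (\<lambda>_. euclidean) UNIV) K"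
    unfolding K_def compactin_PiE by simp
  then have K: "compact K"
    by (simp add: euclidean_product_topology)
  have "filtermap A F \<noteq> bot" using F by (simp add: filtermap_bot_iff)
  moreover have "\<forall>\<^sub>F z in filtermap A F. z \<in> K"
    using bound by (simp add: eventually_filtermap K_def abs_le_iff minus_le_iff PiE_iff)
  ultimately obtain \<Lambda> where \<Lambda>: "inf_class.inf (nhds \<Lambda>) (filtermap A F) \<noteq> bot"
    using K unfolding compact_filter by blast
  \<comment> \<open>Pulling back the neighbourhoods of a cluster point makes every coordinate
    converge; the filter is proper because the point is a cluster point.\<close>
  define G where "G = inf_class.inf F (filtercomap A (nhds \<Lambda>))"
  have "G \<noteq> bot"
  proof
    assume "G = bot"
    then obtain Q R where Q: "eventually Q F" and R: "eventually R (filtercomap A (nhds \<Lambda>))" and QR: "\<And>N. Q N \<Longrightarrow> R N \<Longrightarrow> False"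
      unfolding G_def trivial_limit_def eventually_inf by blast
    obtain S where S: "eventually S (nhds \<Lambda>)" "\<And>N. S (A N) \<Longrightarrow> R N"
      using R unfolding eventually_filtercomap by blast
    have "eventually (\<lambda>z. \<not> S z) (filtermap A F)"
      unfolding eventually_filtermap using Q by (rule eventually_mono) (use QR S(2) in blast)
    with S(1) have "eventually (\<lambda>_. False) (inf_class.inf (nhds \<Lambda>) (filtermap A F))"
      unfolding eventually_inf by blast
    then show False using \<Lambda> by (simp add: trivial_limit_def)
  qed
  moreover have "G \<le> F" by (simp add: G_def)
  then have "G \<le> sequentially" "eventually P G"
    unfolding F_def by (simp_all add: le_principal)
  moreover have "((\<lambda>N. A N i) \<longlongrightarrow> \<Lambda> i) G" for i
  proof -
    have "filterlim A (nhds \<Lambda>) G"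
      unfolding G_def by (rule filterlim_mono[OF filterlim_filtercomap order_refl]) simp
    moreover have "continuous_on UNIV (\<lambda>x :: 'i \<Rightarrow> real. x i)"
      by (rule continuous_on_product_coordinates)
    ultimately show ?thesis
      by (intro continuous_on_tendsto_compose[of UNIV "\<lambda>x. x i" A \<Lambda> G]) auto
  qed
  ultimately show ?thesis using that by blast
qed

text \<open>If the averages of \<open>g0\<close> stay away from \<open>l\<close> along infinitely
  many \<open>N\<close>, a limit functional along these \<open>N\<close> is positive, normalised and
  invariant, yet its value at \<open>g0\<close> is not \<open>l\<close>.\<close>

lemma invariant_measure_unique_imp_convergence:
  fixes y :: "nat \<Rightarrow> 'x::metric_space" and H :: "('x \<Rightarrow> 'x) set" and g0 :: "'x \<Rightarrow> real"
  assumes compact: "compact (UNIV :: 'x set)"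
    and H: "\<And>S. S \<in> H \<Longrightarrow> continuous_on UNIV S"
    and asym: "\<And>S g. S \<in> H \<Longrightarrow> continuous_on UNIV g \<Longrightarrow>
       (\<lambda>N. (\<Sum>n=1..N. g (y n)) / real N - (\<Sum>n=1..N. g (S (y n))) / real N) \<longlonglongrightarrow> 0"
    and unique: "\<And>\<Lambda>. positive_functional \<Lambda> \<Longrightarrow> (\<And>S g. S \<in> H \<Longrightarrow> continuous_on UNIV g \<Longrightarrow> \<Lambda> (\<lambda>x. g (S x)) = \<Lambda> g) \<Longrightarrow> \<Lambda> g0 = l"
    and g0: "continuous_on UNIV g0"
  shows "(\<lambda>N. (\<Sum>n=1..N. g0 (y n)) / real N) \<longlonglongrightarrow> l"
proof (rule ccontr)
  assume "\<not> ?thesis"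
  then obtain e where e: "0 < e" and "\<not> (\<forall>\<^sub>F N in sequentially. \<bar>(\<Sum>n=1..N. g0 (y n)) / real N - l\<bar> < e)"
    unfolding tendsto_iff dist_real_def by blast
  then have freq: "\<exists>\<^sub>F N in sequentially. e \<le> \<bar>(\<Sum>n=1..N. g0 (y n)) / real N - l\<bar>"
    by (simp add: frequently_def not_le)
  \<comment> \<open>The value 0 at discontinuous functions bounds every coordinate, as compactness
    of the product requires.\<close>
  define A where "A N g = (if continuous_on UNIV g then (\<Sum>n=1..N. g (y n)) / real N else 0)" for N and g :: "'x \<Rightarrow> real"
  have "\<exists>b. \<forall>N. \<bar>A N g\<bar> \<le> b" for g
  proof (cases "continuous_on UNIV g")
    case True
    then have "bounded (g ` UNIV)" using compact by (intro compact_imp_bounded compact_continuous_image)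
    then obtain b where b: "\<And>x. \<bar>g x\<bar> \<le> b" by (auto simp: bounded_iff)
    have b0: "0 \<le> b" using b[of undefined] by linarith
    have "\<bar>A N g\<bar> \<le> b" for N
    proof (cases "N = 0")
      case False
      have "\<bar>\<Sum>n=1..N. g (y n)\<bar> \<le> (\<Sum>n=1..N. \<bar>g (y n)\<bar>)" by (rule sum_abs)
      also have "\<dots> \<le> (\<Sum>n=1..N. b)" by (intro sum_mono b)
      also have "\<dots> = real N * b" by simp
      finally show ?thesis using True False by (simp add: A_def divide_le_eq mult.commute)
    qed (use b0 in \<open>simp add: A_def\<close>)
    then show ?thesis by blast
  qed (auto simp: A_def intro: exI[of _ 0])
  then obtain b where b: "\<And>N g. \<bar>A N g\<bar> \<le> b g" by metis
  obtain \<Lambda> G where G: "G \<noteq> bot" "G \<le> sequentially" "\<forall>\<^sub>F N in G. e \<le> \<bar>(\<Sum>n=1..N. g0 (y n)) / real N - l\<bar>"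
    and \<Lambda>: "\<And>g. ((\<lambda>N. A N g) \<longlongrightarrow> \<Lambda> g) G"
    using exists_limit_functional[of A b, OF b freq] by metis
  have "positive_functional \<Lambda>"
  proof
    fix f g :: "'x \<Rightarrow> real" assume fg: "continuous_on UNIV f" "continuous_on UNIV g"
    have "A N (\<lambda>x. f x + g x) = A N f + A N g" for N
      using fg by (simp add: A_def sum.distrib add_divide_distrib continuous_on_add)
    then have "((\<lambda>N. A N f + A N g) \<longlongrightarrow> \<Lambda> (\<lambda>x. f x + g x)) G"
      using \<Lambda>[of "\<lambda>x. f x + g x"] by simp
    then show "\<Lambda> (\<lambda>x. f x + g x) = \<Lambda> f + \<Lambda> g"
      by (rule tendsto_unique[OF G(1) _ tendsto_add[OF \<Lambda> \<Lambda>]])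
  next
    fix f :: "'x \<Rightarrow> real" and c assume f: "continuous_on UNIV f"
    have "A N (\<lambda>x. c * f x) = c * A N f" for N
      using f by (simp add: A_def sum_distrib_left[symmetric] continuous_on_mult_left)
    then have "((\<lambda>N. c * A N f) \<longlongrightarrow> \<Lambda> (\<lambda>x. c * f x)) G"
      using \<Lambda>[of "\<lambda>x. c * f x"] by simp
    then show "\<Lambda> (\<lambda>x. c * f x) = c * \<Lambda> f"
      by (rule tendsto_unique[OF G(1) _ tendsto_mult_left[OF \<Lambda>]])
  next
    fix f :: "'x \<Rightarrow> real" assume f: "continuous_on UNIV f" "\<And>x. 0 \<le> f x"
    then show "0 \<le> \<Lambda> f"
      by (intro tendsto_lowerbound[OF \<Lambda> _ G(1)] always_eventually) (auto simp: A_def intro!: divide_nonneg_nonneg sum_nonneg)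
  next
    have "\<forall>\<^sub>F N in sequentially. A N (\<lambda>_. 1) = 1"
      using eventually_gt_at_top[of 0] by eventually_elim (simp add: A_def)
    then have "\<forall>\<^sub>F N in G. A N (\<lambda>_. 1) = 1" using G(2) by (rule filter_leD[rotated])
    then have "((\<lambda>N. A N (\<lambda>_. 1)) \<longlongrightarrow> 1) G" by (rule tendsto_eventually)
    then show "\<Lambda> (\<lambda>_. 1) = 1" by (rule tendsto_unique[OF G(1) \<Lambda>])
  qed (rule compact)
  moreover have "\<Lambda> (\<lambda>x. g (S x)) = \<Lambda> g" if S: "S \<in> H" and g: "continuous_on UNIV g" for S g
  proof -
    have "continuous_on UNIV (\<lambda>x. g (S x))"
      using continuous_on_compose2[OF g H[OF S]] by simp
    then have "(\<lambda>N. A N g - A N (\<lambda>x. g (S x))) \<longlonglongrightarrow> 0"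
      using asym[OF S g] g by (simp add: A_def)
    then have "((\<lambda>N. A N g - A N (\<lambda>x. g (S x))) \<longlongrightarrow> 0) G"
      using G(2) by (rule tendsto_mono[rotated])
    moreover have "((\<lambda>N. A N g - A N (\<lambda>x. g (S x))) \<longlongrightarrow> \<Lambda> g - \<Lambda> (\<lambda>x. g (S x))) G"
      by (intro tendsto_diff \<Lambda>)
    ultimately have "0 = \<Lambda> g - \<Lambda> (\<lambda>x. g (S x))" by (rule tendsto_unique[OF G(1)])
    then show ?thesis by simp
  qed
  ultimately have "\<Lambda> g0 = l" by (rule unique)
  moreover have "((\<lambda>N. \<bar>A N g0 - l\<bar>) \<longlongrightarrow> \<bar>\<Lambda> g0 - l\<bar>) G"
    by (intro tendsto_intros \<Lambda>)
  then have "e \<le> \<bar>\<Lambda> g0 - l\<bar>"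
    by (rule tendsto_lowerbound[OF _ _ G(1)]) (use G(3) g0 in \<open>simp add: A_def\<close>)
  ultimately show False using e by simp
qed

text \<open>Iterates exist for natural exponents only. The differences of two natural exponent vectors
  whose iterates preserve \<open>\<Lambda>\<close> nevertheless form a subgroup of the integer vectors, and for such a
  difference that is itself natural the common summand can be cancelled.\<close>

definition invariance_vectors ::
    "nat \<Rightarrow> (nat \<Rightarrow> 'x::topological_space \<Rightarrow> 'x) \<Rightarrow> (('x \<Rightarrow> real) \<Rightarrow> real) \<Rightarrow> (nat \<Rightarrow> int) set" where
  "invariance_vectors k T \<Lambda> = {z. \<exists>u v. z = (\<lambda>j\<in>{1..k}. int (u j) - int (v j)) \<and>
     (\<forall>g. continuous_on UNIV g \<longrightarrow> \<Lambda> (\<lambda>x. g (multi_iterate k T u x)) = \<Lambda> g) \<and>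
     (\<forall>g. continuous_on UNIV g \<longrightarrow> \<Lambda> (\<lambda>x. g (multi_iterate k T v x)) = \<Lambda> g)}"

text \<open>Invariance under \<open>v\<close> is applied to the continuous function \<open>g\<close>
  composed with the iterate for \<open>u\<close>. This serves both to add exponent vectors and to
  cancel a common summand.\<close>

lemma invariance_compose:
  fixes \<Lambda> :: "('x::topological_space \<Rightarrow> real) \<Rightarrow> real"
  assumes T: "\<And>i. i \<in> {1..k} \<Longrightarrow> continuous_on UNIV (T i)"
    and comm: "\<And>i j. i \<in> {1..k} \<Longrightarrow> j \<in> {1..k} \<Longrightarrow> T i \<circ> T j = T j \<circ> T i"
    and v: "\<And>g. continuous_on UNIV g \<Longrightarrow> \<Lambda> (\<lambda>x. g (multi_iterate k T v x)) = \<Lambda> g"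
    and g: "continuous_on UNIV g"
  shows "\<Lambda> (\<lambda>x. g (multi_iterate k T (\<lambda>i. u i + v i) x)) = \<Lambda> (\<lambda>x. g (multi_iterate k T u x))"
proof -
  have "continuous_on UNIV (\<lambda>x. g (multi_iterate k T u x))"
    using continuous_on_compose2[OF g continuous_on_multi_iterate[OF T]] by simp
  then have "\<Lambda> (\<lambda>x. g (multi_iterate k T u (multi_iterate k T v x))) = \<Lambda> (\<lambda>x. g (multi_iterate k T u x))"
    by (rule v)
  moreover have "multi_iterate k T (\<lambda>i. u i + v i) x = multi_iterate k T u (multi_iterate k T v x)" for x
    by (rule multi_iterate_add) (rule comm)
  ultimately show ?thesis by simp
qed

lemma subgroup_invariance_vectors:
  assumes T: "\<And>i. i \<in> {1..k} \<Longrightarrow> continuous_on UNIV (T i)"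
    and comm: "\<And>i j. i \<in> {1..k} \<Longrightarrow> j \<in> {1..k} \<Longrightarrow> T i \<circ> T j = T j \<circ> T i"
  shows "subgroup (invariance_vectors k T \<Lambda>) (int_vec_group k)"
proof -
  interpret comm_group "int_vec_group k" by (rule comm_group_int_vec_group)
  have carrier: "invariance_vectors k T \<Lambda> \<subseteq> carrier (int_vec_group k)"
    by (auto simp: invariance_vectors_def carrier_int_vec_group)
  show ?thesis
  proof (rule subgroupI[OF carrier])
    have "(\<lambda>j\<in>{1..k}. int 0 - int 0) \<in> invariance_vectors k T \<Lambda>"
      unfolding invariance_vectors_def by (intro CollectI exI[of _ "\<lambda>_. 0"]) (simp add: multi_iterate_zero)
    then show "invariance_vectors k T \<Lambda> \<noteq> {}" by blast
  next
    fix z assume z: "z \<in> invariance_vectors k T \<Lambda>"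
    then obtain u v where "z = (\<lambda>j\<in>{1..k}. int (u j) - int (v j))"
      "\<forall>g. continuous_on UNIV g \<longrightarrow> \<Lambda> (\<lambda>x. g (multi_iterate k T u x)) = \<Lambda> g"
      "\<forall>g. continuous_on UNIV g \<longrightarrow> \<Lambda> (\<lambda>x. g (multi_iterate k T v x)) = \<Lambda> g"
      unfolding invariance_vectors_def by blast
    moreover from this(1) have "inv\<^bsub>int_vec_group k\<^esub> z = (\<lambda>j\<in>{1..k}. int (v j) - int (u j))"
      using z carrier by (subst inv_int_vec_group) (auto cong: restrict_cong)
    ultimately show "inv\<^bsub>int_vec_group k\<^esub> z \<in> invariance_vectors k T \<Lambda>"
      unfolding invariance_vectors_def by blast
  next
    fix z z' assume "z \<in> invariance_vectors k T \<Lambda>" "z' \<in> invariance_vectors k T \<Lambda>"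
    then obtain u v u' v' where z: "z = (\<lambda>j\<in>{1..k}. int (u j) - int (v j))"
      and z': "z' = (\<lambda>j\<in>{1..k}. int (u' j) - int (v' j))"
      and u: "\<And>g. continuous_on UNIV g \<Longrightarrow> \<Lambda> (\<lambda>x. g (multi_iterate k T u x)) = \<Lambda> g"
      and v: "\<And>g. continuous_on UNIV g \<Longrightarrow> \<Lambda> (\<lambda>x. g (multi_iterate k T v x)) = \<Lambda> g"
      and u': "\<And>g. continuous_on UNIV g \<Longrightarrow> \<Lambda> (\<lambda>x. g (multi_iterate k T u' x)) = \<Lambda> g"
      and v': "\<And>g. continuous_on UNIV g \<Longrightarrow> \<Lambda> (\<lambda>x. g (multi_iterate k T v' x)) = \<Lambda> g"
      unfolding invariance_vectors_def by blast
    have "z \<otimes>\<^bsub>int_vec_group k\<^esub> z' = (\<lambda>j\<in>{1..k}. int (u j + u' j) - int (v j + v' j))"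
      by (simp add: z z' mult_int_vec_group algebra_simps cong: restrict_cong)
    moreover have "\<Lambda> (\<lambda>x. g (multi_iterate k T (\<lambda>j. u j + u' j) x)) = \<Lambda> g" if g: "continuous_on UNIV g" for g
    proof -
      have "\<Lambda> (\<lambda>x. g (multi_iterate k T (\<lambda>j. u j + u' j) x)) = \<Lambda> (\<lambda>x. g (multi_iterate k T u x))"
        by (rule invariance_compose) (fact T comm u' g)+
      then show ?thesis using u[OF g] by simp
    qed
    moreover have "\<Lambda> (\<lambda>x. g (multi_iterate k T (\<lambda>j. v j + v' j) x)) = \<Lambda> g" if g: "continuous_on UNIV g" for g
    proof -
      have "\<Lambda> (\<lambda>x. g (multi_iterate k T (\<lambda>j. v j + v' j) x)) = \<Lambda> (\<lambda>x. g (multi_iterate k T v x))"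
        by (rule invariance_compose) (fact T comm v' g)+
      then show ?thesis using v[OF g] by simp
    qed
    ultimately show "z \<otimes>\<^bsub>int_vec_group k\<^esub> z' \<in> invariance_vectors k T \<Lambda>"
      unfolding invariance_vectors_def
      by (intro CollectI exI[of _ "\<lambda>j. u j + u' j"] exI[of _ "\<lambda>j. v j + v' j"]) simp
  qed
qed

lemma invariance_vector_single:
  assumes T: "\<And>i. i \<in> {1..k} \<Longrightarrow> continuous_on UNIV (T i)"
    and comm: "\<And>i j. i \<in> {1..k} \<Longrightarrow> j \<in> {1..k} \<Longrightarrow> T i \<circ> T j = T j \<circ> T i"
    and i: "i \<in> {1..k}" and z: "(\<lambda>j\<in>{1..k}. if j = i then int m else 0) \<in> invariance_vectors k T \<Lambda>"
    and g: "continuous_on UNIV g"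
  shows "\<Lambda> (\<lambda>x. g ((T i ^^ m) x)) = \<Lambda> g"
proof -
  define w where "w j = (if j = i then m else 0)" for j
  obtain u v where uv: "(\<lambda>j\<in>{1..k}. if j = i then int m else 0) = (\<lambda>j\<in>{1..k}. int (u j) - int (v j))"
    and u: "\<And>g. continuous_on UNIV g \<Longrightarrow> \<Lambda> (\<lambda>x. g (multi_iterate k T u x)) = \<Lambda> g"
    and v: "\<And>g. continuous_on UNIV g \<Longrightarrow> \<Lambda> (\<lambda>x. g (multi_iterate k T v x)) = \<Lambda> g"
    using z unfolding invariance_vectors_def by blast
  have "u j = w j + v j" if j: "j \<in> {1..k}" for j
  proof -
    have "(if j = i then int m else 0) = int (u j) - int (v j)"
      using fun_cong[OF uv, of j] j by simp
    then show ?thesis by (simp add: w_def split: if_splits)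
  qed
  then have "multi_iterate k T u = multi_iterate k T (\<lambda>j. w j + v j)"
    by (rule multi_iterate_cong)
  then have "\<Lambda> (\<lambda>x. g (multi_iterate k T (\<lambda>j. w j + v j) x)) = \<Lambda> g"
    using u[OF g] by simp
  moreover have "\<Lambda> (\<lambda>x. g (multi_iterate k T (\<lambda>j. w j + v j) x)) = \<Lambda> (\<lambda>x. g (multi_iterate k T w x))"
    by (rule invariance_compose) (fact T comm v g)+
  ultimately have "\<Lambda> (\<lambda>x. g (multi_iterate k T w x)) = \<Lambda> g"
    by simp
  then show ?thesis
    unfolding w_def by (simp add: multi_iterate_single[OF i])
qed

section \<open>From prime colours to invariance and to the measure\<close>

lemma avg_real: "avg g (real N) = (\<Sum>n=1..N. g n) / real N"
  by (simp add: avg_def)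

lemma finite_prime_values:
  assumes "\<And>i. i \<in> I \<Longrightarrow> finite {a i p | p. prime p}" "finite I"
  shows "finite ((\<lambda>p. \<lambda>i\<in>I. a i p) ` {p::nat. prime p})"
proof (rule finite_subset)
  show "(\<lambda>p. \<lambda>i\<in>I. a i p) ` {p::nat. prime p} \<subseteq> (\<Pi>\<^sub>E i\<in>I. {a i p | p. prime p})"
    by (intro image_subsetI restrict_PiE_iff[THEN iffD2]) auto
  show "finite (\<Pi>\<^sub>E i\<in>I. {a i p | p. prime p})"
    using assms by (intro finite_PiE)
qed

text \<open>Only finitely many colours lie outside \<Gamma>, so bounds for the single colours add
  up. Conversely, an infinite sum forces a single colour outside \<Gamma> with divergent reciprocal
  sum.\<close>

lemma finite_prime_reciprocals:
  fixes col :: "nat \<Rightarrow> 'c"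
  assumes fin: "finite (col ` {p. prime p})"
    and bnd: "\<And>q. prime q \<Longrightarrow> col q \<notin> \<Gamma> \<Longrightarrow>
      \<exists>L. \<forall>B. finite B \<and> B \<subseteq> {p. prime p \<and> col p = col q} \<longrightarrow> (\<Sum>p\<in>B. 1 / real p) \<le> L"
  shows "(\<Sum>\<^sub>\<infinity>p\<in>{p. prime p \<and> col p \<notin> \<Gamma>}. ennreal (1 / real p)) \<noteq> \<infinity>"
proof -
  define C where "C = col ` {p. prime p} - \<Gamma>"
  have finC: "finite C" using fin by (simp add: C_def)
  have "\<exists>L. \<forall>B. finite B \<and> B \<subseteq> {p. prime p \<and> col p = c} \<longrightarrow> (\<Sum>p\<in>B. 1 / real p) \<le> L" if "c \<in> C" for c
    using bnd that by (auto simp: C_def)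
  then obtain L where L: "\<And>c B. c \<in> C \<Longrightarrow> finite B \<Longrightarrow> B \<subseteq> {p. prime p \<and> col p = c} \<Longrightarrow> (\<Sum>p\<in>B. 1 / real p) \<le> L c"
    by metis
  have "(\<Sum>\<^sub>\<infinity>p\<in>{p. prime p \<and> col p \<notin> \<Gamma>}. ennreal (1 / real p)) \<le> ennreal (\<Sum>c\<in>C. L c)"
  proof (rule infsum_le_finite_sums)
    show "(\<lambda>p. ennreal (1 / real p)) summable_on {p. prime p \<and> col p \<notin> \<Gamma>}"
      by (intro nonneg_summable_on_complete) simp
    fix F assume F: "finite F" "F \<subseteq> {p. prime p \<and> col p \<notin> \<Gamma>}"
    have "F \<subseteq> (\<Union>c\<in>C. {p\<in>F. col p = c})" using F by (auto simp: C_def)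
    then have "(\<Sum>p\<in>F. 1 / real p) \<le> (\<Sum>p\<in>(\<Union>c\<in>C. {p\<in>F. col p = c}). 1 / real p)"
      using F(1) finC by (intro sum_mono2) auto
    also have "\<dots> \<le> (\<Sum>c\<in>C. \<Sum>p\<in>{p\<in>F. col p = c}. 1 / real p)"
      using F(1) finC by (intro sum_UN_le_sum) auto
    also have "\<dots> \<le> (\<Sum>c\<in>C. L c)"
      using F by (intro sum_mono L) auto
    finally show "(\<Sum>p\<in>F. ennreal (1 / real p)) \<le> ennreal (\<Sum>c\<in>C. L c)"
      by (simp add: sum_ennreal ennreal_leI)
  qed
  then show ?thesis by (auto simp: top_unique)
qed

text \<open>Complete additivity turns multiplication by a prime into the iterate given by its
  colour, so after scaling \<open>g\<close> into the unit interval around 0 this is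
  \<open>avg_dilate_prime_class\<close>.\<close>

lemma orbit_averages_asymptotically_invariant:
  fixes k :: nat and a :: "nat \<Rightarrow> nat \<Rightarrow> nat" and T :: "nat \<Rightarrow> 'x::metric_space \<Rightarrow> 'x" and g :: "'x \<Rightarrow> real"
  defines "y \<equiv> \<lambda>x n. multi_iterate k T (\<lambda>i. a i n) x"
  assumes add: "\<And>i. i \<in> {1..k} \<Longrightarrow> completely_additive (a i)"
    and fin: "\<And>i. i \<in> {1..k} \<Longrightarrow> finite {a i p | p. prime p}"
    and compact: "compact (UNIV :: 'x set)"
    and comm: "\<And>i j. i \<in> {1..k} \<Longrightarrow> j \<in> {1..k} \<Longrightarrow> T i \<circ> T j = T j \<circ> T i"
    and q: "prime q"
    and div: "\<And>L. \<exists>B. finite B \<and> B \<subseteq> {p. prime p \<and> (\<forall>i\<in>{1..k}. a i p = a i q)} \<and> L \<le> (\<Sum>p\<in>B. 1 / real p)"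
    and g: "continuous_on UNIV g"
  shows "(\<lambda>N. (\<Sum>n=1..N. g (y x n)) / real N - (\<Sum>n=1..N. g (multi_iterate k T (\<lambda>i. a i q) (y x n))) / real N) \<longlonglongrightarrow> 0"
proof -
  have "bounded (g ` UNIV)" using compact g by (intro compact_imp_bounded compact_continuous_image)
  then obtain b0 where b0: "\<And>x. \<bar>g x\<bar> \<le> b0" by (auto simp: bounded_iff)
  \<comment> \<open>The maximum keeps the divisor positive even for \<open>g = 0\<close>.\<close>
  define b where "b = max b0 1"
  have b: "0 < b" "\<And>x. \<bar>g x\<bar> \<le> b" using b0 by (auto simp: b_def intro: max.coboundedI1)
  define h where "h n = g (y x n) / b" for n
  define col where "col p = (\<lambda>i\<in>{1..k}. a i p)" for p
  have mult: "y x (p * m) = multi_iterate k T (\<lambda>i. a i p) (y x m)" if "1 \<le> p" "1 \<le> m" for p m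
  proof -
    have "y x (p * m) = multi_iterate k T (\<lambda>i. a i p + a i m) x"
      unfolding y_def using add that
      by (intro fun_cong[OF multi_iterate_cong]) (auto simp: completely_additive_def)
    also have "\<dots> = multi_iterate k T (\<lambda>i. a i p) (multi_iterate k T (\<lambda>i. a i m) x)"
      by (rule multi_iterate_add) (fact comm)
    finally show ?thesis by (simp add: y_def)
  qed
  have colD: "a i p = a i p'" if "col p = col p'" "i \<in> {1..k}" for p p' i
    using fun_cong[OF that(1), of i] that(2) by (simp add: col_def)
  have "((\<lambda>z. avg h z - avg (\<lambda>n. h (q * n)) z) \<longlongrightarrow> 0) at_top"
  proof (rule avg_dilate_prime_class[where col = col])
    show "\<bar>h n\<bar> \<le> 1" for n using b(1) b(2)[of "y x n"] by (simp add: h_def)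
    show "finite (col ` {p. prime p})"
      unfolding col_def using fin by (intro finite_prime_values) auto
    show "h (p * m) = h (p' * m)" if p: "prime p" "prime p'" "col p = col p'" and m: "1 \<le> m" for p p' m
    proof -
      have "multi_iterate k T (\<lambda>i. a i p) = multi_iterate k T (\<lambda>i. a i p')"
        using colD[OF p(3)] by (rule multi_iterate_cong)
      then show ?thesis
        using mult[of p m] mult[of p' m] m p prime_ge_1_nat by (simp add: h_def)
    qed
    show "prime q" by fact
    have sub: "{p. prime p \<and> (\<forall>i\<in>{1..k}. a i p = a i q)} \<subseteq> {p. prime p \<and> col p = col q}"
      by (auto simp: col_def intro!: restrict_ext)
    show "\<exists>B. finite B \<and> B \<subseteq> {p. prime p \<and> col p = col q} \<and> L \<le> (\<Sum>p\<in>B. 1 / real p)" for L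
      using div[of L] sub by (meson subset_trans)
  qed
  then have "(\<lambda>N. avg h (real N) - avg (\<lambda>n. h (q * n)) (real N)) \<longlonglongrightarrow> 0"
    by (rule filterlim_compose[OF _ filterlim_real_sequentially])
  then have "(\<lambda>N. b * (avg h (real N) - avg (\<lambda>n. h (q * n)) (real N))) \<longlonglongrightarrow> b * 0"
    by (rule tendsto_mult_left)
  moreover have "b * (avg h (real N) - avg (\<lambda>n. h (q * n)) (real N))
      = (\<Sum>n=1..N. g (y x n)) / real N - (\<Sum>n=1..N. g (multi_iterate k T (\<lambda>i. a i q) (y x n))) / real N" for N
  proof -
    have "(\<Sum>n=1..N. h (q * n)) = (\<Sum>n=1..N. g (multi_iterate k T (\<lambda>i. a i q) (y x n)) / b)"
      using mult[of q] q prime_ge_1_nat by (intro sum.cong) (auto simp: h_def)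
    then have "b * avg (\<lambda>n. h (q * n)) (real N) = (\<Sum>n=1..N. g (multi_iterate k T (\<lambda>i. a i q) (y x n))) / real N"
      using b(1) by (simp add: avg_real flip: sum_divide_distrib)
    moreover have "b * avg h (real N) = (\<Sum>n=1..N. g (y x n)) / real N"
      using b(1) by (simp add: avg_real h_def flip: sum_divide_distrib)
    ultimately show ?thesis by (simp add: right_diff_distrib)
  qed
  ultimately show ?thesis by simp
qed

text \<open>The image measure and the measure itself integrate continuous functions alike, which
  determines a Borel probability measure.\<close>

lemma invariant_under_riesz_measure:
  fixes \<Lambda> :: "('x::metric_space \<Rightarrow> real) \<Rightarrow> real"
  assumes \<Lambda>: "positive_functional \<Lambda>" and S: "continuous_on UNIV S"
    and inv: "\<And>g. continuous_on UNIV g \<Longrightarrow> \<Lambda> (\<lambda>x. g (S x)) = \<Lambda> g"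
  shows "invariant_under (positive_functional.riesz_measure \<Lambda>) S"
proof -
  interpret positive_functional \<Lambda> by (rule \<Lambda>)
  have sets: "sets riesz_measure = sets borel" by (rule sets_riesz_measure)
  have SM: "S \<in> measurable riesz_measure borel"
    unfolding measurable_cong_sets[OF sets refl] using S by (rule borel_measurable_continuous_onI)
  have "distr riesz_measure borel S = riesz_measure"
  proof (rule borel_prob_eqI)
    show "borel_prob (distr riesz_measure borel S)"
      using borel_prob_riesz_measure SM by (simp add: borel_prob_def prob_space.prob_space_distr)
    show "borel_prob riesz_measure" by (rule borel_prob_riesz_measure)
    fix g :: "'x \<Rightarrow> real" assume g: "continuous_on UNIV g"
    have "(\<integral>x. g x \<partial>distr riesz_measure borel S) = (\<integral>x. g (S x) \<partial>riesz_measure)"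
      using SM g by (intro integral_distr borel_measurable_continuous_onI)
    also have "\<dots> = \<Lambda> (\<lambda>x. g (S x))"
      using continuous_on_compose2[OF g S] by (intro integral_riesz_measure) simp
    also have "\<dots> = (\<integral>x. g x \<partial>riesz_measure)"
      using inv[OF g] integral_riesz_measure[OF g] by simp
    finally show "(\<integral>x. g x \<partial>distr riesz_measure borel S) = (\<integral>x. g x \<partial>riesz_measure)" .
  qed
  then show ?thesis by (simp add: invariant_under_def)
qed

theorem corollary1p19:
  fixes k :: nat
    and a :: "nat \<Rightarrow> nat \<Rightarrow> nat"
    and T :: "nat \<Rightarrow> 'x::metric_space \<Rightarrow> 'x"
    and \<mu> :: "'x measure"
    and f :: "'x \<Rightarrow> complex"
    and x :: 'x
  assumes "k \<ge> 1"
    and "\<And>i. i \<in> {1..k} \<Longrightarrow> completely_additive (a i)"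
    and "\<And>i. i \<in> {1..k} \<Longrightarrow> finite {a i p | p. prime p}"
    and "\<And>\<Gamma>. subgroup \<Gamma> (int_vec_group k) \<Longrightarrow> subgroup_rank (int_vec_group k) \<Gamma> < enat k \<Longrightarrow>
           (\<Sum>\<^sub>\<infinity>p\<in>{p. prime p \<and> (\<lambda>i\<in>{1..k}. int (a i p)) \<notin> \<Gamma>}. ennreal (1 / real p)) = \<infinity>"
    and "compact (UNIV :: 'x set)"
    and "\<And>i. i \<in> {1..k} \<Longrightarrow> continuous_on UNIV (T i)"
    and "\<And>i j. i \<in> {1..k} \<Longrightarrow> j \<in> {1..k} \<Longrightarrow> T i \<circ> T j = T j \<circ> T i"
    and "borel_prob \<mu>"
    and "totally_uniquely_ergodic k \<mu> T"
    and "continuous_on UNIV f"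
  shows "(\<lambda>N. (\<Sum>n=1..N. f (multi_iterate k T (\<lambda>i. a i n) x)) / of_nat N)
           \<longlonglongrightarrow> (\<integral>y. f y \<partial>\<mu>)"
proof -
  note add = assms(2) and fin = assms(3) and div = assms(4) and compact = assms(5)
    and T = assms(6) and comm = assms(7) and \<mu> = assms(8) and tue = assms(9) and f = assms(10)
  define y where "y n = multi_iterate k T (\<lambda>i. a i n) x" for n
  define D where "D = {q. prime q \<and> (\<forall>L. \<exists>B. finite B \<and> B \<subseteq> {p. prime p \<and> (\<forall>i\<in>{1..k}. a i p = a i q)} \<and>
     L \<le> (\<Sum>p\<in>B. 1 / real p))}"
  define H where "H = (\<lambda>q. multi_iterate k T (\<lambda>i. a i q)) ` D"
  have H_cont: "continuous_on UNIV S" if "S \<in> H" for S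
    using that T by (auto simp: H_def intro: continuous_on_multi_iterate)
  have asym: "(\<lambda>N. (\<Sum>n=1..N. g (y n)) / real N - (\<Sum>n=1..N. g (S (y n))) / real N) \<longlonglongrightarrow> 0"
    if "S \<in> H" "continuous_on UNIV g" for S and g :: "'x \<Rightarrow> real"
  proof -
    obtain q where q: "q \<in> D" and S: "S = multi_iterate k T (\<lambda>i. a i q)" using \<open>S \<in> H\<close> by (auto simp: H_def)
    have divq: "\<exists>B. finite B \<and> B \<subseteq> {p. prime p \<and> (\<forall>i\<in>{1..k}. a i p = a i q)} \<and> L \<le> (\<Sum>p\<in>B. 1 / real p)" for L
      using q unfolding D_def by blast
    have pq: "prime q" using q by (simp add: D_def)
    show ?thesis
      unfolding y_def S
      by (rule orbit_averages_asymptotically_invariant) (fact add fin compact comm pq divq that(2))+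
  qed
  have unique: "\<Lambda> g = (\<integral>x. g x \<partial>\<mu>)"
    if \<Lambda>: "positive_functional \<Lambda>" and inv: "\<And>S g. S \<in> H \<Longrightarrow> continuous_on UNIV g \<Longrightarrow> \<Lambda> (\<lambda>x. g (S x)) = \<Lambda> g"
      and g: "continuous_on UNIV g" for \<Lambda> and g :: "'x \<Rightarrow> real"
  proof -
    interpret positive_functional \<Lambda> by (rule \<Lambda>)
    let ?\<Gamma> = "invariance_vectors k T \<Lambda>"
    have \<Gamma>: "subgroup ?\<Gamma> (int_vec_group k)"
      by (rule subgroup_invariance_vectors) (fact T comm)+
    \<comment> \<open>Were the rank smaller, the primes with colours outside this subgroup would
      have divergent reciprocal sum. But a single colour with divergent sum belongs to
      \<open>H\<close>, hence to the subgroup.\<close>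
    have "\<not> subgroup_rank (int_vec_group k) ?\<Gamma> < enat k"
    proof
      assume "subgroup_rank (int_vec_group k) ?\<Gamma> < enat k"
      then have inf: "(\<Sum>\<^sub>\<infinity>p\<in>{p. prime p \<and> (\<lambda>i\<in>{1..k}. int (a i p)) \<notin> ?\<Gamma>}. ennreal (1 / real p)) = \<infinity>"
        by (rule div[OF \<Gamma>])
      have "(\<Sum>\<^sub>\<infinity>p\<in>{p. prime p \<and> (\<lambda>i\<in>{1..k}. int (a i p)) \<notin> ?\<Gamma>}. ennreal (1 / real p)) \<noteq> \<infinity>"
      proof (rule finite_prime_reciprocals)
        have "finite ((\<lambda>p. \<lambda>i\<in>{1..k}. a i p) ` {p. prime p})"
          using fin by (intro finite_prime_values) auto
        then have "finite ((\<lambda>v. \<lambda>i\<in>{1..k}. int (v i)) ` (\<lambda>p. \<lambda>i\<in>{1..k}. a i p) ` {p. prime p})"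
          by (rule finite_imageI)
        then show "finite ((\<lambda>p. \<lambda>i\<in>{1..k}. int (a i p)) ` {p. prime p})"
          by (simp add: image_image cong: restrict_cong)
      next
        fix q assume q: "prime q" "(\<lambda>i\<in>{1..k}. int (a i q)) \<notin> ?\<Gamma>"
        have "q \<notin> D"
        proof
          assume "q \<in> D"
          then have "multi_iterate k T (\<lambda>i. a i q) \<in> H" by (simp add: H_def)
          \<comment> \<open>A colour is already natural, so the subtracted exponent vector can be
            zero.\<close>
          then have "(\<lambda>i\<in>{1..k}. int (a i q) - int 0) \<in> ?\<Gamma>"
            unfolding invariance_vectors_def using inv
            by (intro CollectI exI[of _ "\<lambda>i. a i q"] exI[of _ "\<lambda>_. 0"]) (simp add: multi_iterate_zero)
          then show False using q(2) by simp
        qed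
        then obtain L where L: "\<And>B. finite B \<Longrightarrow> B \<subseteq> {p. prime p \<and> (\<forall>i\<in>{1..k}. a i p = a i q)} \<Longrightarrow> (\<Sum>p\<in>B. 1 / real p) < L"
          using q(1) unfolding D_def by (auto simp: not_le)
        have "{p. prime p \<and> (\<lambda>i\<in>{1..k}. int (a i p)) = (\<lambda>i\<in>{1..k}. int (a i q))} \<subseteq> {p. prime p \<and> (\<forall>i\<in>{1..k}. a i p = a i q)}"
        proof safe
          fix p i assume "(\<lambda>i\<in>{1..k}. int (a i p)) = (\<lambda>i\<in>{1..k}. int (a i q))" "i \<in> {1..k}"
          then show "a i p = a i q" by (metis of_nat_eq_iff restrict_apply')
        qed
        then show "\<exists>L. \<forall>B. finite B \<and> B \<subseteq> {p. prime p \<and> (\<lambda>i\<in>{1..k}. int (a i p)) = (\<lambda>i\<in>{1..k}. int (a i q))} \<longrightarrow>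
            (\<Sum>p\<in>B. 1 / real p) \<le> L"
          using L by (meson less_imp_le subset_trans)
      qed
      then show False using inf by blast
    qed
    then have "\<exists>m\<ge>1. (\<lambda>j\<in>{1..k}. if j = i then int m else 0) \<in> ?\<Gamma>" if "i \<in> {1..k}" for i
      using full_rank_subgroup_multiple[OF \<Gamma>] that by blast
    then obtain m where m: "\<And>i. i \<in> {1..k} \<Longrightarrow> m i \<ge> 1"
      "\<And>i. i \<in> {1..k} \<Longrightarrow> (\<lambda>j\<in>{1..k}. if j = i then int (m i) else 0) \<in> ?\<Gamma>"
      by metis
    have "invariant_under riesz_measure (T i ^^ m i)" if i: "i \<in> {1..k}" for i
    proof (rule invariant_under_riesz_measure[OF \<Lambda>])
      show "continuous_on UNIV (T i ^^ m i)" using T[OF i] by (rule continuous_on_funpow)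
      show "\<Lambda> (\<lambda>x. g ((T i ^^ m i) x)) = \<Lambda> g" if g: "continuous_on UNIV g" for g
        by (rule invariance_vector_single[OF _ _ i m(2)[OF i] g]) (fact T comm)+
    qed
    \<comment> \<open>The exponents \<open>m\<close> depend on the functional, which is why unique
      ergodicity is needed for all powers.\<close>
    then have "riesz_measure = \<mu>"
      using tue m(1) borel_prob_riesz_measure unfolding totally_uniquely_ergodic_def by blast
    then show ?thesis using integral_riesz_measure[OF g] by simp
  qed
  have real_case: "(\<lambda>N. (\<Sum>n=1..N. g (y n)) / real N) \<longlonglongrightarrow> (\<integral>x. g x \<partial>\<mu>)"
    if g: "continuous_on UNIV g" for g :: "'x \<Rightarrow> real"
  proof (rule invariant_measure_unique_imp_convergence[where H = H])
    fix \<Lambda> assume \<Lambda>: "positive_functional \<Lambda>"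
      and inv: "\<And>S g. S \<in> H \<Longrightarrow> continuous_on UNIV g \<Longrightarrow> \<Lambda> (\<lambda>x. g (S x)) = \<Lambda> g"
    show "\<Lambda> g = (\<integral>x. g x \<partial>\<mu>)" by (rule unique) (fact \<Lambda> inv g)+
  qed (fact compact H_cont asym g)+
  interpret \<mu>: prob_space \<mu> using \<mu> by (simp add: borel_prob_def)
  have "integrable \<mu> f"
  proof -
    have "bounded (f ` UNIV)" using compact f by (intro compact_imp_bounded compact_continuous_image)
    then obtain b where "\<And>x. norm (f x) \<le> b" by (auto simp: bounded_iff)
    moreover have "f \<in> borel_measurable \<mu>"
      using \<mu> borel_measurable_continuous_onI[OF f] by (simp add: borel_prob_def cong: measurable_cong_sets)
    ultimately show ?thesis by (intro \<mu>.integrable_const_bound[of _ b]) auto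
  qed
  then have Re: "Re (\<integral>x. f x \<partial>\<mu>) = (\<integral>x. Re (f x) \<partial>\<mu>)" and Im: "Im (\<integral>x. f x \<partial>\<mu>) = (\<integral>x. Im (f x) \<partial>\<mu>)"
    by simp_all
  have "(\<lambda>N. Complex ((\<Sum>n=1..N. Re (f (y n))) / real N) ((\<Sum>n=1..N. Im (f (y n))) / real N))
      \<longlonglongrightarrow> Complex (\<integral>x. Re (f x) \<partial>\<mu>) (\<integral>x. Im (f x) \<partial>\<mu>)"
    using f by (intro tendsto_Complex real_case continuous_on_Re continuous_on_Im)
  moreover have "Complex ((\<Sum>n=1..N. Re (f (y n))) / real N) ((\<Sum>n=1..N. Im (f (y n))) / real N)
      = (\<Sum>n=1..N. f (y n)) / of_nat N" for N
    by (simp add: complex_eq_iff Re_divide_of_nat Im_divide_of_nat)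
  moreover have "Complex (\<integral>x. Re (f x) \<partial>\<mu>) (\<integral>x. Im (f x) \<partial>\<mu>) = (\<integral>x. f x \<partial>\<mu>)"
    using Re Im by (simp add: complex_eq_iff)
  ultimately show ?thesis unfolding y_def by simp
qed

end
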